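(* Let $t>0$. The function on strict partitions $$\varphi_t(\mu)=\frac{1}{(t)_n}\,\frac{\prod_{(i,j)\in\mu}(2t+(j-1)j)}{2^{\ell(\mu)}\prod_{i=1}^{\ell(\mu)}\mu_i!}\prod_{1\le i<j\le\ell(\mu)}\frac{\mu_i-\mu_j}{\mu_i+\mu_j},\qquad n=|\mu|,$$ is a positive harmonic function on the Schur graph, i.e. $\varphi_t>0$ and $\varphi_t(\mu)=\sum_{\lambda\searrow\mu}\varphi_t(\lambda)$ (sum over strict $\lambda$) for all strict $\mu$. Moreover, there is a multiplicative linear functional $\pi_t:\Gamma\to\mathbb C$ with $$\pi_t(P^*_\mu)=(-1)^n\frac{\prod_{(i,j)\in\mu}(2t+(j-1)j)}{2^{\ell(\mu)}\prod_{i=1}^{\ell(\mu)}\mu_i!}\prod_{1\le i<j\le\ell(\mu)}\frac{\mu_i-\mu_j}{\mu_i+\mu_j}$$ for all strict $\mu$, so that $\varphi_t(\mu)=(-1)^{|\mu|}\pi_t(P^*_\mu)/(t)_{|\mu|}$.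
   Context: A strict partition has pairwise distinct nonzero parts (the empty partition included); $\ell(\mu)$ is its number of nonzero parts and $(i,j)\in\mu$ ranges over boxes of its ordinary Young diagram. $\lambda\searrow\mu$ means $\lambda$ is obtained from $\mu$ by adding one box. $(t)_n=t(t+1)\cdots(t+n-1)$. $\Gamma$ is the subalgebra of the algebra of symmetric functions generated by the odd power sums $p_1,p_3,p_5,\dots$; its elements can be evaluated at sequences with finitely many nonzero terms, in particular at strict partitions $(\lambda_1,\lambda_2,\dots)$. $P_\mu$ is Schur's $P$-function. The factorial Schur $P$-function $P^*_\mu$ is the unique element of $\Gamma$ of degree $|\mu|$ whose top-degree homogeneous component is $P_\mu$ and which vanishes at every strict partition $\lambda\ne\mu$ with $|\lambda|\le|\mu|$; the $P^*_\mu$ form a basis of $\Gamma$. *)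

theory Defs
  imports Complex_Main "HOL-Library.Poly_Mapping"
begin

section \<open>Formal power series in countably many variables\<close>

text \<open>
  A monomial in the variables \<open>x\<^sub>0, x\<^sub>1, \<dots>\<close> is an element \<open>m\<close> of \<^typ>\<open>nat \<Rightarrow>\<^sub>0 nat\<close>;
  the exponent of \<open>x\<^sub>i\<close> in it is \<open>Poly_Mapping.lookup m i\<close>.
  A formal power series is an arbitrary assignment of complex coefficients to monomials.
\<close>

typedef pser = "UNIV :: ((nat \<Rightarrow>\<^sub>0 nat) \<Rightarrow> complex) set"
  morphisms coeff Abs_pser by simp

setup_lifting type_definition_pser

lemma pser_eqI: "(\<And>m. coeff f m = coeff g m) \<Longrightarrow> f = g"
  by (metis coeff_inject ext)

definition splits :: "(nat \<Rightarrow>\<^sub>0 nat) \<Rightarrow> ((nat \<Rightarrow>\<^sub>0 nat) \<times> (nat \<Rightarrow>\<^sub>0 nat)) set"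
  where "splits m = {(a, b). a + b = m}"

lemma finite_splits [simp]: "finite (splits m)"
proof -
  let ?K = "Poly_Mapping.keys m"
  let ?S = "{f. \<forall>x. (x \<in> ?K \<longrightarrow> f x \<in> {..Max (Poly_Mapping.lookup m ` ?K)}) \<and> (x \<notin> ?K \<longrightarrow> f x = (0::nat))}"
  have "finite ?S"
    by (rule finite_set_of_finite_funs) auto
  moreover have "Poly_Mapping.lookup ` fst ` splits m \<subseteq> ?S"
  proof clarsimp
    fix a b x assume "(a, b) \<in> splits m"
    then have m: "Poly_Mapping.lookup m x = Poly_Mapping.lookup a x + Poly_Mapping.lookup b x"
      by (auto simp: splits_def lookup_add)
    show "(x \<in> ?K \<longrightarrow> Poly_Mapping.lookup a x \<le> Max (Poly_Mapping.lookup m ` ?K)) \<and>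
          (x \<notin> ?K \<longrightarrow> Poly_Mapping.lookup a x = 0)"
    proof (intro conjI impI)
      assume "x \<in> ?K"
      then have "Poly_Mapping.lookup m x \<le> Max (Poly_Mapping.lookup m ` ?K)" by simp
      with m show "Poly_Mapping.lookup a x \<le> Max (Poly_Mapping.lookup m ` ?K)" by linarith
    next
      assume "x \<notin> ?K"
      with m show "Poly_Mapping.lookup a x = 0" by (simp add: in_keys_iff)
    qed
  qed
  ultimately have "finite (Poly_Mapping.lookup ` fst ` splits m)"
    by (rule finite_subset[rotated])
  then have "finite (fst ` splits m)"
    by (rule finite_imageD) (auto simp: inj_on_def poly_mapping_eqI)
  moreover have "inj_on fst (splits m)"
    by (auto simp: inj_on_def splits_def)
  ultimately show ?thesis
    by (rule finite_imageD)
qed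

instantiation pser :: comm_ring_1
begin

lift_definition zero_pser :: pser is "\<lambda>m. 0" .
lift_definition one_pser :: pser is "\<lambda>m. if m = 0 then 1 else 0" .
lift_definition plus_pser :: "pser \<Rightarrow> pser \<Rightarrow> pser" is "\<lambda>f g m. f m + g m" .
lift_definition minus_pser :: "pser \<Rightarrow> pser \<Rightarrow> pser" is "\<lambda>f g m. f m - g m" .
lift_definition uminus_pser :: "pser \<Rightarrow> pser" is "\<lambda>f m. - f m" .
lift_definition times_pser :: "pser \<Rightarrow> pser \<Rightarrow> pser"
  is "\<lambda>f g m. \<Sum>(a, b)\<in>splits m. f a * g b" .

instance
proof
  fix f g h :: pser
  show "f + g + h = f + (g + h)" by transfer (simp add: add.assoc)
  show "f + g = g + f" by transfer (simp add: add.commute)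
  show "0 + f = f" by transfer simp
  show "- f + f = 0" by transfer simp
  show "f - g = f + - g" by transfer simp
  show "(0::pser) \<noteq> 1" by transfer (metis one_neq_zero)
  show "(f + g) * h = f * h + g * h"
    by transfer (auto simp: distrib_right sum.distrib case_prod_unfold)
  show "f * g = g * f"
  proof (rule pser_eqI)
    fix m
    have "(\<Sum>(a, b)\<in>splits m. coeff f a * coeff g b) = (\<Sum>(a, b)\<in>splits m. coeff g a * coeff f b)"
      by (rule sum.reindex_bij_witness[of _ "\<lambda>(a, b). (b, a)" "\<lambda>(a, b). (b, a)"])
         (auto simp: splits_def add.commute)
    then show "coeff (f * g) m = coeff (g * f) m" by (simp add: times_pser.rep_eq)
  qed
  show "1 * f = f"
  proof (rule pser_eqI)
    fix m
    have "(\<Sum>p\<in>splits m. (if fst p = 0 then 1 else 0) * coeff f (snd p))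
        = (\<Sum>p\<in>{(0 :: nat \<Rightarrow>\<^sub>0 nat, m)}. (if fst p = 0 then 1 else 0) * coeff f (snd p))"
      by (intro sum.mono_neutral_right finite_splits) (auto simp: splits_def)
    then show "coeff (1 * f) m = coeff f m" by (simp add: times_pser.rep_eq one_pser.rep_eq case_prod_unfold)
  qed
  show "f * g * h = f * (g * h)"
  proof (rule pser_eqI)
    fix m
    have "coeff (f * g * h) m
        = (\<Sum>p\<in>splits m. \<Sum>q\<in>splits (fst p). coeff f (fst q) * coeff g (snd q) * coeff h (snd p))"
      by (simp add: times_pser.rep_eq case_prod_unfold sum_distrib_right)
    also have "\<dots> = (\<Sum>(p, q)\<in>(SIGMA p:splits m. splits (fst p)).
                      coeff f (fst q) * coeff g (snd q) * coeff h (snd p))"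
      by (rule sum.Sigma) auto
    also have "\<dots> = (\<Sum>(p, q)\<in>(SIGMA p:splits m. splits (snd p)).
                      coeff f (fst p) * (coeff g (fst q) * coeff h (snd q)))"
      by (rule sum.reindex_bij_witness[of _
            "\<lambda>((a, _), (b, c)). ((a + b, c), (a, b))" "\<lambda>((_, c), (a, b)). ((a, b + c), (b, c))"])
         (auto simp: splits_def add.assoc mult.assoc)
    also have "\<dots> = (\<Sum>p\<in>splits m. \<Sum>q\<in>splits (snd p). coeff f (fst p) * (coeff g (fst q) * coeff h (snd q)))"
      by (rule sum.Sigma[symmetric]) auto
    also have "\<dots> = coeff (f * (g * h)) m"
      by (simp add: times_pser.rep_eq case_prod_unfold sum_distrib_left)
    finally show "coeff (f * g * h) m = coeff (f * (g * h)) m" .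
  qed
qed

end

lift_definition scale :: "complex \<Rightarrow> pser \<Rightarrow> pser" is "\<lambda>c f m. c * f m" .

definition mdeg :: "(nat \<Rightarrow>\<^sub>0 nat) \<Rightarrow> nat"
  where "mdeg m = (\<Sum>i\<in>Poly_Mapping.keys m. Poly_Mapping.lookup m i)"

definition has_degree :: "pser \<Rightarrow> nat \<Rightarrow> bool"
  where "has_degree f n \<longleftrightarrow>
    (\<exists>m. coeff f m \<noteq> 0 \<and> mdeg m = n) \<and> (\<forall>m. coeff f m \<noteq> 0 \<longrightarrow> mdeg m \<le> n)"

lift_definition hom_component :: "nat \<Rightarrow> pser \<Rightarrow> pser"
  is "\<lambda>n f m. if mdeg m = n then f m else 0" .

text \<open>
  Evaluation at a sequence with finitely many nonzero terms.  If \<open>f\<close> has bounded degree, only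
  finitely many monomials contribute, and \<^const>\<open>Sum_any\<close> is the sum over these.
\<close>

definition eval_at :: "pser \<Rightarrow> (nat \<Rightarrow> complex) \<Rightarrow> complex"
  where "eval_at f x =
    Sum_any (\<lambda>m. coeff f m * (\<Prod>i\<in>Poly_Mapping.keys m. x i ^ Poly_Mapping.lookup m i))"

section \<open>Symmetric functions and the algebra \<open>\<Gamma>\<close>\<close>

definition symmetric_functions :: "pser set"
  where "symmetric_functions = {f.
    (\<exists>d. \<forall>m. coeff f m \<noteq> 0 \<longrightarrow> mdeg m \<le> d) \<and>
    (\<forall>\<sigma> m m'. bij \<sigma> \<longrightarrow> (\<forall>i. Poly_Mapping.lookup m' i = Poly_Mapping.lookup m (\<sigma> i)) \<longrightarrow>
       coeff f m' = coeff f m)}"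

lift_definition power_sum :: "nat \<Rightarrow> pser"
  is "\<lambda>k m. if \<exists>i. m = Poly_Mapping.single i k then 1 else 0" .

text \<open>
  The subalgebra generated by the odd power sums.  The generation takes place inside the algebra of
  symmetric functions, see \<open>Gamma_subset_symmetric_functions\<close> below.
\<close>

inductive_set Gamma :: "pser set" where
  odd_power_sum: "odd k \<Longrightarrow> power_sum k \<in> Gamma"
| one: "1 \<in> Gamma"
| add: "f \<in> Gamma \<Longrightarrow> g \<in> Gamma \<Longrightarrow> f + g \<in> Gamma"
| scale: "f \<in> Gamma \<Longrightarrow> scale c f \<in> Gamma"
| mult: "f \<in> Gamma \<Longrightarrow> g \<in> Gamma \<Longrightarrow> f * g \<in> Gamma"

lemma mdeg_superset:
  assumes "finite A" "Poly_Mapping.keys m \<subseteq> A"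
  shows "mdeg m = (\<Sum>i\<in>A. Poly_Mapping.lookup m i)"
  unfolding mdeg_def using assms by (intro sum.mono_neutral_left) (auto simp: in_keys_iff)

lemma mdeg_add: "mdeg (a + b) = mdeg a + mdeg b"
proof -
  let ?A = "Poly_Mapping.keys a \<union> Poly_Mapping.keys b"
  have "mdeg (a + b) = (\<Sum>i\<in>?A. Poly_Mapping.lookup (a + b) i)"
    by (rule mdeg_superset) (auto simp: keys_add)
  then show ?thesis
    using mdeg_superset[of ?A a] mdeg_superset[of ?A b]
    by (simp add: lookup_add sum.distrib)
qed

lemma symmetric_functions_mult:
  assumes f: "f \<in> symmetric_functions" and g: "g \<in> symmetric_functions"
  shows "f * g \<in> symmetric_functions"
  unfolding symmetric_functions_def
proof (intro CollectI conjI allI impI)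
  from f g obtain d e where d: "\<And>m. coeff f m \<noteq> 0 \<Longrightarrow> mdeg m \<le> d"
    and e: "\<And>m. coeff g m \<noteq> 0 \<Longrightarrow> mdeg m \<le> e"
    unfolding symmetric_functions_def by blast
  have "mdeg m \<le> d + e" if "coeff (f * g) m \<noteq> 0" for m
  proof -
    from that obtain a b where "(a, b) \<in> splits m" "coeff f a * coeff g b \<noteq> 0"
      unfolding times_pser.rep_eq by (metis (mono_tags, lifting) case_prodE2 sum.neutral surj_pair case_prod_conv)
    then show ?thesis
      using d[of a] e[of b] by (auto simp: splits_def mdeg_add intro: add_mono)
  qed
  then show "\<exists>d. \<forall>m. coeff (f * g) m \<noteq> 0 \<longrightarrow> mdeg m \<le> d" by blast
next
  fix \<sigma> :: "nat \<Rightarrow> nat" and m m' :: "nat \<Rightarrow>\<^sub>0 nat"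
  assume s: "bij \<sigma>" and m: "\<forall>i. Poly_Mapping.lookup m' i = Poly_Mapping.lookup m (\<sigma> i)"
  have inv: "bij (inv \<sigma>)" "\<And>i. \<sigma> (inv \<sigma> i) = i" "\<And>i. inv \<sigma> (\<sigma> i) = i"
    using s by (auto simp: bij_imp_bij_inv bij_is_surj surj_f_inv_f bij_is_inj)
  let ?F = "Poly_Mapping.map_key \<sigma> :: (nat \<Rightarrow>\<^sub>0 nat) \<Rightarrow> _"
  let ?G = "Poly_Mapping.map_key (inv \<sigma>) :: (nat \<Rightarrow>\<^sub>0 nat) \<Rightarrow> _"
  have F: "Poly_Mapping.lookup (?F a) i = Poly_Mapping.lookup a (\<sigma> i)" for a i
    using s by (simp add: map_key.rep_eq bij_is_inj)
  have G: "Poly_Mapping.lookup (?G a) i = Poly_Mapping.lookup a (inv \<sigma> i)" for a i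
    using inv(1) by (simp add: map_key.rep_eq bij_is_inj)
  have cf: "coeff f (?F a) = coeff f a" and cg: "coeff g (?F a) = coeff g a" for a
    using f g s F unfolding symmetric_functions_def by blast+
  have GF: "?G (?F a) = a" and FG: "?F (?G a) = a" for a
    by (simp_all add: poly_mapping_eq_iff fun_eq_iff F G inv)
  have F_add: "?F (a + b) = ?F a + ?F b" and G_add: "?G (a + b) = ?G a + ?G b" for a b
    by (simp_all add: poly_mapping_eq_iff fun_eq_iff F G lookup_add)
  have m': "m' = ?F m"
    using m by (simp add: poly_mapping_eq_iff fun_eq_iff F)
  have "(\<Sum>p\<in>splits m'. coeff f (fst p) * coeff g (snd p)) = (\<Sum>p\<in>splits m. coeff f (fst p) * coeff g (snd p))"
    by (rule sum.reindex_bij_witness[of _ "\<lambda>p. (?F (fst p), ?F (snd p))" "\<lambda>p. (?G (fst p), ?G (snd p))"])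
       (auto simp: splits_def m' GF FG simp flip: F_add G_add, (metis FG cf cg)+)
  then show "coeff (f * g) m' = coeff (f * g) m"
    by (simp add: times_pser.rep_eq case_prod_unfold)
qed

lemma Gamma_subset_symmetric_functions: "Gamma \<subseteq> symmetric_functions"
proof
  fix f assume "f \<in> Gamma"
  then show "f \<in> symmetric_functions"
  proof induction
    case (odd_power_sum k)
    have deg: "mdeg (Poly_Mapping.single i k) = k" for i
      by (simp add: mdeg_def)
    have perm: "(\<exists>i. m' = Poly_Mapping.single i k) \<longleftrightarrow> (\<exists>i. m = Poly_Mapping.single i k)"
      if s: "bij \<sigma>" and m: "\<forall>i. Poly_Mapping.lookup m' i = Poly_Mapping.lookup m (\<sigma> i)"
      for \<sigma> :: "nat \<Rightarrow> nat" and m m'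
    proof -
      have "m' = Poly_Mapping.single i k \<longleftrightarrow> m = Poly_Mapping.single (\<sigma> i) k" for i
      proof -
        have "m = Poly_Mapping.single (\<sigma> i) k \<longleftrightarrow>
            (\<forall>j. Poly_Mapping.lookup m (\<sigma> j) = Poly_Mapping.lookup (Poly_Mapping.single (\<sigma> i) k) (\<sigma> j))"
          unfolding poly_mapping_eq_iff fun_eq_iff using s by (metis bij_pointE)
        also have "\<dots> \<longleftrightarrow> m' = Poly_Mapping.single i k"
          unfolding poly_mapping_eq_iff fun_eq_iff using s m
          by (simp add: lookup_single when_def inj_eq bij_is_inj)
        finally show ?thesis by simp
      qed
      then show ?thesis using s by (metis bij_pointE)
    qed
    have cf: "coeff (power_sum k) m = (if \<exists>i. m = Poly_Mapping.single i k then 1 else 0)" for m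
      by (simp add: power_sum.rep_eq)
    have "coeff (power_sum k) m \<noteq> 0 \<Longrightarrow> mdeg m \<le> k" for m
      unfolding cf using deg by (auto split: if_splits)
    moreover have "coeff (power_sum k) m' = coeff (power_sum k) m"
      if "bij \<sigma>" "\<forall>i. Poly_Mapping.lookup m' i = Poly_Mapping.lookup m (\<sigma> i)" for \<sigma> m m'
      unfolding cf using perm[OF that] by simp
    ultimately show ?case unfolding symmetric_functions_def by blast
  next
    case one
    have "(m' = 0) = (m = 0)"
      if "bij \<sigma>" "\<forall>i. Poly_Mapping.lookup m' i = Poly_Mapping.lookup m (\<sigma> i)"
      for \<sigma> :: "nat \<Rightarrow> nat" and m m' :: "nat \<Rightarrow>\<^sub>0 nat"
      using that unfolding poly_mapping_eq_iff fun_eq_iff by simp (metis bij_pointE)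
    note zero = this
    have cf: "coeff 1 m = (if m = 0 then 1 else 0)" for m
      by (simp add: one_pser.rep_eq)
    have "coeff 1 m \<noteq> 0 \<Longrightarrow> mdeg m \<le> 0" for m
      unfolding cf by (simp add: mdeg_def split: if_splits)
    moreover have "coeff 1 m' = coeff 1 m"
      if "bij \<sigma>" "\<forall>i. Poly_Mapping.lookup m' i = Poly_Mapping.lookup m (\<sigma> i)" for \<sigma> m m'
      unfolding cf using zero[OF that] by simp
    ultimately show ?case unfolding symmetric_functions_def by blast
  next
    case (add f g)
    from add.IH obtain d e where d: "\<And>m. coeff f m \<noteq> 0 \<Longrightarrow> mdeg m \<le> d"
      and e: "\<And>m. coeff g m \<noteq> 0 \<Longrightarrow> mdeg m \<le> e"
      unfolding symmetric_functions_def by blast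
    have "mdeg m \<le> max d e" if "coeff (f + g) m \<noteq> 0" for m
      using that d[of m] e[of m] by (cases "coeff f m = 0") (auto simp: plus_pser.rep_eq)
    moreover have "coeff (f + g) m' = coeff (f + g) m"
      if "bij \<sigma>" "\<forall>i. Poly_Mapping.lookup m' i = Poly_Mapping.lookup m (\<sigma> i)" for \<sigma> m m'
    proof -
      have "coeff f m' = coeff f m" "coeff g m' = coeff g m"
        using add.IH that unfolding symmetric_functions_def by blast+
      then show ?thesis by (simp add: plus_pser.rep_eq)
    qed
    ultimately show ?case unfolding symmetric_functions_def by blast
  next
    case (scale f c)
    then show ?case
      unfolding symmetric_functions_def scale.rep_eq mem_Collect_eq mult_eq_0_iff
      by metis
  next
    case (mult f g)
    then show ?case by (simp add: symmetric_functions_mult)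
  qed
qed

section \<open>Strict partitions and the Schur graph\<close>

definition strict_partition :: "nat list \<Rightarrow> bool"
  where "strict_partition \<mu> \<longleftrightarrow> sorted_wrt (>) \<mu> \<and> 0 \<notin> set \<mu>"

definition boxes :: "nat list \<Rightarrow> (nat \<times> nat) set"
  where "boxes \<mu> = {(i, j). 1 \<le> i \<and> i \<le> length \<mu> \<and> 1 \<le> j \<and> j \<le> \<mu> ! (i - 1)}"

definition covers :: "nat list \<Rightarrow> nat list \<Rightarrow> bool"  (infix "\<searrow>" 50)
  where "\<nu> \<searrow> \<mu> \<longleftrightarrow> (\<exists>b. b \<notin> boxes \<mu> \<and> boxes \<nu> = insert b (boxes \<mu>))"

definition positive_harmonic :: "(nat list \<Rightarrow> real) \<Rightarrow> bool"
  where "positive_harmonic \<phi> \<longleftrightarrow> (\<forall>\<mu>. strict_partition \<mu> \<longrightarrow>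
    \<phi> \<mu> > 0 \<and> \<phi> \<mu> = (\<Sum>\<nu> | strict_partition \<nu> \<and> \<nu> \<searrow> \<mu>. \<phi> \<nu>))"

definition partition_seq :: "nat list \<Rightarrow> nat \<Rightarrow> complex"
  where "partition_seq \<mu> i = (if i < length \<mu> then of_nat (\<mu> ! i) else 0)"

section \<open>Schur's \<open>P\<close>-functions and their factorial analogues\<close>

text \<open>
  Schur's definition: \<open>\<Sum>\<^sub>r q\<^sub>r z\<^sup>r = \<Prod>\<^sub>i (1 + x\<^sub>i z) / (1 - x\<^sub>i z)\<close>, and
  \<open>Q\<^sub>\<mu>\<close> is the Pfaffian of the matrix with entries \<open>Q\<^sub>(\<^sub>r\<^sub>,\<^sub>s\<^sub>)\<close> for \<open>r, s\<close> running over the parts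
  of \<open>\<mu>\<close>, to which a part \<open>0\<close> is appended if their number is odd; finally
  \<open>P\<^sub>\<mu> = 2\<^sup>-\<^sup>l Q\<^sub>\<mu>\<close> with \<open>l = \<ell>(\<mu>)\<close>.
  Since \<open>(1 + y) / (1 - y) = 1 + 2y + 2y\<^sup>2 + \<dots>\<close>, the coefficient in \<open>q\<^sub>r\<close> of a monomial of degree
  \<open>r\<close> is \<open>2\<close> to the number of variables occurring in it.
\<close>

lift_definition schur_q :: "nat \<Rightarrow> pser"
  is "\<lambda>r m. if mdeg m = r then 2 ^ card (Poly_Mapping.keys m) else 0" .

definition schur_Q2 :: "nat \<Rightarrow> nat \<Rightarrow> pser"
  where "schur_Q2 r s =
    schur_q r * schur_q s + 2 * (\<Sum>i=1..s. (- 1) ^ i * schur_q (r + i) * schur_q (s - i))"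

text \<open>
  \<open>pfaffian A [k\<^sub>1, \<dots>, k\<^sub>n]\<close> is the Pfaffian of the skew-symmetric matrix whose entries above
  the diagonal are \<open>A k\<^sub>a k\<^sub>b\<close>, \<open>a < b\<close>, by expansion along the first row.  The entries on and
  below the diagonal are never used, so \<open>A\<close> itself need not be skew-symmetric.
\<close>

function pfaffian :: "('i \<Rightarrow> 'i \<Rightarrow> 'a :: comm_ring_1) \<Rightarrow> 'i list \<Rightarrow> 'a" where
  "pfaffian A [] = 1"
| "pfaffian A (k # ks) =
    (\<Sum>j<length ks. (- 1) ^ j * A k (ks ! j) * pfaffian A (take j ks @ drop (Suc j) ks))"
  by pat_completeness auto
termination by (relation "measure (length \<circ> snd)") auto

definition schur_Q :: "nat list \<Rightarrow> pser"
  where "schur_Q \<mu> = pfaffian schur_Q2 (if even (length \<mu>) then \<mu> else \<mu> @ [0])"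

definition schur_P :: "nat list \<Rightarrow> pser"
  where "schur_P \<mu> = scale (1 / 2 ^ length \<mu>) (schur_Q \<mu>)"

definition factorial_schur_P :: "nat list \<Rightarrow> pser"
  where "factorial_schur_P \<mu> = (THE f. f \<in> Gamma \<and>
    has_degree f (sum_list \<mu>) \<and> hom_component (sum_list \<mu>) f = schur_P \<mu> \<and>
    (\<forall>\<nu>. strict_partition \<nu> \<longrightarrow> \<nu> \<noteq> \<mu> \<longrightarrow> sum_list \<nu> \<le> sum_list \<mu> \<longrightarrow>
       eval_at f (partition_seq \<nu>) = 0))"

definition multiplicative_functional :: "(pser \<Rightarrow> complex) \<Rightarrow> bool"
  where "multiplicative_functional \<pi> \<longleftrightarrow>
    (\<forall>f\<in>Gamma. \<forall>g\<in>Gamma. \<pi> (f + g) = \<pi> f + \<pi> g) \<and>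
    (\<forall>c. \<forall>f\<in>Gamma. \<pi> (scale c f) = c * \<pi> f) \<and>
    (\<forall>f\<in>Gamma. \<forall>g\<in>Gamma. \<pi> (f * g) = \<pi> f * \<pi> g) \<and>
    \<pi> 1 = 1"

section \<open>The functions \<open>\<phi>\<^sub>t\<close>\<close>

definition schur_weight :: "real \<Rightarrow> nat list \<Rightarrow> real"
  where "schur_weight t \<mu> =
    (\<Prod>(i, j)\<in>boxes \<mu>. 2 * t + (real j - 1) * real j) /
      (2 ^ length \<mu> * (\<Prod>i<length \<mu>. fact (\<mu> ! i))) *
    (\<Prod>(i, j)\<in>{(i, j). i < j \<and> j < length \<mu>}.
      (real (\<mu> ! i) - real (\<mu> ! j)) / (real (\<mu> ! i) + real (\<mu> ! j)))"

definition phi :: "real \<Rightarrow> nat list \<Rightarrow> real"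
  where "phi t \<mu> = 1 / pochhammer t (sum_list \<mu>) * schur_weight t \<mu>"

end

theory Submission
  imports Defs "HOL-Computational_Algebra.Formal_Power_Series" "HOL-Computational_Algebra.Polynomial"
begin

text \<open>
  Harmonicity.  With \<open>x\<^sub>k = \<mu>\<^sub>k (\<mu>\<^sub>k + 1)\<close> and \<open>y\<^sub>k = \<mu>\<^sub>k (\<mu>\<^sub>k - 1)\<close>, the ratios of the weights of the covers of
  \<open>\<mu>\<close> to that of \<open>\<mu>\<close> are the residues of \<open>(2t + z) / (2z) \<Prod>\<^sub>k (z - y\<^sub>k) / (z - x\<^sub>k)\<close>, the new part \<open>1\<close>
  belonging to the pole at \<open>0\<close>; they sum to \<open>t + |\<mu>|\<close>.

  The functional.  For \<open>f \<in> \<Gamma>\<close> the value at the staircase \<open>(k, k - 1, \<dots>, 1)\<close> is a polynomial in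
  \<open>k (k + 1) / 2\<close>, and \<open>\<pi>\<^sub>t(f)\<close> is the value of this polynomial at \<open>-t\<close>; multiplicativity is then automatic.
  The function \<open>P\<^sup>*\<^sub>\<mu>\<close> is the Pfaffian for \<open>P\<^sub>\<mu>\<close> with the powers in the generating function of the \<open>Q\<^sub>r\<^sub>,\<^sub>s\<close>
  replaced by falling factorials: its value at a strict partition expands into Schur Pfaffians of
  words in the parts, which gives the vanishing property.  At a staircase the entries of the
  Pfaffian are \<open>(r - s) / (r + s) L\<^sub>r L\<^sub>s\<close>, so Schur's Pfaffian identity applies once more and gives
  the product formula.
\<close>

hide_const (open) Polynomial.coeff

section \<open>Harmonicity\<close>

text \<open>Why staircases and why \<open>-t\<close>: with \<open>\<tau> = k (k + 1) / 2\<close>,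
  the size of the staircase, the factor \<open>2 \<tau> - (j - 1) j\<close> equals
  \<open>(k - j + 1) (k + j)\<close>, which is what residues at the nodes \<open>0, ..., k\<close>
  produce. At \<open>\<tau> = -t\<close> it becomes \<open>-(2 t + (j - 1) j)\<close>, one sign for
  each box, hence \<open>(-1)^n\<close>. Two obstacles shape the second half. The function
  \<open>P*_\<mu>\<close> is given only by a characterization, so a Pfaffian candidate must be shown
  to satisfy it and to be the only solution; uniqueness is a dimension count against products of the
  \<open>q_r\<close> indexed by strict partitions. And the kernel of the double residue is undefined
  at \<open>(0, 0)\<close>, a pair of nodes that always occurs, so the formulas for
  \<open>Q_{r,s}\<close> require \<open>r > 0\<close>. The padding zero of an odd partition
  therefore has to stand last: a Pfaffian reads only entries above the diagonal, and their first
  index is then positive.\<close>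

lemma partial_fractions:
  fixes x y :: "'i \<Rightarrow> 'a :: field"
  assumes "finite I" "inj_on x I"
  defines "r \<equiv> \<lambda>I i. (x i - y i) * (\<Prod>j\<in>I - {i}. (x i - y j) / (x i - x j))"
  shows partial_fractions_prod: "z \<notin> x ` I \<Longrightarrow>
      (\<Prod>i\<in>I. (z - y i) / (z - x i)) = 1 + (\<Sum>i\<in>I. r I i / (z - x i))"
    and partial_fractions_residue_sum: "(\<Sum>i\<in>I. r I i) = (\<Sum>i\<in>I. x i - y i)"
proof -
  \<comment> \<open>\<open>r I i\<close> is the residue of the product at \<open>x i\<close>, and
    the sum of the residues is the coefficient of \<open>1 / z\<close> at infinity. One induction
    serves both, because the residue at a new node \<open>k\<close> is computed from the product
    formula at \<open>z = x k\<close>.\<close>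
  have "(\<forall>z. z \<notin> x ` I \<longrightarrow> (\<Prod>i\<in>I. (z - y i) / (z - x i)) = 1 + (\<Sum>i\<in>I. r I i / (z - x i)))
     \<and> (\<Sum>i\<in>I. r I i) = (\<Sum>i\<in>I. x i - y i)"
    using assms(1,2)
  proof (induction I rule: finite_induct)
    case empty
    then show ?case by simp
  next
    case (insert k I)
    then have k: "x k \<notin> x ` I" by auto
    have IH: "(\<Prod>i\<in>I. (z - y i) / (z - x i)) = 1 + (\<Sum>i\<in>I. r I i / (z - x i))" if "z \<notin> x ` I" for z
      using insert that by auto
    have IHs: "(\<Sum>i\<in>I. r I i) = (\<Sum>i\<in>I. x i - y i)"
      using insert by auto
    have ri: "r (insert k I) i = r I i * ((x i - y k) / (x i - x k))" if "i \<in> I" for i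
    proof -
      have "insert k I - {i} = insert k (I - {i})" using insert that by auto
      then show ?thesis using insert by (simp add: r_def)
    qed
    have rk: "r (insert k I) k = (x k - y k) * (1 + (\<Sum>i\<in>I. r I i / (x k - x i)))"
      using insert IH[OF k] by (simp add: r_def)
    have "(\<Prod>i\<in>insert k I. (z - y i) / (z - x i)) = 1 + (\<Sum>i\<in>insert k I. r (insert k I) i / (z - x i))"
      if z: "z \<notin> x ` insert k I" for z
    proof -
      have zk: "z - x k \<noteq> 0" and zI: "z \<notin> x ` I" using z by auto
      have "(\<Sum>i\<in>insert k I. r (insert k I) i / (z - x i))
          = (x k - y k) / (z - x k) + (\<Sum>i\<in>I. r I i * ((x k - y k) / ((x k - x i) * (z - x k))
              + (x i - y k) / ((x i - x k) * (z - x i))))"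
      proof -
        have "(x k - y k) * (1 + (\<Sum>i\<in>I. r I i / (x k - x i))) / (z - x k)
          = (x k - y k) / (z - x k) + (\<Sum>i\<in>I. r I i * ((x k - y k) / ((x k - x i) * (z - x k))))"
          by (simp add: distrib_left add_divide_distrib sum_distrib_left sum_divide_distrib mult_ac)
        moreover have "(\<Sum>i\<in>I. r (insert k I) i / (z - x i))
          = (\<Sum>i\<in>I. r I i * ((x i - y k) / ((x i - x k) * (z - x i))))"
          by (intro sum.cong) (auto simp: ri)
        ultimately show ?thesis
          using insert by (simp add: rk distrib_left sum.distrib add.assoc)
      qed
      also have "\<dots> = (x k - y k) / (z - x k) + (\<Sum>i\<in>I. r I i * ((z - y k) / ((z - x k) * (z - x i))))"
      proof -
        have "(x k - y k) / ((x k - x i) * (z - x k)) + (x i - y k) / ((x i - x k) * (z - x i))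
            = (z - y k) / ((z - x k) * (z - x i))" if "i \<in> I" for i
        proof -
          have "x k \<noteq> x i" using that k by (metis imageI)
          then have "x k - x i \<noteq> 0" "x i - x k \<noteq> 0" "z - x i \<noteq> 0"
            using that z by auto
          then show ?thesis using zk
            by (simp add: divide_simps) (simp add: algebra_simps)
        qed
        then show ?thesis by simp
      qed
      also have "\<dots> = (x k - y k) / (z - x k) + (z - y k) / (z - x k) * (\<Sum>i\<in>I. r I i / (z - x i))"
        by (simp add: sum_distrib_left mult_ac)
      finally show ?thesis
        using insert zk by (simp add: IH[OF zI] divide_simps) (simp add: algebra_simps)
    qed
    moreover have "(\<Sum>i\<in>insert k I. r (insert k I) i) = (\<Sum>i\<in>insert k I. x i - y i)"
    proof -
      have "(\<Sum>i\<in>insert k I. r (insert k I) i)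
         = (x k - y k) + (\<Sum>i\<in>I. r I i * ((x k - y k) / (x k - x i) + (x i - y k) / (x i - x k)))"
        using insert by (simp add: rk ri sum.distrib sum_distrib_left algebra_simps)
      also have "\<dots> = (x k - y k) + (\<Sum>i\<in>I. r I i)"
      proof -
        have "(x k - y k) / (x k - x i) + (x i - y k) / (x i - x k) = 1" if "i \<in> I" for i
        proof -
          have "x k \<noteq> x i" using that k by (metis imageI)
          then have "x k - x i \<noteq> 0" "x i - x k \<noteq> 0" by auto
          then show ?thesis by (simp add: divide_simps) (simp add: algebra_simps)
        qed
        then show ?thesis by simp
      qed
      finally show ?thesis using insert IHs by simp
    qed
    ultimately show ?case by blast
  qed
  then show "z \<notin> x ` I \<Longrightarrow>
      (\<Prod>i\<in>I. (z - y i) / (z - x i)) = 1 + (\<Sum>i\<in>I. r I i / (z - x i))"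
    and "(\<Sum>i\<in>I. r I i) = (\<Sum>i\<in>I. x i - y i)" by auto
qed

section \<open>Weights as functions of the set of parts\<close>

definition set_weight :: "real \<Rightarrow> nat set \<Rightarrow> real"
  where "set_weight t M = (\<Prod>m\<in>M. (\<Prod>j=1..m. 2 * t + (real j - 1) * real j) / (2 * fact m)) *
    (\<Prod>(a, b)\<in>{(a, b). a \<in> M \<and> b \<in> M \<and> b < a}. (real a - real b) / (real a + real b))"

text \<open>Parts enter as a set because adding a box replaces one element \<open>m\<close> by
  \<open>Suc m\<close>. The inserted element may lie above or below the others, hence the absolute
  values.\<close>

lemma set_weight_insert:
  assumes "finite M" "c \<notin> M"
  shows "set_weight t (insert c M) = set_weight t M *
    ((\<Prod>j=1..c. 2 * t + (real j - 1) * real j) / (2 * fact c)) *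
    (\<Prod>b\<in>M. \<bar>real c - real b\<bar> / (real c + real b))"
proof -
  let ?h = "\<lambda>(a, b). (real a - real b) / (real a + real b)"
  let ?U = "{b \<in> M. b < c}" and ?V = "{a \<in> M. c < a}"
  have M: "M = ?U \<union> ?V" using assms(2) by (auto, metis linorder_neqE_nat)
  have fin: "finite {(a, b). a \<in> M \<and> b \<in> M \<and> b < a}"
    by (rule finite_subset[of _ "M \<times> M"]) (auto simp: assms)
  have "{(a, b). a \<in> insert c M \<and> b \<in> insert c M \<and> b < a}
      = {(a, b). a \<in> M \<and> b \<in> M \<and> b < a} \<union> ((\<lambda>b. (c, b)) ` ?U \<union> (\<lambda>a. (a, c)) ` ?V)"
    by auto
  then have "prod ?h {(a, b). a \<in> insert c M \<and> b \<in> insert c M \<and> b < a}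
      = prod ?h {(a, b). a \<in> M \<and> b \<in> M \<and> b < a} * prod ?h ((\<lambda>b. (c, b)) ` ?U \<union> (\<lambda>a. (a, c)) ` ?V)"
    by (simp only:) (rule prod.union_disjoint, use fin assms in auto)
  also have "prod ?h ((\<lambda>b. (c, b)) ` ?U \<union> (\<lambda>a. (a, c)) ` ?V)
      = prod ?h ((\<lambda>b. (c, b)) ` ?U) * prod ?h ((\<lambda>a. (a, c)) ` ?V)"
    using assms by (auto intro!: prod.union_disjoint)
  also have "prod ?h ((\<lambda>b. (c, b)) ` ?U) = (\<Prod>b\<in>?U. \<bar>real c - real b\<bar> / (real c + real b))"
    by (subst prod.reindex) (auto simp: inj_on_def intro!: prod.cong)
  also have "prod ?h ((\<lambda>a. (a, c)) ` ?V) = (\<Prod>b\<in>?V. \<bar>real c - real b\<bar> / (real c + real b))"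
    by (subst prod.reindex) (auto simp: inj_on_def intro!: prod.cong)
  also have "(\<Prod>b\<in>?U. \<bar>real c - real b\<bar> / (real c + real b)) * (\<Prod>b\<in>?V. \<bar>real c - real b\<bar> / (real c + real b))
     = (\<Prod>b\<in>?U \<union> ?V. \<bar>real c - real b\<bar> / (real c + real b))"
    by (rule prod.union_disjoint[symmetric]) (auto simp: assms)
  also note M[symmetric]
  finally show ?thesis
    using assms by (simp add: set_weight_def)
qed

lemma set_weight_pos:
  assumes "finite M" "t > 0" "0 \<notin> M"
  shows "set_weight t M > 0"
  using assms
proof (induction M rule: finite_induct)
  case empty
  then show ?case by (simp add: set_weight_def)
next
  case (insert c M)
  have "(\<Prod>j=1..c. 2 * t + (real j - 1) * real j) > 0"
    using insert by (intro prod_pos) (auto intro!: add_pos_nonneg)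
  moreover have "(\<Prod>b\<in>M. \<bar>real c - real b\<bar> / (real c + real b)) > 0"
    using insert by (intro prod_pos) (auto intro!: divide_pos_pos)
  ultimately show ?case
    using insert by (simp add: set_weight_insert)
qed

lemma abs_ratio:
  fixes A B C D :: real
  assumes "A > 0 \<and> B > 0 \<or> A < 0 \<and> B < 0" "D \<noteq> 0"
  shows "\<bar>A\<bar> / C = \<bar>B\<bar> / D * (A * D / (B * C))"
  using assms by (auto simp: divide_simps)

text \<open>With \<open>x_m = m (m + 1)\<close> and \<open>y_b = b (b - 1)\<close> one has
  \<open>x_m - y_b = (m + 1 - b) (m + b)\<close> and \<open>x_m - x_b = (m - b) (m + 1 + b)\<close>.
  The absolute values drop out because \<open>m - b\<close> and \<open>m + 1 - b\<close> have the
  same sign when \<open>b\<close> is neither \<open>m\<close> nor \<open>m + 1\<close>.\<close>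

lemma set_weight_Suc:
  assumes "finite N" "m \<notin> N" "Suc m \<notin> N" "0 \<notin> N" "m > 0"
  shows "set_weight t (insert (Suc m) N) = set_weight t (insert m N) *
    ((2 * t + real m * (real m + 1)) / (real m + 1)) *
    (\<Prod>b\<in>N. (real m * (real m + 1) - real b * (real b - 1)) / (real m * (real m + 1) - real b * (real b + 1)))"
proof -
  have "\<bar>real (Suc m) - real b\<bar> / (real (Suc m) + real b)
     = \<bar>real m - real b\<bar> / (real m + real b) *
       ((real m * (real m + 1) - real b * (real b - 1)) / (real m * (real m + 1) - real b * (real b + 1)))"
    if "b \<in> N" for b
  proof -
    have b: "b \<noteq> m" "b \<noteq> Suc m" using that assms by auto
    have 1: "real m * (real m + 1) - real b * (real b - 1) = (real (Suc m) - real b) * (real m + real b)"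
      and 2: "real m * (real m + 1) - real b * (real b + 1) = (real m - real b) * (real (Suc m) + real b)"
      by (simp_all add: algebra_simps)
    have 3: "real m + real b > 0" using assms(5) by simp
    from b have "real m - real b > 0 \<and> real (Suc m) - real b > 0 \<or> real m - real b < 0 \<and> real (Suc m) - real b < 0"
      by linarith
    then show ?thesis
      unfolding 1 2 using 3 by (intro abs_ratio) auto
  qed
  then have "(\<Prod>b\<in>N. \<bar>real (Suc m) - real b\<bar> / (real (Suc m) + real b))
    = (\<Prod>b\<in>N. \<bar>real m - real b\<bar> / (real m + real b)) *
      (\<Prod>b\<in>N. (real m * (real m + 1) - real b * (real b - 1)) / (real m * (real m + 1) - real b * (real b + 1)))"
    by (simp flip: prod.distrib)
  moreover have "(\<Prod>j=1..Suc m. 2 * t + (real j - 1) * real j) / (2 * fact (Suc m))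
     = (\<Prod>j=1..m. 2 * t + (real j - 1) * real j) / (2 * fact m) * ((2 * t + real m * (real m + 1)) / (real m + 1))"
    by (simp add: divide_simps mult_ac add_ac)
  ultimately show ?thesis
    using assms by (simp only: set_weight_insert[OF assms(1,3)] set_weight_insert[OF assms(1,2)]) (simp add: mult_ac)
qed

lemma set_weight_harmonic:
  assumes "finite M" "0 \<notin> M"
  shows "(\<Sum>m\<in>{m \<in> insert 0 M. Suc m \<notin> M}. set_weight t (insert (Suc m) (M - {m})))
    = (t + real (\<Sum>M)) * set_weight t M"
proof -
  define x where "x m = real m * (real m + 1)" for m
  define y where "y m = real m * (real m - 1)" for m
  define r where "r m = (x m - y m) * (\<Prod>j\<in>M - {m}. (x m - y j) / (x m - x j))" for m
  have inj: "inj_on x M"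
  proof (rule inj_onI)
    fix a b assume "x a = x b"
    then have "(real a - real b) * (real a + real b + 1) = 0" by (simp add: x_def algebra_simps)
    then show "a = b" by (auto simp: add_eq_0_iff)
  qed
  have x0: "x m \<noteq> 0" if "m \<in> M" for m using that assms by (cases "m = 0") (auto simp: x_def add_eq_0_iff)
  then have 0: "(0::real) \<notin> x ` M" by force
  \<comment> \<open>The product formula at \<open>z = 0\<close>, which is not a node since 0 is not
    a part.\<close>
  have pf: "(\<Prod>b\<in>M. y b / x b) = 1 - (\<Sum>m\<in>M. r m / x m)"
  proof -
    have "(\<Prod>b\<in>M. y b / x b) = (\<Prod>b\<in>M. (0 - y b) / (0 - x b))" by simp
    also have "\<dots> = 1 + (\<Sum>m\<in>M. r m / (0 - x m))"
      unfolding r_def by (rule partial_fractions_prod[OF assms(1) inj 0])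
    finally show ?thesis by (simp add: sum_negf)
  qed
  have rs: "(\<Sum>m\<in>M. r m) = 2 * real (\<Sum>M)"
  proof -
    have "(\<Sum>m\<in>M. r m) = (\<Sum>m\<in>M. x m - y m)"
      unfolding r_def by (rule partial_fractions_residue_sum[OF assms(1) inj])
    also have "\<dots> = (\<Sum>m\<in>M. 2 * real m)" by (intro sum.cong) (auto simp: x_def y_def algebra_simps)
    finally show ?thesis by (simp add: sum_distrib_left)
  qed
  have old: "(if Suc m \<in> M then 0 else set_weight t (insert (Suc m) (M - {m})))
      = set_weight t M * ((2 * t + x m) / (2 * x m) * r m)" if m: "m \<in> M" for m
  proof (cases "Suc m \<in> M")
    case True
    \<comment> \<open>A blocked move drops out by itself: \<open>x m = y (Suc m)\<close>, so the
      residue contains a vanishing factor.\<close>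
    then have "r m = 0"
      using assms by (auto simp: r_def x_def y_def intro!: bexI[of _ "Suc m"])
    then show ?thesis using True by simp
  next
    case False
    have "m > 0" using m assms by (metis gr0I)
    then have "(2 * t + real m * (real m + 1)) / (real m + 1) = (2 * t + x m) / (2 * x m) * (x m - y m)"
      by (simp add: x_def y_def divide_simps) (simp add: algebra_simps)
    then show ?thesis
      using False m \<open>m > 0\<close> assms set_weight_Suc[of "M - {m}" m t]
      by (simp add: insert_absorb r_def x_def y_def mult_ac)
  qed
  have new: "(if 1 \<in> M then 0 else set_weight t (insert 1 M)) = set_weight t M * (t * (\<Prod>b\<in>M. y b / x b))"
  proof (cases "1 \<in> M")
    case True
    then have "(\<Prod>b\<in>M. y b / x b) = 0" using assms by (auto simp: y_def intro!: bexI[of _ 1])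
    then show ?thesis using True by simp
  next
    case False
    have "\<bar>1 - real b\<bar> / (1 + real b) = y b / x b" if "b \<in> M" for b
    proof -
      have "b \<noteq> 0" using that assms by metis
      then have "\<bar>1 - real b\<bar> = real b - 1" "real b + 1 \<noteq> 0" by auto
      then show ?thesis using \<open>b \<noteq> 0\<close> by (simp add: x_def y_def add.commute)
    qed
    then show ?thesis using False assms by (simp add: set_weight_insert)
  qed
  have "(\<Sum>m\<in>{m \<in> insert 0 M. Suc m \<notin> M}. set_weight t (insert (Suc m) (M - {m})))
    = (\<Sum>m\<in>insert 0 M. if Suc m \<in> M then 0 else set_weight t (insert (Suc m) (M - {m})))"
    using assms by (simp add: sum.If_cases Collect_conj_eq[symmetric] Int_def)
  also have "\<dots> = set_weight t M * (t * (\<Prod>b\<in>M. y b / x b)) + (\<Sum>m\<in>M. set_weight t M * ((2 * t + x m) / (2 * x m) * r m))"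
  proof -
    have "(\<Sum>m\<in>insert 0 M. if Suc m \<in> M then 0 else set_weight t (insert (Suc m) (M - {m})))
      = (if Suc 0 \<in> M then 0 else set_weight t (insert (Suc 0) M))
        + (\<Sum>m\<in>M. if Suc m \<in> M then 0 else set_weight t (insert (Suc m) (M - {m})))"
      using assms by simp
    then show ?thesis
      by (simp only: new[unfolded One_nat_def] old cong: sum.cong)
  qed
  also have "(\<Sum>m\<in>M. set_weight t M * ((2 * t + x m) / (2 * x m) * r m))
     = set_weight t M * (\<Sum>m\<in>M. t * (r m / x m) + r m / 2)"
    using x0 by (subst sum_distrib_left[symmetric]) (intro arg_cong2[where f=times] sum.cong refl, simp add: divide_simps, simp add: algebra_simps)
  also have "\<dots> = set_weight t M * (t * (\<Sum>m\<in>M. r m / x m) + real (\<Sum>M))"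
    by (simp only: sum.distrib sum_distrib_left[symmetric] sum_divide_distrib[symmetric] rs) simp
  \<comment> \<open>The sums \<open>\<Sum> r m / x m\<close> from the old parts and from the new
    part cancel, leaving \<open>t\<close> once.\<close>
  finally show ?thesis
    unfolding pf by (simp add: algebra_simps)
qed


section \<open>Strict partitions and their sets of parts\<close>

lemma strict_partition_Cons:
  "strict_partition (m # \<mu>) \<longleftrightarrow> m > 0 \<and> (\<forall>k\<in>set \<mu>. k < m) \<and> strict_partition \<mu>"
  by (auto simp: strict_partition_def)

lemma strict_partition_distinct: "strict_partition \<mu> \<Longrightarrow> distinct \<mu>"
  by (induction \<mu>) (auto simp: strict_partition_Cons)

lemma strict_partition_nth_less:
  "strict_partition \<mu> \<Longrightarrow> i < j \<Longrightarrow> j < length \<mu> \<Longrightarrow> \<mu> ! j < \<mu> ! i"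
  by (auto simp: strict_partition_def sorted_wrt_iff_nth_less)

lemma strict_partition_nth_pos: "strict_partition \<mu> \<Longrightarrow> i < length \<mu> \<Longrightarrow> 0 < \<mu> ! i"
  by (metis gr0I nth_mem strict_partition_def)

lemma strict_partition_eqI:
  assumes "strict_partition \<mu>" "strict_partition \<nu>" "set \<mu> = set \<nu>"
  shows "\<mu> = \<nu>"
proof -
  have "sorted_wrt (<) (rev \<mu>)" "sorted_wrt (<) (rev \<nu>)"
    using assms by (auto simp: strict_partition_def sorted_wrt_rev)
  then have "rev \<mu> = rev \<nu>"
    using assms(3) by (metis set_rev strict_sorted_equal)
  then show ?thesis by simp
qed

lemma ex_strict_partition:
  assumes "finite M" "0 \<notin> M"
  obtains \<mu> where "strict_partition \<mu>" "set \<mu> = M"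
proof
  show "set (rev (sorted_list_of_set M)) = M" using assms by simp
  then show "strict_partition (rev (sorted_list_of_set M))"
    using assms by (simp add: strict_partition_def sorted_wrt_rev)
qed

lemma sum_list_strict_partition: "strict_partition \<mu> \<Longrightarrow> sum_list \<mu> = \<Sum>(set \<mu>)"
  by (simp add: distinct_sum_list_conv_Sum strict_partition_distinct)

lemma prod_boxes:
  "(\<Prod>(i, j)\<in>boxes \<mu>. f j) = (\<Prod>i<length \<mu>. \<Prod>j=1..\<mu> ! i. (f j :: 'a :: comm_monoid_mult))"
proof -
  have "(\<Prod>i<length \<mu>. \<Prod>j=1..\<mu> ! i. f j) = (\<Prod>(i, j)\<in>(SIGMA i:{..<length \<mu>}. {1..\<mu> ! i}). f j)"
    by (rule prod.Sigma) auto
  also have "\<dots> = (\<Prod>(i, j)\<in>boxes \<mu>. f j)"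
    by (rule prod.reindex_bij_witness[of _ "\<lambda>(i, j). (i - 1, j)" "\<lambda>(i, j). (Suc i, j)"])
       (auto simp: boxes_def)
  finally show ?thesis by simp
qed

lemma schur_weight_eq_set_weight:
  assumes "strict_partition \<mu>"
  shows "schur_weight t \<mu> = set_weight t (set \<mu>)"
proof -
  have bij: "bij_betw (\<lambda>i. \<mu> ! i) {..<length \<mu>} (set \<mu>)"
    using assms by (intro bij_betw_nth strict_partition_distinct) auto
  have "(\<Prod>(a, b)\<in>{(a, b). a \<in> set \<mu> \<and> b \<in> set \<mu> \<and> b < a}. (real a - real b) / (real a + real b))
    = (\<Prod>(i, j)\<in>{(i, j). i < j \<and> j < length \<mu>}.
      (real (\<mu> ! i) - real (\<mu> ! j)) / (real (\<mu> ! i) + real (\<mu> ! j)))"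
  proof -
    have "inj_on (\<lambda>(i, j). (\<mu> ! i, \<mu> ! j)) {(i, j). i < j \<and> j < length \<mu>}"
      using strict_partition_distinct[OF assms] by (auto simp: inj_on_def nth_eq_iff_index_eq)
    moreover have "(\<lambda>(i, j). (\<mu> ! i, \<mu> ! j)) ` {(i, j). i < j \<and> j < length \<mu>}
      = {(a, b). a \<in> set \<mu> \<and> b \<in> set \<mu> \<and> b < a}" (is "?L = ?R")
    proof
      show "?L \<subseteq> ?R" using strict_partition_nth_less[OF assms] by auto
      show "?R \<subseteq> ?L"
      proof clarify
        fix a b assume "a \<in> set \<mu>" "b \<in> set \<mu>" "b < a"
        then obtain i j where ij: "i < length \<mu>" "j < length \<mu>" "\<mu> ! i = a" "\<mu> ! j = b"
          by (metis in_set_conv_nth)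
        then have "i < j"
          using \<open>b < a\<close> strict_partition_nth_less[OF assms, of j i] by (cases i j rule: linorder_cases) auto
        then show "(a, b) \<in> ?L" using ij by force
      qed
    qed
    ultimately have "bij_betw (\<lambda>(i, j). (\<mu> ! i, \<mu> ! j)) {(i, j). i < j \<and> j < length \<mu>}
      {(a, b). a \<in> set \<mu> \<and> b \<in> set \<mu> \<and> b < a}"
      by (simp add: bij_betw_def)
    from prod.reindex_bij_betw[OF this, of "\<lambda>(a, b). (real a - real b) / (real a + real b)"]
    show ?thesis by (simp add: case_prod_unfold)
  qed
  moreover have "(\<Prod>m\<in>set \<mu>. (\<Prod>j=1..m. 2 * t + (real j - 1) * real j) / (2 * fact m))
    = (\<Prod>(i, j)\<in>boxes \<mu>. 2 * t + (real j - 1) * real j) / (2 ^ length \<mu> * (\<Prod>i<length \<mu>. fact (\<mu> ! i)))"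
    unfolding prod_boxes
    by (subst prod.reindex_bij_betw[OF bij, symmetric]) (simp add: prod_dividef prod.distrib)
  ultimately show ?thesis
    by (simp add: schur_weight_def set_weight_def)
qed

section \<open>The covering relation in terms of parts\<close>

definition part :: "nat list \<Rightarrow> nat \<Rightarrow> nat"
  where "part \<mu> i = (if i < length \<mu> then \<mu> ! i else 0)"

lemma boxes_iff_part: "(Suc i, Suc j) \<in> boxes \<mu> \<longleftrightarrow> j < part \<mu> i"
  by (auto simp: boxes_def part_def)

text \<open>Extending the parts by zeros makes a new row an increase by one as well. Rows are
  initial segments, so the added box can only be the next one in its row.\<close>

lemma covers_iff_part: "\<nu> \<searrow> \<mu> \<longleftrightarrow> (\<exists>i. part \<nu> = (part \<mu>)(i := Suc (part \<mu> i)))"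
proof
  assume "\<nu> \<searrow> \<mu>"
  then obtain b where b: "b \<notin> boxes \<mu>" "boxes \<nu> = insert b (boxes \<mu>)" by (auto simp: covers_def)
  then have "b \<in> boxes \<nu>" by auto
  then obtain i j where ij: "b = (Suc i, Suc j)"
    by (cases b) (auto simp: boxes_def elim!: Suc_le_D[THEN exE])
  have eq: "j' < part \<nu> i' \<longleftrightarrow> (i' = i \<and> j' = j) \<or> j' < part \<mu> i'" for i' j'
    using b(2) unfolding boxes_iff_part[symmetric] ij by auto
  have "\<not> j < part \<mu> i" using b(1) unfolding ij boxes_iff_part .
  have "part \<nu> i' = part \<mu> i'" if "i' \<noteq> i" for i'
    using eq[of _ i'] that by (metis linorder_neqE_nat less_irrefl)
  moreover have "part \<nu> i = Suc (part \<mu> i)"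
  proof -
    have "j < part \<nu> i" using eq by simp
    have "j \<le> part \<mu> i"
    proof (rule ccontr)
      assume "\<not> j \<le> part \<mu> i"
      then have "part \<mu> i < part \<nu> i" using \<open>j < part \<nu> i\<close> by simp
      then show False using eq[of "part \<mu> i" i] \<open>\<not> j \<le> part \<mu> i\<close> by simp
    qed
    then have "j = part \<mu> i" using \<open>\<not> j < part \<mu> i\<close> by simp
    then show ?thesis
      using eq[of _ i] by (metis linorder_neqE_nat less_irrefl less_Suc_eq)
  qed
  ultimately show "\<exists>i. part \<nu> = (part \<mu>)(i := Suc (part \<mu> i))" by (auto simp: fun_eq_iff)
next
  assume "\<exists>i. part \<nu> = (part \<mu>)(i := Suc (part \<mu> i))"
  then obtain i where i: "part \<nu> = (part \<mu>)(i := Suc (part \<mu> i))" ..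
  have boxes_part: "boxes \<kappa> = (\<lambda>(i, j). (Suc i, Suc j)) ` {(i, j). j < part \<kappa> i}" for \<kappa>
  proof -
    have "(a, b) \<in> boxes \<kappa> \<Longrightarrow> (a, b) \<in> (\<lambda>(i, j). (Suc i, Suc j)) ` {(i, j). j < part \<kappa> i}" for a b
      using boxes_iff_part[of "a - 1" "b - 1" \<kappa>]
      by (auto simp: boxes_def intro!: image_eqI[of _ _ "(a - 1, b - 1)"])
    then show ?thesis by (auto simp: boxes_iff_part)
  qed
  show "\<nu> \<searrow> \<mu>"
    unfolding covers_def boxes_part i
    by (intro exI[of _ "(Suc i, Suc (part \<mu> i))"]) (auto simp: less_Suc_eq split: if_splits)
qed

lemma set_eq_part:
  assumes "strict_partition \<mu>"
  shows "set \<mu> = range (part \<mu>) - {0}"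
proof (intro equalityI subsetI)
  fix x assume x: "x \<in> set \<mu>"
  then obtain i where "i < length \<mu>" "\<mu> ! i = x" by (auto simp: in_set_conv_nth)
  then have "part \<mu> i = x" by (simp add: part_def)
  moreover have "x \<noteq> 0" using x assms by (metis strict_partition_def)
  ultimately show "x \<in> range (part \<mu>) - {0}" by auto
next
  fix x assume "x \<in> range (part \<mu>) - {0}"
  then show "x \<in> set \<mu>" by (auto simp: part_def split: if_splits)
qed

lemma covers_imp_set:
  assumes "strict_partition \<mu>" "strict_partition \<nu>" "\<nu> \<searrow> \<mu>"
  obtains m where "m \<in> insert 0 (set \<mu>)" "Suc m \<notin> set \<mu>" "set \<nu> = insert (Suc m) (set \<mu> - {m})"
proof -
  obtain i where i: "part \<nu> = (part \<mu>)(i := Suc (part \<mu> i))"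
    using assms(3) unfolding covers_iff_part ..
  have inj: "part \<kappa> a = part \<kappa> b \<Longrightarrow> part \<kappa> a \<noteq> 0 \<Longrightarrow> a = b" if "strict_partition \<kappa>" for \<kappa> a b
    using strict_partition_distinct[OF that]
    by (auto simp: part_def nth_eq_iff_index_eq split: if_splits)
  show thesis
  proof
    show "part \<mu> i \<in> insert 0 (set \<mu>)" by (auto simp: part_def)
    \<comment> \<open>Otherwise \<open>\<nu>\<close> would contain this part twice, in row
      \<open>i\<close> and in an unchanged row.\<close>
    show "Suc (part \<mu> i) \<notin> set \<mu>"
    proof
      assume "Suc (part \<mu> i) \<in> set \<mu>"
      then obtain j where j: "part \<mu> j = Suc (part \<mu> i)"
        using set_eq_part[OF assms(1)] by (metis DiffD1 rangeE)
      then have "j \<noteq> i" by auto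
      then show False using inj[OF assms(2), of i j] j by (simp add: i)
    qed
    show "set \<nu> = insert (Suc (part \<mu> i)) (set \<mu> - {part \<mu> i})"
    proof (intro equalityI subsetI)
      fix x assume "x \<in> set \<nu>"
      then obtain j where j: "x = part \<nu> j" "x \<noteq> 0" using set_eq_part[OF assms(2)] by auto
      then show "x \<in> insert (Suc (part \<mu> i)) (set \<mu> - {part \<mu> i})"
        using inj[OF assms(1), of j i] by (auto simp: i set_eq_part[OF assms(1)] split: if_splits)
    next
      fix x assume "x \<in> insert (Suc (part \<mu> i)) (set \<mu> - {part \<mu> i})"
      then consider "x = Suc (part \<mu> i)" | j where "x = part \<mu> j" "x \<noteq> 0" "x \<noteq> part \<mu> i"
        using set_eq_part[OF assms(1)] by auto
      then show "x \<in> set \<nu>"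
      proof cases
        case 1
        then have "x = part \<nu> i" by (simp add: i)
        then show ?thesis using 1 by (simp add: set_eq_part[OF assms(2)])
      next
        case 2
        then have "x = part \<nu> j" by (auto simp: i)
        then show ?thesis using 2 by (simp add: set_eq_part[OF assms(2)])
      qed
    qed
  qed
qed

text \<open>Converse of \<open>covers_imp_set\<close>. For \<open>m = 0\<close> a part 1 is
  appended; otherwise the part \<open>m\<close> is raised in place, which keeps the list strictly
  decreasing because \<open>m + 1\<close> is not a part.\<close>

lemma ex_covers:
  assumes "strict_partition \<mu>" "m \<in> insert 0 (set \<mu>)" "Suc m \<notin> set \<mu>"
  obtains \<nu> where "strict_partition \<nu>" "\<nu> \<searrow> \<mu>" "set \<nu> = insert (Suc m) (set \<mu> - {m})"
proof (cases "m = 0")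
  case True
  let ?\<nu> = "\<mu> @ [1]"
  have "\<forall>k\<in>set \<mu>. 1 < k"
    using assms True by (metis One_nat_def Suc_lessI gr0I strict_partition_def)
  then have "strict_partition ?\<nu>"
    using assms by (auto simp: strict_partition_def sorted_wrt_append)
  moreover have "?\<nu> \<searrow> \<mu>"
    unfolding covers_iff_part by (intro exI[of _ "length \<mu>"]) (auto simp: part_def fun_eq_iff nth_append)
  moreover have "set ?\<nu> = insert (Suc m) (set \<mu> - {m})"
    using True assms by (auto simp: strict_partition_def)
  ultimately show ?thesis using that by blast
next
  case False
  then obtain i where i: "i < length \<mu>" "\<mu> ! i = m"
    using assms(2) by (auto simp: in_set_conv_nth)
  let ?\<nu> = "\<mu>[i := Suc m]"
  have "strict_partition ?\<nu>"
    unfolding strict_partition_def sorted_wrt_iff_nth_less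
  proof (intro conjI allI impI)
    fix a b assume ab: "a < b" "b < length ?\<nu>"
    show "?\<nu> ! b < ?\<nu> ! a"
    proof (cases "b = i")
      case True
      then have "m < \<mu> ! a" using ab i strict_partition_nth_less[OF assms(1), of a b] by simp
      moreover have "\<mu> ! a \<noteq> Suc m" using ab assms(3) by (metis length_list_update less_trans nth_mem)
      ultimately show ?thesis using True ab by simp
    next
      case False
      then show ?thesis using ab i strict_partition_nth_less[OF assms(1), of a b]
        by (auto simp: nth_list_update)
    qed
  next
    show "0 \<notin> set ?\<nu>"
      using assms(1) by (auto simp: strict_partition_def dest: set_update_subset_insert[THEN subsetD])
  qed
  moreover have "?\<nu> \<searrow> \<mu>"
    unfolding covers_iff_part using i
    by (intro exI[of _ i]) (auto simp: part_def fun_eq_iff nth_list_update)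
  moreover have "set ?\<nu> = insert (Suc m) (set \<mu> - {m})"
    using set_update_distinct[OF strict_partition_distinct[OF assms(1)] i(1), of "Suc m"] i(2) by simp
  ultimately show ?thesis using that by blast
qed

text \<open>A strict partition is determined by its set of parts, and a move by its result, since
  \<open>Suc m\<close> is the only new element. The sum over covers thus becomes the one in
  \<open>set_weight_harmonic\<close>.\<close>

lemma schur_weight_harmonic:
  assumes "strict_partition \<mu>"
  shows "(\<Sum>\<nu> | strict_partition \<nu> \<and> \<nu> \<searrow> \<mu>. schur_weight t \<nu>)
    = (t + real (sum_list \<mu>)) * schur_weight t \<mu>"
proof -
  let ?N = "{\<nu>. strict_partition \<nu> \<and> \<nu> \<searrow> \<mu>}"
  let ?S = "{m \<in> insert 0 (set \<mu>). Suc m \<notin> set \<mu>}"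
  let ?g = "\<lambda>m. insert (Suc m) (set \<mu> - {m})"
  have "(\<Sum>\<nu>\<in>?N. schur_weight t \<nu>) = (\<Sum>\<nu>\<in>?N. set_weight t (set \<nu>))"
    by (intro sum.cong) (auto simp: schur_weight_eq_set_weight)
  also have "\<dots> = (\<Sum>M\<in>set ` ?N. set_weight t M)"
    by (subst sum.reindex) (auto simp: inj_on_def intro: strict_partition_eqI)
  also have "set ` ?N = ?g ` ?S"
  proof (intro equalityI subsetI)
    fix M assume "M \<in> set ` ?N"
    then obtain \<nu> where \<nu>: "strict_partition \<nu>" "\<nu> \<searrow> \<mu>" "M = set \<nu>" by auto
    from covers_imp_set[OF assms \<nu>(1,2)] show "M \<in> ?g ` ?S" using \<nu>(3) by (metis (mono_tags, lifting) image_eqI mem_Collect_eq)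
  next
    fix M assume "M \<in> ?g ` ?S"
    then obtain m where m: "m \<in> insert 0 (set \<mu>)" "Suc m \<notin> set \<mu>" "M = ?g m" by auto
    from ex_covers[OF assms m(1,2)] show "M \<in> set ` ?N" using m(3) by (metis (mono_tags, lifting) image_eqI mem_Collect_eq)
  qed
  also have "(\<Sum>M\<in>?g ` ?S. set_weight t M) = (\<Sum>m\<in>?S. set_weight t (?g m))"
  proof (subst sum.reindex)
    show "inj_on ?g ?S"
    proof (rule inj_onI)
      fix a b assume ab: "a \<in> ?S" "b \<in> ?S" "?g a = ?g b"
      then have "Suc a \<in> ?g b" by (metis insertI1)
      then show "a = b" using ab(1) by auto
    qed
  qed simp
  also have "\<dots> = (t + real (sum_list \<mu>)) * schur_weight t \<mu>"
    using assms set_weight_harmonic[of "set \<mu>" t]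
    by (simp add: schur_weight_eq_set_weight sum_list_strict_partition strict_partition_def)
  finally show ?thesis .
qed

lemma sum_list_covers:
  assumes "\<nu> \<searrow> \<mu>"
  shows "sum_list \<nu> = Suc (sum_list \<mu>)"
proof -
  have *: "sum_list \<kappa> = sum (part \<kappa>) {..<n}" if "length \<kappa> \<le> n" for \<kappa> n
  proof -
    have "sum (part \<kappa>) {..<n} = sum (part \<kappa>) {..<length \<kappa>}"
      using that by (intro sum.mono_neutral_right) (auto simp: part_def)
    also have "\<dots> = sum_list \<kappa>" by (simp add: sum_list_sum_nth part_def atLeast0LessThan)
    finally show ?thesis by simp
  qed
  obtain i where i: "part \<nu> = (part \<mu>)(i := Suc (part \<mu> i))"
    using assms unfolding covers_iff_part ..
  let ?n = "max (max (length \<mu>) (length \<nu>)) (Suc i)"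
  have "sum_list \<nu> = sum (part \<nu>) {..<?n}" by (rule *) simp
  also have "\<dots> = Suc (part \<mu> i) + sum (part \<mu>) ({..<?n} - {i})"
    by (subst sum.remove[of _ i]) (auto simp: i)
  also have "\<dots> = Suc (sum (part \<mu>) {..<?n})"
    by (subst (2) sum.remove[of _ i]) auto
  also have "sum (part \<mu>) {..<?n} = sum_list \<mu>" by (rule *[symmetric]) simp
  finally show ?thesis .
qed

lemma positive_harmonic_phi:
  assumes "t > 0"
  shows "positive_harmonic (phi t)"
  unfolding positive_harmonic_def
proof (intro allI impI conjI)
  fix \<mu> assume \<mu>: "strict_partition \<mu>"
  have pos: "pochhammer t n > 0" for n using assms by (simp add: pochhammer_pos)
  show "phi t \<mu> > 0"
    using assms \<mu> pos[of "sum_list \<mu>"] set_weight_pos[of "set \<mu>" t]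
    by (simp add: phi_def schur_weight_eq_set_weight strict_partition_def)
  have "(\<Sum>\<nu> | strict_partition \<nu> \<and> \<nu> \<searrow> \<mu>. phi t \<nu>)
    = (\<Sum>\<nu> | strict_partition \<nu> \<and> \<nu> \<searrow> \<mu>. 1 / pochhammer t (Suc (sum_list \<mu>)) * schur_weight t \<nu>)"
    by (intro sum.cong) (auto simp: phi_def sum_list_covers)
  also have "\<dots> = 1 / pochhammer t (Suc (sum_list \<mu>)) * ((t + real (sum_list \<mu>)) * schur_weight t \<mu>)"
    by (simp only: sum_distrib_left[symmetric] schur_weight_harmonic[OF \<mu>])
  \<comment> \<open>The factor \<open>t + |\<mu>|\<close> is the quotient of two consecutive
    Pochhammer symbols.\<close>
  also have "\<dots> = phi t \<mu>"
    using assms pos[of "sum_list \<mu>"] by (simp add: phi_def pochhammer_Suc add_nonneg_eq_0_iff)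
  finally show "phi t \<mu> = (\<Sum>\<nu> | strict_partition \<nu> \<and> \<nu> \<searrow> \<mu>. phi t \<nu>)" by simp
qed

section \<open>Degree bounds and the linear structure of power series\<close>

definition degree_le :: "pser \<Rightarrow> nat \<Rightarrow> bool"
  where "degree_le f d \<longleftrightarrow> (\<forall>m. coeff f m \<noteq> 0 \<longrightarrow> mdeg m \<le> d)"

lemma degree_leD: "degree_le f d \<Longrightarrow> coeff f m \<noteq> 0 \<Longrightarrow> mdeg m \<le> d"
  by (simp add: degree_le_def)

lemma degree_le_mono: "degree_le f d \<Longrightarrow> d \<le> e \<Longrightarrow> degree_le f e"
  by (auto simp: degree_le_def intro: order_trans)

lemma degree_le_add: "degree_le f d \<Longrightarrow> degree_le g d \<Longrightarrow> degree_le (f + g) d"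
  by (auto simp: degree_le_def plus_pser.rep_eq) (metis add.right_neutral)

lemma degree_le_scale: "degree_le f d \<Longrightarrow> degree_le (scale c f) d"
  by (auto simp: degree_le_def scale.rep_eq)

lemma coeff_times_nonzeroE:
  assumes "coeff (f * g) m \<noteq> 0"
  obtains a b where "m = a + b" "coeff f a \<noteq> 0" "coeff g b \<noteq> 0"
proof -
  from assms have "\<exists>p\<in>splits m. coeff f (fst p) * coeff g (snd p) \<noteq> 0"
    unfolding times_pser.rep_eq case_prod_unfold by (metis (no_types, lifting) sum.neutral)
  then show ?thesis using that by (auto simp: splits_def)
qed

lemma degree_le_mult: "degree_le f d \<Longrightarrow> degree_le g e \<Longrightarrow> degree_le (f * g) (d + e)"
  unfolding degree_le_def by (metis add_mono coeff_times_nonzeroE mdeg_add)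

lemma mdeg_0 [simp]: "mdeg 0 = 0"
  by (simp add: mdeg_def)

lemma mdeg_eq_0_iff [simp]: "mdeg m = 0 \<longleftrightarrow> m = 0"
  by (auto simp: mdeg_def in_keys_iff intro!: poly_mapping_eqI)

lemma mdeg_single [simp]: "mdeg (Poly_Mapping.single i k) = k"
  by (simp add: mdeg_def)

lemma degree_le_one: "degree_le 1 0"
  by (simp add: degree_le_def one_pser.rep_eq)

lemma degree_le_zero: "degree_le 0 d"
  by (simp add: degree_le_def zero_pser.rep_eq)

lemma degree_le_sum: "(\<And>i. i \<in> I \<Longrightarrow> degree_le (f i) d) \<Longrightarrow> degree_le (sum f I) d"
  by (induction I rule: infinite_finite_induct) (auto simp: degree_le_zero degree_le_add)

lemma Gamma_degree_le:
  assumes "f \<in> Gamma"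
  obtains d where "degree_le f d"
  using assms Gamma_subset_symmetric_functions that
  by (auto simp: symmetric_functions_def degree_le_def)

text \<open>Scalars become constant series, so that the rules for products follow from the ring
  axioms.\<close>

lemma scale_eq_mult: "scale c f = scale c 1 * f"
proof (rule pser_eqI)
  fix m
  have "coeff (scale c 1 * f) m = (\<Sum>p\<in>splits m. (if fst p = 0 then c else 0) * coeff f (snd p))"
    by (auto simp: times_pser.rep_eq scale.rep_eq one_pser.rep_eq case_prod_unfold intro!: sum.cong)
  also have "\<dots> = (\<Sum>p\<in>{(0 :: nat \<Rightarrow>\<^sub>0 nat, m)}. (if fst p = 0 then c else 0) * coeff f (snd p))"
    by (intro sum.mono_neutral_right finite_splits) (auto simp: splits_def)
  finally show "coeff (scale c f) m = coeff (scale c 1 * f) m" by (simp add: scale.rep_eq)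
qed

lemma scale_mult_left: "scale c f * g = scale c (f * g)"
  by (simp add: scale_eq_mult[of c f] scale_eq_mult[of c "f * g"] mult.assoc)

lemma scale_mult_right: "f * scale c g = scale c (f * g)"
  by (metis mult.commute scale_mult_left)

lemma scale_1 [simp]: "scale 1 f = f"
  by (rule pser_eqI) (simp add: scale.rep_eq)

lemma scale_0 [simp]: "scale 0 f = 0" "scale c 0 = 0"
  by (rule pser_eqI, simp add: scale.rep_eq zero_pser.rep_eq)+

text \<open>Provides span, independence and the bound on independent sets for the dimension count
  behind uniqueness.\<close>

interpretation pser: vector_space scale
  by standard (rule pser_eqI; simp add: scale.rep_eq plus_pser.rep_eq algebra_simps)+

lemma numeral_pser: "numeral n = scale (numeral n) 1"
proof -
  have "of_nat k = scale (of_nat k) 1" for k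
    by (induction k) (simp_all add: pser.scale_left_distrib)
  from this[of "numeral n"] show ?thesis by simp
qed

lemma of_nat_pser: "of_nat k = scale (of_nat k) 1"
  by (induction k) (simp_all add: pser.scale_left_distrib)

lemma of_nat_mult_pser_eq_0: "of_nat k * (f :: pser) = 0 \<longleftrightarrow> k = 0 \<or> f = 0"
  by (simp add: of_nat_pser scale_mult_left)

lemma Gamma_uminus: "f \<in> Gamma \<Longrightarrow> - f \<in> Gamma"
  using Gamma.scale[of f "-1"] by simp

lemma Gamma_diff: "f \<in> Gamma \<Longrightarrow> g \<in> Gamma \<Longrightarrow> f - g \<in> Gamma"
  using Gamma.add[of f "- g"] Gamma_uminus by simp

lemma Gamma_zero: "0 \<in> Gamma"
  using Gamma.scale[OF Gamma.one, of 0] by simp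

lemma Gamma_sum: "(\<And>i. i \<in> I \<Longrightarrow> f i \<in> Gamma) \<Longrightarrow> sum f I \<in> Gamma"
  by (induction I rule: infinite_finite_induct) (auto simp: Gamma_zero intro: Gamma.add)

lemma Gamma_numeral: "numeral k \<in> Gamma"
  unfolding numeral_pser by (intro Gamma.intros)

lemma Gamma_power: "f \<in> Gamma \<Longrightarrow> f ^ k \<in> Gamma"
  by (induction k) (auto intro: Gamma.intros)

lemma Gamma_minus_one_power: "(- 1) ^ k \<in> Gamma"
  by (intro Gamma_power Gamma_uminus Gamma.one)

section \<open>Evaluation\<close>

definition monomial_value :: "(nat \<Rightarrow> complex) \<Rightarrow> (nat \<Rightarrow>\<^sub>0 nat) \<Rightarrow> complex"
  where "monomial_value x m = (\<Prod>i\<in>Poly_Mapping.keys m. x i ^ Poly_Mapping.lookup m i)"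

lemma monomial_value_superset:
  assumes "finite A" "Poly_Mapping.keys m \<subseteq> A"
  shows "monomial_value x m = (\<Prod>i\<in>A. x i ^ Poly_Mapping.lookup m i)"
  unfolding monomial_value_def using assms
  by (intro prod.mono_neutral_left) (auto simp: in_keys_iff)

lemma monomial_value_add: "monomial_value x (a + b) = monomial_value x a * monomial_value x b"
proof -
  let ?A = "Poly_Mapping.keys a \<union> Poly_Mapping.keys b"
  have "monomial_value x (a + b) = (\<Prod>i\<in>?A. x i ^ Poly_Mapping.lookup (a + b) i)"
    by (rule monomial_value_superset) (auto simp: keys_add)
  then show ?thesis
    using monomial_value_superset[of ?A a x] monomial_value_superset[of ?A b x]
    by (simp add: lookup_add power_add prod.distrib)
qed

definition monomials :: "nat \<Rightarrow> nat \<Rightarrow> (nat \<Rightarrow>\<^sub>0 nat) set"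
  where "monomials N d = {m. Poly_Mapping.keys m \<subseteq> {..<N} \<and> mdeg m \<le> d}"

lemma finite_monomials: "finite (monomials N d)"
proof -
  let ?S = "{f. \<forall>x. (x \<in> {..<N} \<longrightarrow> f x \<in> {..d}) \<and> (x \<notin> {..<N} \<longrightarrow> f x = (0::nat))}"
  have "finite ?S"
    by (rule finite_set_of_finite_funs) auto
  moreover have "Poly_Mapping.lookup ` monomials N d \<subseteq> ?S"
  proof clarsimp
    fix m x assume m: "m \<in> monomials N d"
    have "Poly_Mapping.lookup m x \<le> mdeg m"
    proof (cases "x \<in> Poly_Mapping.keys m")
      case True
      then show ?thesis unfolding mdeg_def by (intro member_le_sum) auto
    next
      case False
      then show ?thesis by (simp add: in_keys_iff)
    qed
    then show "(x < N \<longrightarrow> Poly_Mapping.lookup m x \<le> d) \<and> (\<not> x < N \<longrightarrow> Poly_Mapping.lookup m x = 0)"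
      using m by (auto simp: monomials_def in_keys_iff subset_eq)
  qed
  ultimately have "finite (Poly_Mapping.lookup ` monomials N d)"
    by (rule finite_subset[rotated])
  then show ?thesis
    by (rule finite_imageD) (auto simp: inj_on_def poly_mapping_eqI)
qed

lemma monomials_add_iff:
  "a + b \<in> monomials N d \<longleftrightarrow> Poly_Mapping.keys a \<subseteq> {..<N} \<and> Poly_Mapping.keys b \<subseteq> {..<N} \<and> mdeg a + mdeg b \<le> d"
proof -
  have "Poly_Mapping.keys (a + b) = Poly_Mapping.keys a \<union> Poly_Mapping.keys b"
    by (auto simp: in_keys_iff lookup_add)
  then show ?thesis by (auto simp: monomials_def mdeg_add)
qed

definition supported :: "nat \<Rightarrow> (nat \<Rightarrow> complex) \<Rightarrow> bool"
  where "supported N x \<longleftrightarrow> (\<forall>i\<ge>N. x i = 0)"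

text \<open>A monomial containing a variable beyond \<open>N\<close> has value 0, and a degree bound
  leaves finitely many others. The set of summation depends only on the two bounds, so sums for
  different functions can be compared.\<close>

lemma eval_at_eq_sum:
  assumes "supported N x" "degree_le f d"
  shows "eval_at f x = (\<Sum>m\<in>monomials N d. coeff f m * monomial_value x m)"
proof -
  have "monomial_value x m = 0" if "\<not> Poly_Mapping.keys m \<subseteq> {..<N}" for m
  proof -
    from that obtain i where "i \<in> Poly_Mapping.keys m" "i \<ge> N"
      by (metis lessThan_iff linorder_not_le subsetI)
    then show ?thesis using assms(1)
      by (auto simp: monomial_value_def supported_def in_keys_iff intro!: bexI[of _ i])
  qed
  then have "{m. coeff f m * monomial_value x m \<noteq> 0} \<subseteq> monomials N d"
    using degree_leD[OF assms(2)] by (auto simp: monomials_def)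
  from Sum_any.expand_superset[OF finite_monomials this] show ?thesis
    by (simp add: eval_at_def monomial_value_def)
qed

lemma eval_at_add:
  assumes "supported N x" "degree_le f d" "degree_le g e"
  shows "eval_at (f + g) x = eval_at f x + eval_at g x"
proof -
  have "degree_le f (max d e)" "degree_le g (max d e)"
    using assms by (auto elim: degree_le_mono)
  then show ?thesis
    using eval_at_eq_sum[OF assms(1)] degree_le_add[of f "max d e" g]
    by (simp add: plus_pser.rep_eq distrib_right sum.distrib)
qed

lemma eval_at_scale:
  assumes "supported N x" "degree_le f d"
  shows "eval_at (scale c f) x = c * eval_at f x"
  unfolding eval_at_eq_sum[OF assms(1) degree_le_scale[OF assms(2)]] eval_at_eq_sum[OF assms]
  by (simp add: scale.rep_eq mult.assoc sum_distrib_left)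

lemma eval_at_mult:
  assumes "supported N x" "degree_le f d" "degree_le g e"
  shows "eval_at (f * g) x = eval_at f x * eval_at g x"
proof -
  let ?h = "\<lambda>(a, b). coeff f a * coeff g b * (monomial_value x a * monomial_value x b)"
  let ?M = "monomials N (d + e)" and ?P = "\<lambda>m. {(a, b). a + b = m}"
  have "eval_at (f * g) x = (\<Sum>m\<in>?M. \<Sum>p\<in>splits m. ?h p)"
    unfolding eval_at_eq_sum[OF assms(1) degree_le_mult[OF assms(2,3)]]
    by (intro sum.cong refl)
       (auto simp: times_pser.rep_eq sum_distrib_right splits_def monomial_value_add intro!: sum.cong)
  also have "\<dots> = sum ?h (\<Union>m\<in>?M. splits m)"
    by (rule sum.UNION_disjoint[symmetric]) (simp_all add: finite_monomials, auto simp: splits_def)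
  \<comment> \<open>A pair of total degree at most \<open>d + e\<close> outside the product exceeds
    one of the two bounds, so one of its coefficients is 0.\<close>
  also have "\<dots> = sum ?h (monomials N d \<times> monomials N e)"
  proof (rule sum.mono_neutral_right)
    show "finite (\<Union>m\<in>?M. splits m)" by (simp add: finite_monomials)
    show "monomials N d \<times> monomials N e \<subseteq> (\<Union>m\<in>?M. splits m)"
    proof clarify
      fix a b assume "a \<in> monomials N d" "b \<in> monomials N e"
      then have "a + b \<in> ?M" by (simp add: monomials_add_iff) (auto simp: monomials_def)
      then show "(a, b) \<in> (\<Union>m\<in>?M. splits m)" by (auto simp: splits_def)
    qed
    show "\<forall>p\<in>(\<Union>m\<in>?M. splits m) - monomials N d \<times> monomials N e. ?h p = 0"
    proof
      fix p assume p: "p \<in> (\<Union>m\<in>?M. splits m) - monomials N d \<times> monomials N e"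
      obtain a b where ab: "p = (a, b)" by (cases p)
      from p have "a + b \<in> ?M" and n: "(a, b) \<notin> monomials N d \<times> monomials N e"
        by (auto simp: splits_def ab)
      then have "\<not> (mdeg a \<le> d \<and> mdeg b \<le> e)"
        using n by (simp add: monomials_add_iff) (auto simp: monomials_def)
      then have "coeff f a = 0 \<or> coeff g b = 0"
        using degree_leD[OF assms(2), of a] degree_leD[OF assms(3), of b] by blast
      then show "?h p = 0" by (auto simp: ab)
    qed
  qed
  also have "\<dots> = eval_at f x * eval_at g x"
    unfolding eval_at_eq_sum[OF assms(1,2)] eval_at_eq_sum[OF assms(1,3)] sum_product
    by (simp add: sum.cartesian_product case_prod_unfold mult_ac)
  finally show ?thesis .
qed

lemma eval_at_one: "supported N x \<Longrightarrow> eval_at 1 x = 1"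
proof -
  assume "supported N x"
  then have "eval_at 1 x = (\<Sum>m\<in>monomials N 0. coeff 1 m * monomial_value x m)"
    by (rule eval_at_eq_sum) (rule degree_le_one)
  moreover have "monomials N 0 = {0}" by (auto simp: monomials_def)
  ultimately show ?thesis by (simp add: one_pser.rep_eq monomial_value_def)
qed

lemma degree_le_power_sum: "degree_le (power_sum k) k"
  by (auto simp: degree_le_def power_sum.rep_eq)

lemma eval_at_power_sum:
  assumes "supported N x" "k > 0"
  shows "eval_at (power_sum k) x = (\<Sum>i<N. x i ^ k)"
proof -
  let ?s = "\<lambda>i. Poly_Mapping.single i k"
  have "eval_at (power_sum k) x = (\<Sum>m\<in>monomials N k. coeff (power_sum k) m * monomial_value x m)"
    by (rule eval_at_eq_sum[OF assms(1) degree_le_power_sum])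
  also have "\<dots> = (\<Sum>m\<in>?s ` {..<N}. coeff (power_sum k) m * monomial_value x m)"
    using assms(2) by (intro sum.mono_neutral_right finite_monomials)
      (auto simp: monomials_def power_sum.rep_eq split: if_splits)
  also have "\<dots> = (\<Sum>i<N. coeff (power_sum k) (?s i) * monomial_value x (?s i))"
  proof (subst sum.reindex)
    show "inj_on ?s {..<N}"
    proof (rule inj_onI)
      fix i j assume "?s i = ?s j"
      then have "Poly_Mapping.lookup (?s i) i = Poly_Mapping.lookup (?s j) i" by simp
      then show "i = j" using assms(2) by (auto simp: lookup_single when_def split: if_splits)
    qed
  qed simp
  also have "\<dots> = (\<Sum>i<N. x i ^ k)"
    using assms(2) by (intro sum.cong) (auto simp: power_sum.rep_eq monomial_value_def)
  finally show ?thesis .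
qed

lemma supported_partition_seq: "supported (length \<mu>) (partition_seq \<mu>)"
  by (simp add: supported_def partition_seq_def)

definition value_at :: "nat list \<Rightarrow> pser \<Rightarrow> complex"
  where "value_at \<nu> f = eval_at f (partition_seq \<nu>)"

lemma value_at_add: "f \<in> Gamma \<Longrightarrow> g \<in> Gamma \<Longrightarrow> value_at \<nu> (f + g) = value_at \<nu> f + value_at \<nu> g"
  unfolding value_at_def by (metis Gamma_degree_le eval_at_add supported_partition_seq)

lemma value_at_scale: "f \<in> Gamma \<Longrightarrow> value_at \<nu> (scale c f) = c * value_at \<nu> f"
  unfolding value_at_def by (metis Gamma_degree_le eval_at_scale supported_partition_seq)

lemma value_at_mult: "f \<in> Gamma \<Longrightarrow> g \<in> Gamma \<Longrightarrow> value_at \<nu> (f * g) = value_at \<nu> f * value_at \<nu> g"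
  unfolding value_at_def by (metis Gamma_degree_le eval_at_mult supported_partition_seq)

lemma value_at_one [simp]: "value_at \<nu> 1 = 1"
  unfolding value_at_def by (metis eval_at_one supported_partition_seq)

lemma value_at_zero [simp]: "value_at \<nu> 0 = 0"
  using value_at_scale[OF Gamma.one, of \<nu> 0] by simp

lemma value_at_uminus: "f \<in> Gamma \<Longrightarrow> value_at \<nu> (- f) = - value_at \<nu> f"
  using value_at_scale[of f \<nu> "-1"] by simp

lemma value_at_diff: "f \<in> Gamma \<Longrightarrow> g \<in> Gamma \<Longrightarrow> value_at \<nu> (f - g) = value_at \<nu> f - value_at \<nu> g"
  using value_at_add[of f "- g" \<nu>] by (simp add: Gamma_uminus value_at_uminus)

lemma value_at_sum: "(\<And>i. i \<in> I \<Longrightarrow> f i \<in> Gamma) \<Longrightarrow> value_at \<nu> (sum f I) = (\<Sum>i\<in>I. value_at \<nu> (f i))"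
  by (induction I rule: infinite_finite_induct) (auto simp: value_at_add Gamma_sum)

lemma value_at_minus_one_power: "value_at \<nu> ((- 1) ^ k) = (- 1) ^ k"
  by (cases "even k") (auto simp: value_at_uminus Gamma.one)

lemma value_at_numeral: "value_at \<nu> (numeral k) = numeral k"
  by (simp add: numeral_pser value_at_scale Gamma.one)

lemma value_at_power_sum: "k > 0 \<Longrightarrow> value_at \<nu> (power_sum k) = (\<Sum>i<length \<nu>. of_nat (\<nu> ! i) ^ k)"
  unfolding value_at_def eval_at_power_sum[OF supported_partition_seq]
  by (intro sum.cong) (auto simp: partition_seq_def)

section \<open>Homogeneous components\<close>

lemma hom_component_add: "hom_component k (f + g) = hom_component k f + hom_component k g"
  by (rule pser_eqI) (simp add: hom_component.rep_eq plus_pser.rep_eq)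

lemma hom_component_scale: "hom_component k (scale c f) = scale c (hom_component k f)"
  by (rule pser_eqI) (simp add: hom_component.rep_eq scale.rep_eq)

lemma coeff_sum: "coeff (sum f I) m = (\<Sum>i\<in>I. coeff (f i) m)"
  by (induction I rule: infinite_finite_induct) (simp_all add: zero_pser.rep_eq plus_pser.rep_eq)

lemma hom_component_sum: "hom_component k (sum f I) = (\<Sum>i\<in>I. hom_component k (f i))"
  by (rule pser_eqI) (simp add: hom_component.rep_eq coeff_sum)

lemma hom_component_mult:
  "hom_component k (f * g) = (\<Sum>i\<le>k. hom_component i f * hom_component (k - i) g)"
proof (rule pser_eqI)
  fix m
  have "coeff (\<Sum>i\<le>k. hom_component i f * hom_component (k - i) g) m
    = (\<Sum>i\<le>k. \<Sum>p\<in>splits m. (if mdeg (fst p) = i then coeff f (fst p) else 0)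
        * (if mdeg (snd p) = k - i then coeff g (snd p) else 0))"
    by (simp add: coeff_sum times_pser.rep_eq hom_component.rep_eq case_prod_unfold)
  also have "\<dots> = (\<Sum>p\<in>splits m. \<Sum>i\<le>k. (if mdeg (fst p) = i then coeff f (fst p) else 0)
        * (if mdeg (snd p) = k - i then coeff g (snd p) else 0))"
    by (rule sum.swap)
  also have "\<dots> = (\<Sum>p\<in>splits m. if mdeg m = k then coeff f (fst p) * coeff g (snd p) else 0)"
  proof (rule sum.cong[OF refl])
    fix p assume "p \<in> splits m"
    then have m: "mdeg m = mdeg (fst p) + mdeg (snd p)"
      by (auto simp: splits_def mdeg_add)
    have "(\<Sum>i\<le>k. (if mdeg (fst p) = i then coeff f (fst p) else 0)
        * (if mdeg (snd p) = k - i then coeff g (snd p) else 0))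
      = (\<Sum>i\<le>k. if i = mdeg (fst p) then (if mdeg (snd p) = k - i then coeff f (fst p) * coeff g (snd p) else 0) else 0)"
      by (intro sum.cong) auto
    also have "\<dots> = (if mdeg m = k then coeff f (fst p) * coeff g (snd p) else 0)"
      by (auto simp: m)
    finally show "(\<Sum>i\<le>k. (if mdeg (fst p) = i then coeff f (fst p) else 0)
        * (if mdeg (snd p) = k - i then coeff g (snd p) else 0))
      = (if mdeg m = k then coeff f (fst p) * coeff g (snd p) else 0)" .
  qed
  also have "\<dots> = coeff (hom_component k (f * g)) m"
    by (simp add: hom_component.rep_eq times_pser.rep_eq case_prod_unfold)
  finally show "coeff (hom_component k (f * g)) m
    = coeff (\<Sum>i\<le>k. hom_component i f * hom_component (k - i) g) m" by simp
qed

lemma hom_component_gt: "degree_le f d \<Longrightarrow> d < k \<Longrightarrow> hom_component k f = 0"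
  by (rule pser_eqI) (auto simp: hom_component.rep_eq zero_pser.rep_eq dest!: degree_leD)

lemma hom_component_mult_top:
  assumes "degree_le f d" "degree_le g e"
  shows "hom_component (d + e) (f * g) = hom_component d f * hom_component e g"
proof -
  have "hom_component (d + e) (f * g) = (\<Sum>i\<le>d + e. hom_component i f * hom_component (d + e - i) g)"
    by (rule hom_component_mult)
  also have "\<dots> = (\<Sum>i\<in>{d}. hom_component i f * hom_component (d + e - i) g)"
  proof (rule sum.mono_neutral_right)
    show "\<forall>i\<in>{..d + e} - {d}. hom_component i f * hom_component (d + e - i) g = 0"
    proof
      fix i assume "i \<in> {..d + e} - {d}"
      then have "d < i \<or> e < d + e - i" by auto
      then show "hom_component i f * hom_component (d + e - i) g = 0"
        using hom_component_gt[OF assms(1)] hom_component_gt[OF assms(2)] by auto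
    qed
  qed auto
  finally show ?thesis by simp
qed

lemma hom_component_expand:
  assumes "\<And>m. coeff f m \<noteq> 0 \<Longrightarrow> mdeg m < n"
  shows "f = (\<Sum>k<n. hom_component k f)"
  using assms by (intro pser_eqI) (force simp: coeff_sum hom_component.rep_eq)

lemma hom_component_homogeneous:
  assumes "\<And>m. coeff f m \<noteq> 0 \<Longrightarrow> mdeg m = d"
  shows "hom_component k f = (if k = d then f else 0)"
  using assms by (intro pser_eqI) (auto simp: hom_component.rep_eq zero_pser.rep_eq)

section \<open>The functions \<open>q\<^sub>r\<close>\<close>

text \<open>The k-th power of the variable \<open>i\<close> can be split off only where its exponent
  is at least \<open>k\<close>. Subtraction of exponents is truncated, so this condition must
  restrict the sum.\<close>

lemma coeff_power_sum_mult:
  assumes "k > 0"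
  shows "coeff (power_sum k * f) m
    = (\<Sum>i | k \<le> Poly_Mapping.lookup m i. coeff f (m - Poly_Mapping.single i k))"
proof -
  let ?s = "\<lambda>i. Poly_Mapping.single i k" and ?I = "{i. k \<le> Poly_Mapping.lookup m i}"
  have fin: "finite ?I"
    by (rule finite_subset[of _ "Poly_Mapping.keys m"]) (use assms in \<open>auto simp: in_keys_iff\<close>)
  have split: "?s i + (m - ?s i) = m" if "i \<in> ?I" for i
    using that by (intro poly_mapping_eqI) (auto simp: lookup_add lookup_minus lookup_single when_def)
  have "coeff (power_sum k * f) m = (\<Sum>p\<in>splits m. coeff (power_sum k) (fst p) * coeff f (snd p))"
    by (simp add: times_pser.rep_eq case_prod_unfold)
  also have "\<dots> = (\<Sum>p\<in>(\<lambda>i. (?s i, m - ?s i)) ` ?I. coeff (power_sum k) (fst p) * coeff f (snd p))"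
  proof (rule sum.mono_neutral_right)
    show "(\<lambda>i. (?s i, m - ?s i)) ` ?I \<subseteq> splits m"
      using split by (auto simp: splits_def)
    show "\<forall>p\<in>splits m - (\<lambda>i. (?s i, m - ?s i)) ` ?I. coeff (power_sum k) (fst p) * coeff f (snd p) = 0"
    proof
      fix p assume p: "p \<in> splits m - (\<lambda>i. (?s i, m - ?s i)) ` ?I"
      have "fst p \<noteq> ?s i" for i
      proof
        assume i: "fst p = ?s i"
        then have m: "m = ?s i + snd p" using p by (auto simp: splits_def)
        then have "i \<in> ?I" by (simp add: lookup_add)
        moreover have "p = (?s i, m - ?s i)" using i m by (simp add: prod_eq_iff)
        ultimately show False using p by blast
      qed
      then show "coeff (power_sum k) (fst p) * coeff f (snd p) = 0"
        by (simp add: power_sum.rep_eq)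
    qed
  qed simp
  also have "\<dots> = (\<Sum>i\<in>?I. coeff (power_sum k) (?s i) * coeff f (m - ?s i))"
  proof (subst sum.reindex)
    show "inj_on (\<lambda>i. (?s i, m - ?s i)) ?I"
    proof (rule inj_onI)
      fix i j assume "(?s i, m - ?s i) = (?s j, m - ?s j)"
      then have "Poly_Mapping.lookup (?s i) i = Poly_Mapping.lookup (?s j) i" by simp
      then show "i = j" using assms by (auto simp: lookup_single when_def split: if_splits)
    qed
  qed simp
  also have "\<dots> = (\<Sum>i\<in>?I. coeff f (m - ?s i))"
    by (intro sum.cong) (auto simp: power_sum.rep_eq)
  finally show ?thesis .
qed

text \<open>A variable disappears exactly when its whole exponent is removed, and the coefficient is
  then halved.\<close>

lemma coeff_schur_q_diff:
  assumes "0 < k" "k \<le> r" "k \<le> Poly_Mapping.lookup m i"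
  shows "coeff (schur_q (r - k)) (m - Poly_Mapping.single i k)
    = (if mdeg m = r then 2 ^ (if Poly_Mapping.lookup m i = k then card (Poly_Mapping.keys m) - 1
         else card (Poly_Mapping.keys m)) else 0)"
proof -
  let ?m = "m - Poly_Mapping.single i k"
  have "m = ?m + Poly_Mapping.single i k"
    using assms by (intro poly_mapping_eqI) (auto simp: lookup_add lookup_minus lookup_single when_def)
  then have "mdeg m = mdeg ?m + k" by (metis mdeg_add mdeg_single)
  then have 1: "mdeg ?m = r - k \<longleftrightarrow> mdeg m = r" using assms by auto
  have "Poly_Mapping.keys ?m
      = (if Poly_Mapping.lookup m i = k then Poly_Mapping.keys m - {i} else Poly_Mapping.keys m)"
    using assms by (auto simp: in_keys_iff lookup_minus lookup_single when_def split: if_splits)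
  moreover have "i \<in> Poly_Mapping.keys m" using assms by (auto simp: in_keys_iff)
  ultimately have "card (Poly_Mapping.keys ?m) = (if Poly_Mapping.lookup m i = k
      then card (Poly_Mapping.keys m) - 1 else card (Poly_Mapping.keys m))"
    by simp
  with 1 show ?thesis by (simp add: schur_q.rep_eq)
qed

text \<open>The contribution of one variable of exponent \<open>n\<close> to Newton's relation: the
  term with \<open>Suc i = n\<close> uses up the variable and counts half.\<close>

lemma sum_alternate:
  "(\<Sum>i<n. if even i then (if Suc i = n then c else 2 * c) else 0) = of_nat n * (c :: complex)"
proof -
  have *: "(\<Sum>i<p. if even i then 2 * c else 0) = (of_nat p + (if even p then 0 else 1)) * c" for p
    by (induction p) (auto simp: algebra_simps)
  show ?thesis
  proof (cases n)
    case (Suc p)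
    have "(\<Sum>i<n. if even i then (if Suc i = n then c else 2 * c) else 0)
      = (\<Sum>i<p. if even i then 2 * c else 0) + (if even p then c else 0)"
      unfolding Suc by (auto intro!: sum.cong)
    then show ?thesis using Suc * by (auto simp: algebra_simps)
  qed simp
qed

definition odd_power_sums :: "nat \<Rightarrow> pser"
  where "odd_power_sums i = (if even i then power_sum (Suc i) else 0)"

text \<open>
  The logarithmic derivative of \<open>\<Prod>\<^sub>i (1 + x\<^sub>i z) / (1 - x\<^sub>i z)\<close> is
  \<open>2 (p\<^sub>1 + p\<^sub>3 z\<^sup>2 + p\<^sub>5 z\<^sup>4 + \<dots>)\<close>.
\<close>

lemma schur_q_newton:
  "of_nat (Suc n) * schur_q (Suc n) = 2 * (\<Sum>i\<le>n. odd_power_sums i * schur_q (n - i))"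
proof (rule pser_eqI)
  fix m :: "nat \<Rightarrow>\<^sub>0 nat"
  let ?l = "Poly_Mapping.lookup m" and ?K = "Poly_Mapping.keys m"
  let ?c = "2 ^ card ?K :: complex"
  let ?h = "\<lambda>i j. if even i then (if Suc i = ?l j then ?c else 2 * ?c) else 0"
  have summand: "coeff (odd_power_sums i * schur_q (n - i)) m * 2
      = (if mdeg m = Suc n then (\<Sum>j | j \<in> ?K \<and> i < ?l j. ?h i j) else 0)" if "i \<le> n" for i
  proof (cases "even i")
    case True
    have "coeff (odd_power_sums i * schur_q (n - i)) m * 2
      = (\<Sum>j | Suc i \<le> ?l j. coeff (schur_q (Suc n - Suc i)) (m - Poly_Mapping.single j (Suc i)) * 2)"
      using True by (simp add: odd_power_sums_def coeff_power_sum_mult sum_distrib_right)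
    also have "\<dots> = (\<Sum>j | Suc i \<le> ?l j. if mdeg m = Suc n then ?h i j else 0)"
    proof (rule sum.cong[OF refl])
      fix j assume j: "j \<in> {j. Suc i \<le> ?l j}"
      then have "card ?K > 0"
        by (intro card_gt_0_iff[THEN iffD2]) (auto simp: in_keys_iff intro!: exI[of _ j])
      then have "2 ^ (card ?K - 1) * 2 = ?c" by (metis Suc_diff_1 power_Suc2)
      moreover have "m \<noteq> 0" using j by auto
      ultimately show "coeff (schur_q (Suc n - Suc i)) (m - Poly_Mapping.single j (Suc i)) * 2
        = (if mdeg m = Suc n then ?h i j else 0)"
        using True j that by (subst coeff_schur_q_diff) auto
    qed
    also have "{j. Suc i \<le> ?l j} = {j. j \<in> ?K \<and> i < ?l j}"
      by (auto simp: in_keys_iff)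
    finally show ?thesis by (simp cong: sum.cong)
  qed (simp add: odd_power_sums_def zero_pser.rep_eq)
  have "coeff (2 * (\<Sum>i\<le>n. odd_power_sums i * schur_q (n - i))) m
      = (\<Sum>i\<le>n. coeff (odd_power_sums i * schur_q (n - i)) m * 2)"
    by (simp add: numeral_pser scale_mult_left scale.rep_eq coeff_sum sum_distrib_left mult.commute)
  also have "\<dots> = (if mdeg m = Suc n then (\<Sum>i\<le>n. \<Sum>j | j \<in> ?K \<and> i < ?l j. ?h i j) else 0)"
    using summand by (auto intro!: sum.cong sum.neutral)
  also have "\<dots> = (if mdeg m = Suc n then of_nat (Suc n) * ?c else 0)"
  proof (cases "mdeg m = Suc n")
    case True
    have le: "?l j \<le> Suc n" if "j \<in> ?K" for j
      unfolding True[symmetric] mdeg_def using that by (intro member_le_sum) auto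
    have "(\<Sum>i\<le>n. \<Sum>j | j \<in> ?K \<and> i < ?l j. ?h i j) = (\<Sum>j\<in>?K. \<Sum>i | i \<in> {..n} \<and> i < ?l j. ?h i j)"
      by (rule sum.swap_restrict) auto
    also have "\<dots> = (\<Sum>j\<in>?K. \<Sum>i<?l j. ?h i j)"
      by (intro sum.cong) (use le in force)+
    also have "\<dots> = (\<Sum>j\<in>?K. of_nat (?l j) * ?c)"
      by (simp only: sum_alternate)
    also have "\<dots> = of_nat (mdeg m) * ?c"
      by (simp add: mdeg_def sum_distrib_right)
    finally show ?thesis using True by simp
  qed simp
  also have "\<dots> = coeff (of_nat (Suc n) * schur_q (Suc n)) m"
    unfolding of_nat_pser[of "Suc n"] by (simp add: scale_mult_left scale.rep_eq schur_q.rep_eq)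
  finally show "coeff (of_nat (Suc n) * schur_q (Suc n)) m
    = coeff (2 * (\<Sum>i\<le>n. odd_power_sums i * schur_q (n - i))) m" by simp
qed

lemma schur_q_0 [simp]: "schur_q 0 = 1"
  by (rule pser_eqI) (simp add: schur_q.rep_eq one_pser.rep_eq)

lemma odd_power_sums_Gamma: "odd_power_sums i \<in> Gamma"
  by (auto simp: odd_power_sums_def Gamma_zero intro: Gamma.intros)

text \<open>Newton's relation can be solved for the last \<open>q\<close>, because positive integers
  are invertible scalars.\<close>

lemma schur_q_Gamma: "schur_q n \<in> Gamma"
proof (induction n rule: less_induct)
  case (less n)
  show ?case
  proof (cases n)
    case (Suc k)
    have "schur_q (Suc k) = scale (1 / of_nat (Suc k)) (of_nat (Suc k) * schur_q (Suc k))"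
      unfolding of_nat_pser[of "Suc k"] by (simp add: scale_mult_left del: of_nat_Suc)
    moreover have "of_nat (Suc k) * schur_q (Suc k) \<in> Gamma"
      unfolding schur_q_newton using less Suc
      by (intro Gamma.mult Gamma_sum Gamma_numeral odd_power_sums_Gamma) auto
    ultimately show ?thesis using Suc by (metis Gamma.scale)
  qed (simp add: Gamma.one)
qed

text \<open>This is \<open>E(z) E(-z) = 1\<close> for the generating series \<open>E\<close> of the
  \<open>q_r\<close>. The series \<open>P\<close> has only even powers, so \<open>E' = 2 P E\<close>
  gives \<open>F' = - 2 P F\<close> for \<open>F(z) = E(-z)\<close>, and the derivative of
  \<open>E F\<close> vanishes.\<close>

lemma schur_q_alternating:
  assumes "n > 0"
  shows "(\<Sum>i\<le>n. (- 1) ^ (n - i) * schur_q i * schur_q (n - i)) = 0"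
proof -
  define E where "E = Abs_fps schur_q"
  define F where "F = Abs_fps (\<lambda>n. (- 1) ^ n * schur_q n)"
  define P where "P = Abs_fps odd_power_sums"
  have E: "fps_deriv E = P * E + P * E"
  proof (rule fps_ext)
    fix n
    have "fps_nth (fps_deriv E) n = of_nat (Suc n) * schur_q (Suc n)"
      by (simp only: E_def fps_deriv_nth fps_nth_Abs_fps Suc_eq_plus1)
    then show "fps_nth (fps_deriv E) n = fps_nth (P * E + P * E) n"
      unfolding schur_q_newton
      by (simp only: E_def P_def fps_add_nth fps_mult_nth fps_nth_Abs_fps mult_2 atLeast0AtMost)
  qed
  have F: "fps_deriv F = - (P * F + P * F)"
  proof (rule fps_ext)
    fix n
    have "fps_nth (fps_deriv F) n = (- 1) ^ Suc n * (of_nat (Suc n) * schur_q (Suc n))"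
      unfolding F_def fps_deriv_nth fps_nth_Abs_fps Suc_eq_plus1 by (rule mult.left_commute)
    also have "\<dots> = - (2 * (\<Sum>i\<le>n. odd_power_sums i * ((- 1) ^ n * schur_q (n - i))))"
      unfolding schur_q_newton by (simp add: sum_distrib_left sum_negf mult_ac)
    also have "(\<Sum>i\<le>n. odd_power_sums i * ((- 1) ^ n * schur_q (n - i)))
        = (\<Sum>i\<le>n. odd_power_sums i * ((- 1) ^ (n - i) * schur_q (n - i)))"
    proof (rule sum.cong[OF refl])
      fix i assume "i \<in> {..n}"
      then have "(- 1 :: pser) ^ n = (- 1) ^ (n - i) * (- 1) ^ i" by (simp flip: power_add)
      then show "odd_power_sums i * ((- 1) ^ n * schur_q (n - i))
        = odd_power_sums i * ((- 1) ^ (n - i) * schur_q (n - i))"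
        by (cases "even i") (auto simp: odd_power_sums_def)
    qed
    also have "- (2 * (\<Sum>i\<le>n. odd_power_sums i * ((- 1) ^ (n - i) * schur_q (n - i))))
      = fps_nth (- (P * F + P * F)) n"
      by (simp only: F_def P_def fps_neg_nth fps_add_nth fps_mult_nth fps_nth_Abs_fps mult_2 atLeast0AtMost)
    finally show "fps_nth (fps_deriv F) n = fps_nth (- (P * F + P * F)) n" .
  qed
  have "fps_deriv (E * F) = 0"
    by (simp add: E F algebra_simps)
  then have "fps_nth (fps_deriv (E * F)) (n - 1) = 0" by simp
  then have "of_nat n * fps_nth (E * F) n = 0"
    unfolding fps_deriv_nth using assms by simp
  then have "fps_nth (E * F) n = 0"
    using assms by (simp add: of_nat_mult_pser_eq_0)
  then show ?thesis
    by (simp add: E_def F_def fps_mult_nth atLeast0AtMost mult_ac)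
qed

text \<open>The alternating sum of degree \<open>2 r\<close> is symmetric about
  \<open>i = r\<close>; its two equal halves and its middle term make up
  \<open>(-1)^r Q_{r,r}\<close>. It yields the relation by which squares are straightened.\<close>

lemma schur_Q2_diagonal:
  assumes "r > 0"
  shows "schur_Q2 r r = 0"
proof -
  let ?f = "\<lambda>i. (- 1) ^ (2 * r - i) * schur_q i * schur_q (2 * r - i)"
  have sign: "(- 1 :: pser) ^ (r - i) = (- 1) ^ r * (- 1) ^ i" if "i \<le> r" for i
  proof -
    have "(- 1 :: pser) ^ r = (- 1) ^ (r - i) * (- 1) ^ i" using that by (simp flip: power_add)
    then show ?thesis by (simp add: mult.assoc flip: power_mult_distrib)
  qed
  have upper: "(\<Sum>i=Suc r..2 * r. ?f i) = (\<Sum>i=1..r. (- 1) ^ r * ((- 1) ^ i * schur_q (r + i) * schur_q (r - i)))"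
  proof (rule sum.reindex_bij_witness[of _ "\<lambda>i. r + i" "\<lambda>i. i - r"])
    fix a assume a: "a \<in> {Suc r..2 * r}"
    then have e: "r - (a - r) = 2 * r - a" "r + (a - r) = a" "a - r \<le> r" by auto
    show "(- 1) ^ r * ((- 1) ^ (a - r) * schur_q (r + (a - r)) * schur_q (r - (a - r))) = ?f a"
      unfolding sign[OF e(3), unfolded e(1)] e(1,2) by (simp only: mult_ac)
  qed auto
  have lower: "(\<Sum>i<r. ?f i) = (\<Sum>i=1..r. (- 1) ^ r * ((- 1) ^ i * schur_q (r + i) * schur_q (r - i)))"
  proof (rule sum.reindex_bij_witness[of _ "\<lambda>i. r - i" "\<lambda>i. r - i"])
    fix a assume a: "a \<in> {..<r}"
    then have e: "2 * r - a = r + (r - a)" "r - (r - a) = a" by auto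
    show "(- 1) ^ r * ((- 1) ^ (r - a) * schur_q (r + (r - a)) * schur_q (r - (r - a))) = ?f a"
      unfolding e power_add by (simp only: mult_ac)
  qed auto
  have "{..2 * r} = {..<r} \<union> ({r} \<union> {Suc r..2 * r})" by auto
  then have "(\<Sum>i\<le>2 * r. ?f i) = (\<Sum>i<r. ?f i) + (?f r + (\<Sum>i=Suc r..2 * r. ?f i))"
    by (simp only:) (subst sum.union_disjoint; auto)+
  also have "\<dots> = (- 1) ^ r * schur_Q2 r r"
    unfolding upper lower by (simp add: schur_Q2_def algebra_simps sum_distrib_left)
  finally have "(- 1) ^ r * schur_Q2 r r = 0"
    using schur_q_alternating[of "2 * r"] assms by simp
  then have "(- 1) ^ r * ((- 1) ^ r * schur_Q2 r r) = 0" by simp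
  then show ?thesis by (simp flip: mult.assoc power_mult_distrib)
qed

lemma schur_Q2_0: "schur_Q2 r 0 = schur_q r"
  by (simp add: schur_Q2_def)

text \<open>Shifts a unit from the second index to the first, so that claims for all
  \<open>r\<close> reduce by induction on \<open>s\<close> to \<open>schur_Q2_0\<close>.\<close>

lemma schur_Q2_Suc:
  "schur_Q2 r (Suc s) = schur_q r * schur_q (Suc s) - schur_q (Suc r) * schur_q s - schur_Q2 (Suc r) s"
proof -
  have "(\<Sum>i=1..Suc s. (- 1) ^ i * schur_q (r + i) * schur_q (Suc s - i))
    = - (schur_q (Suc r) * schur_q s) + (\<Sum>i=Suc 1..Suc s. (- 1) ^ i * schur_q (r + i) * schur_q (Suc s - i))"
    by (subst sum.atLeast_Suc_atMost) auto
  also have "(\<Sum>i=Suc 1..Suc s. (- 1) ^ i * schur_q (r + i) * schur_q (Suc s - i))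
    = - (\<Sum>i=1..s. (- 1) ^ i * schur_q (Suc r + i) * schur_q (s - i))"
    by (subst sum.shift_bounds_cl_Suc_ivl) (simp add: sum_negf)
  finally have "(\<Sum>i=1..Suc s. (- 1) ^ i * schur_q (r + i) * schur_q (Suc s - i))
    = - (schur_q (Suc r) * schur_q s) - (\<Sum>i=1..s. (- 1) ^ i * schur_q (Suc r + i) * schur_q (s - i))"
    by simp
  then show ?thesis
    unfolding schur_Q2_def by (simp only:) (simp add: algebra_simps)
qed

lemma schur_Q2_Gamma: "schur_Q2 r s \<in> Gamma"
  unfolding schur_Q2_def
  by (intro Gamma.add Gamma.mult Gamma_sum Gamma_numeral Gamma_minus_one_power schur_q_Gamma)

lemma coeff_schur_q_nonzero: "coeff (schur_q r) m \<noteq> 0 \<Longrightarrow> mdeg m = r"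
  by (simp add: schur_q.rep_eq split: if_splits)

lemma coeff_schur_Q2_nonzero: "coeff (schur_Q2 r s) m \<noteq> 0 \<Longrightarrow> mdeg m = r + s"
proof (induction s arbitrary: r)
  case 0
  then show ?case by (simp add: schur_Q2_0 coeff_schur_q_nonzero)
next
  case (Suc s)
  have q: "mdeg m = a + b" if "coeff (schur_q a * schur_q b) m \<noteq> 0" for a b
    using that by (auto elim!: coeff_times_nonzeroE simp: mdeg_add dest!: coeff_schur_q_nonzero)
  from Suc.prems have "coeff (schur_q r * schur_q (Suc s)) m \<noteq> 0 \<or>
      coeff (schur_q (Suc r) * schur_q s) m \<noteq> 0 \<or> coeff (schur_Q2 (Suc r) s) m \<noteq> 0"
    unfolding schur_Q2_Suc minus_pser.rep_eq by auto
  then show ?case using q[of r "Suc s"] q[of "Suc r" s] Suc.IH[of "Suc r"] by auto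
qed

section \<open>Spanning sets of \<open>\<Gamma>\<close>\<close>

definition q_prod :: "nat list \<Rightarrow> pser"
  where "q_prod xs = prod_list (map schur_q xs)"

lemma sum_list_squares_le: "sum_list (map (\<lambda>x. x\<^sup>2) xs) \<le> (sum_list xs)\<^sup>2" for xs :: "nat list"
  by (induction xs) (auto simp: power2_sum)

text \<open>
  The relation \<open>q\<^sub>r\<^sup>2 = 2 \<Sum>\<^sub>i (-1)\<^sup>i\<^sup>+\<^sup>1 q\<^sub>r\<^sub>+\<^sub>i q\<^sub>r\<^sub>-\<^sub>i\<close> removes repeated factors; it increases the
  sum of the squares of the indices, so the straightening ends.
\<close>

lemma q_prod_straighten:
  "q_prod xs \<in> pser.span (q_prod ` {\<kappa>. strict_partition \<kappa> \<and> sum_list \<kappa> = sum_list xs})"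
proof (induction "(sum_list xs)\<^sup>2 - sum_list (map (\<lambda>x. x\<^sup>2) xs)" arbitrary: xs rule: less_induct)
  case less
  let ?S = "pser.span (q_prod ` {\<kappa>. strict_partition \<kappa> \<and> sum_list \<kappa> = sum_list xs})"
  \<comment> \<open>Zero entries contribute \<open>q_0 = 1\<close>. They are dropped because the
    relation for a square needs a positive index.\<close>
  define ys where "ys = filter (\<lambda>x. x \<noteq> 0) xs"
  have ys: "q_prod ys = q_prod xs" "sum_list ys = sum_list xs"
      "sum_list (map (\<lambda>x. x\<^sup>2) ys) = sum_list (map (\<lambda>x. x\<^sup>2) xs)" "0 \<notin> set ys"
    unfolding ys_def by (induction xs) (auto simp: q_prod_def)
  show ?case
  proof (cases "distinct ys")
    case True
    obtain \<kappa> where \<kappa>: "strict_partition \<kappa>" "set \<kappa> = set ys"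
      using ex_strict_partition[of "set ys"] ys(4) by auto
    have "q_prod \<kappa> = q_prod ys" "sum_list \<kappa> = sum_list ys"
      unfolding q_prod_def
      using True \<kappa> strict_partition_distinct[OF \<kappa>(1)] prod.distinct_set_conv_list[of \<kappa> schur_q]
        prod.distinct_set_conv_list[of ys schur_q]
      by (simp_all add: distinct_sum_list_conv_Sum)
    then show ?thesis using \<kappa>(1) ys by (intro pser.span_base) (metis (mono_tags, lifting) image_eqI mem_Collect_eq)
  next
    case False
    then obtain as y bs cs where dec: "ys = as @ [y] @ bs @ [y] @ cs"
      by (meson not_distinct_decomp)
    define zs where "zs = as @ bs @ cs"
    have "y > 0" using ys(4) dec by auto
    define ws where "ws i = (y + i) # (y - i) # zs" for i
    have "q_prod ys = schur_q y * schur_q y * q_prod zs"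
      by (simp add: dec zs_def q_prod_def mult_ac)
    also have "schur_q y * schur_q y = - (2 * (\<Sum>i=1..y. (- 1) ^ i * schur_q (y + i) * schur_q (y - i)))"
      using schur_Q2_diagonal[OF \<open>y > 0\<close>] by (simp add: schur_Q2_def eq_neg_iff_add_eq_0)
    also have "\<dots> * q_prod zs = - (2 * (\<Sum>i=1..y. (- 1) ^ i * q_prod (ws i)))"
      by (simp add: q_prod_def ws_def sum_distrib_right sum_distrib_left mult_ac)
    finally have eq: "q_prod xs = scale (- 2) (\<Sum>i=1..y. scale ((- 1) ^ i) (q_prod (ws i)))"
    proof -
      have s: "(- 1) ^ i * f = scale ((- 1) ^ i) f" for i and f :: pser by (cases "even i") auto
      assume "q_prod ys = - (2 * (\<Sum>i=1..y. (- 1) ^ i * q_prod (ws i)))"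
      then show ?thesis unfolding s ys(1) by (simp add: numeral_pser scale_mult_left)
    qed
    have "q_prod (ws i) \<in> ?S" if i: "i \<in> {1..y}" for i
    proof -
      have sum: "sum_list (ws i) = sum_list xs"
        using i by (simp add: ws_def zs_def dec flip: ys(2))
      have "(y + i)\<^sup>2 + (y - i)\<^sup>2 = y\<^sup>2 + y\<^sup>2 + 2 * i\<^sup>2"
      proof -
        obtain j where "y = i + j" using i by (auto simp: le_iff_add)
        then show ?thesis by (simp add: power2_eq_square algebra_simps)
      qed
      then have "sum_list (map (\<lambda>x. x\<^sup>2) (ws i)) = sum_list (map (\<lambda>x. x\<^sup>2) xs) + 2 * i\<^sup>2"
        by (simp add: ws_def zs_def dec flip: ys(3))
      then have "sum_list (map (\<lambda>x. x\<^sup>2) xs) < sum_list (map (\<lambda>x. x\<^sup>2) (ws i))" using i by simp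
      then show ?thesis
        using less[of "ws i"] sum_list_squares_le[of "ws i"] unfolding sum by linarith
    qed
    then show ?thesis unfolding eq by (intro pser.span_scale pser.span_sum)
  qed
qed

definition q_span :: "nat \<Rightarrow> pser set"
  where "q_span d = pser.span (q_prod ` {xs. sum_list xs = d})"

lemma q_prod_in_q_span: "sum_list xs = d \<Longrightarrow> q_prod xs \<in> q_span d"
  by (auto simp: q_span_def intro: pser.span_base)

lemma q_span_mult:
  assumes "f \<in> q_span d" "g \<in> q_span e"
  shows "f * g \<in> q_span (d + e)"
proof -
  have "q_prod xs * g \<in> q_span (d + e)" if xs: "sum_list xs = d" for xs
    using assms(2) unfolding q_span_def[of e]
  proof (induction rule: pser.span_induct_alt)
    case base
    then show ?case by (simp add: q_span_def pser.span_zero)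
  next
    case (step c x y)
    then obtain ys where "x = q_prod ys" "sum_list ys = e" by auto
    then have "q_prod xs * x \<in> q_span (d + e)"
      using xs q_prod_in_q_span[of "xs @ ys"] by (simp add: q_prod_def)
    with step show ?case
      by (simp add: distrib_left scale_mult_right q_span_def pser.span_add pser.span_scale)
  qed
  with assms(1) show ?thesis
    unfolding q_span_def[of d]
  proof (induction rule: pser.span_induct_alt)
    case base
    then show ?case by (simp add: q_span_def pser.span_zero)
  next
    case (step c x y)
    then show ?case
      by (auto simp: distrib_right scale_mult_left q_span_def intro!: pser.span_add pser.span_scale)
  qed
qed

lemma one_in_q_span: "1 \<in> q_span 0"
  using q_prod_in_q_span[of "[]" 0] by (simp add: q_prod_def)

lemma schur_q_in_q_span: "schur_q d \<in> q_span d"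
  using q_prod_in_q_span[of "[d]" d] by (simp add: q_prod_def)

text \<open>Newton's relation read the other way: the term with \<open>q_0 = 1\<close> isolates the
  last power sum.\<close>

lemma odd_power_sums_in_q_span: "odd_power_sums n \<in> q_span (Suc n)"
proof (induction n rule: less_induct)
  case (less n)
  have "of_nat (Suc n) * schur_q (Suc n)
      = 2 * odd_power_sums n + 2 * (\<Sum>i<n. odd_power_sums i * schur_q (n - i))"
    unfolding schur_q_newton by (simp add: lessThan_Suc_atMost[symmetric] algebra_simps)
  then have "scale 2 (odd_power_sums n)
      = scale (of_nat (Suc n)) (schur_q (Suc n)) - scale 2 (\<Sum>i<n. odd_power_sums i * schur_q (n - i))"
    unfolding of_nat_pser[of "Suc n"] numeral_pser scale_mult_left mult_1 by (simp add: algebra_simps)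
  moreover have "\<dots> \<in> q_span (Suc n)"
  proof -
    have "odd_power_sums i * schur_q (n - i) \<in> q_span (Suc n)" if "i < n" for i
      using q_span_mult[OF less[OF that] schur_q_in_q_span[of "n - i"]] that by simp
    then show ?thesis
      using schur_q_in_q_span[of "Suc n"] unfolding q_span_def
      by (intro pser.span_diff pser.span_scale pser.span_sum) auto
  qed
  ultimately have "scale (1 / 2) (scale 2 (odd_power_sums n)) \<in> q_span (Suc n)"
    unfolding q_span_def by (metis pser.span_scale)
  then show ?case by simp
qed

text \<open>The generators of \<open>\<Gamma>\<close> are homogeneous, so the algebra is graded; the
  degree of a product of \<open>q_r\<close> is the sum of its indices.\<close>

lemma hom_component_Gamma: "f \<in> Gamma \<Longrightarrow> hom_component k f \<in> q_span k"
proof (induction arbitrary: k rule: Gamma.induct)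
  case (odd_power_sum n)
  have "hom_component k (power_sum n) = (if k = n then power_sum n else 0)"
    by (rule hom_component_homogeneous) (auto simp: power_sum.rep_eq split: if_splits)
  moreover have "power_sum n \<in> q_span n"
    using odd_power_sums_in_q_span[of "n - 1"] odd_power_sum by (simp add: odd_power_sums_def odd_pos)
  ultimately show ?case by (simp add: q_span_def pser.span_zero)
next
  case one
  have "hom_component k 1 = (if k = 0 then 1 else 0)"
    by (rule hom_component_homogeneous) (auto simp: one_pser.rep_eq split: if_splits)
  then show ?case using one_in_q_span by (simp add: q_span_def pser.span_zero)
next
  case (add f g)
  then show ?case by (simp add: hom_component_add q_span_def pser.span_add)
next
  case (scale f c)
  then show ?case by (simp add: hom_component_scale q_span_def pser.span_scale)
next
  case (mult f g)
  have "hom_component i f * hom_component (k - i) g \<in> q_span k" if "i \<le> k" for i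
    using q_span_mult[OF mult.IH(1)[of i] mult.IH(2)[of "k - i"]] that by simp
  then show ?case
    unfolding hom_component_mult q_span_def by (intro pser.span_sum) auto
qed

text \<open>Homogeneous components reduce the claim to one degree, where straightening replaces
  arbitrary index lists by strict partitions.\<close>

lemma Gamma_span:
  assumes "f \<in> Gamma" "\<And>m. coeff f m \<noteq> 0 \<Longrightarrow> mdeg m < n"
  shows "f \<in> pser.span (q_prod ` {\<kappa>. strict_partition \<kappa> \<and> sum_list \<kappa> < n})"
proof -
  let ?S = "pser.span (q_prod ` {\<kappa>. strict_partition \<kappa> \<and> sum_list \<kappa> < n})"
  have "q_span k \<subseteq> ?S" if "k < n" for k
    unfolding q_span_def
  proof (rule pser.span_minimal)
    show "q_prod ` {xs. sum_list xs = k} \<subseteq> ?S"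
      using that by (auto intro!: pser.span_mono[THEN subsetD, OF _ q_prod_straighten])
  qed simp
  then have "(\<Sum>k<n. hom_component k f) \<in> ?S"
    using hom_component_Gamma[OF assms(1)] by (intro pser.span_sum) auto
  then show ?thesis using hom_component_expand[OF assms(2)] by simp
qed

section \<open>Values at a strict partition as sums over the parts\<close>

text \<open>\<open>2 * x\<close> times this is the residue of
  \<open>\<Prod> (z + y) / (z - y)\<close> at \<open>x\<close>. With that factor split off, the node
  0 keeps a nonzero coefficient although the residue there is 0.\<close>

definition node_coeff :: "'a :: field set \<Rightarrow> 'a \<Rightarrow> 'a"
  where "node_coeff Y x = (\<Prod>y\<in>Y - {x}. (x + y) / (x - y))"

lemma node_coeff_insert:
  assumes "finite Y" "y \<notin> Y"
  shows "x \<in> Y \<Longrightarrow> node_coeff (insert y Y) x = node_coeff Y x * ((x + y) / (x - y))"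
    and "node_coeff (insert y Y) y = (\<Prod>b\<in>Y. (y + b) / (y - b))"
proof -
  assume "x \<in> Y"
  then have "insert y Y - {x} = insert y (Y - {x})" using assms by auto
  then show "node_coeff (insert y Y) x = node_coeff Y x * ((x + y) / (x - y))"
    using assms by (simp add: node_coeff_def)
next
  show "node_coeff (insert y Y) y = (\<Prod>b\<in>Y. (y + b) / (y - b))"
    using assms by (simp add: node_coeff_def)
qed

lemma node_partial_fractions:
  assumes "finite Y" "z \<notin> Y"
  shows "(\<Prod>x\<in>Y. (z + x) / (z - x)) = 1 + (\<Sum>x\<in>Y. 2 * x * node_coeff Y x / (z - x))"
  using partial_fractions_prod[OF assms(1), of "\<lambda>x. x" z uminus] assms(2)
  by (simp add: node_coeff_def)

text \<open>Adjoining a node turns the sum \<open>S\<close> into \<open>1 - S\<close>, by partial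
  fractions at the new node. Unlike setting \<open>z = 0\<close> in the partial fractions, this
  works in every characteristic and when 0 is a node.\<close>

lemma sum_node_coeff:
  "finite Y \<Longrightarrow> (\<Sum>x\<in>Y. node_coeff Y x) = (if odd (card Y) then 1 else 0)"
proof (induction Y rule: finite_induct)
  case (insert y Y)
  have "(\<Sum>x\<in>insert y Y. node_coeff (insert y Y) x)
      = 1 + (\<Sum>x\<in>Y. 2 * x * node_coeff Y x / (y - x)) + (\<Sum>x\<in>Y. node_coeff Y x * ((x + y) / (x - y)))"
    using insert by (simp add: node_coeff_insert node_partial_fractions)
  also have "\<dots> = 1 + (\<Sum>x\<in>Y. - node_coeff Y x)"
  proof -
    have "2 * x * node_coeff Y x / (y - x) + node_coeff Y x * ((x + y) / (x - y)) = - node_coeff Y x"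
      if "x \<in> Y" for x
    proof -
      have "y - x \<noteq> 0" "x - y \<noteq> 0" using that insert by auto
      then show ?thesis by (simp add: divide_simps) (simp add: algebra_simps)
    qed
    then show ?thesis by (simp add: add.assoc flip: sum.distrib)
  qed
  finally show ?case using insert by (simp add: sum_negf)
qed simp

text \<open>
  Let \<open>F(z) = \<Prod>\<^sub>y (z + y) / (z - y) = \<Sum>\<^sub>r q\<^sub>r z\<^sup>-\<^sup>r\<close>.  The weights are the residues of \<open>F(z) / z\<close>; the node
  \<open>0\<close> is always included, since the pole at \<open>0\<close> contributes to \<open>q\<^sub>0\<close>.  Accordingly \<open>Q\<^sub>r\<^sub>,\<^sub>s\<close> is a double
  residue of \<open>F(z) F(w) (w - z) / (w + z)\<close>.
\<close>

definition node_weight :: "complex set \<Rightarrow> complex \<Rightarrow> complex"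
  where "node_weight X x = (if x = 0 then 1 else 2) * node_coeff X x"

text \<open>At \<open>(0, 0)\<close> the value is \<open>0 / 0 = 0\<close>. Whenever the kernel is
  summed over all nodes, the row \<open>x = 0\<close> has to be removed by another factor.\<close>

definition kernel :: "complex \<Rightarrow> complex \<Rightarrow> complex"
  where "kernel x y = (y - x) / (x + y)"

text \<open>This is the value of \<open>q_0\<close>. The coefficient of the node 0 is a sign given
  by the parity of the number of nodes; as this node has weight factor 1 instead of 2, the sign
  balances the parity in \<open>sum_node_coeff\<close>.\<close>

lemma sum_node_weight:
  assumes "finite X" "0 \<in> X"
  shows "(\<Sum>x\<in>X. node_weight X x) = 1"
proof -
  have "node_coeff X 0 = (\<Prod>y\<in>X - {0}. - 1)"
    unfolding node_coeff_def by (intro prod.cong) (auto simp: divide_simps)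
  also have "\<dots> = (- 1) ^ (card X - 1)" using assms by simp
  finally have 0: "node_coeff X 0 = (- 1) ^ (card X - 1)" .
  have "(\<Sum>x\<in>X. node_weight X x) = node_weight X 0 + (\<Sum>x\<in>X - {0}. node_weight X x)"
    using assms by (rule sum.remove)
  also have "\<dots> = node_coeff X 0 + 2 * (\<Sum>x\<in>X - {0}. node_coeff X x)"
    by (simp add: node_weight_def sum_distrib_left)
  also have "\<dots> = 2 * (\<Sum>x\<in>X. node_coeff X x) - node_coeff X 0"
    using assms by (simp add: sum.remove[of X 0])
  also have "\<dots> = 1"
    using assms card_gt_0_iff[of X] by (auto simp: sum_node_coeff 0)
  finally show ?thesis .
qed

text \<open>Partial fractions at \<open>z = -a\<close>, where the product is 0 because of its factor
  at \<open>a\<close>, combined with \<open>kernel a b = 2 b / (a + b) - 1\<close>. It is the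
  relation \<open>Q_{r,0} = q_r\<close> on the level of nodes.\<close>

lemma sum_node_weight_kernel:
  assumes "finite X" "0 \<in> X" "a \<in> X" "a \<noteq> 0" "- a \<notin> X"
  shows "(\<Sum>b\<in>X. node_weight X b * kernel a b) = 1"
proof -
  have ne: "a + b \<noteq> 0" if "b \<in> X" for b
    using that assms(5) by (metis add_eq_0_iff)
  have "0 = (\<Prod>x\<in>X. (- a + x) / (- a - x))"
    using assms by (intro prod_zero[symmetric]) (auto intro!: bexI[of _ a])
  also have "\<dots> = 1 + (\<Sum>x\<in>X. 2 * x * node_coeff X x / (- a - x))"
    by (rule node_partial_fractions) (use assms in auto)
  also have "(\<Sum>x\<in>X. 2 * x * node_coeff X x / (- a - x)) = - (\<Sum>x\<in>X. node_weight X x * (x / (a + x)))"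
    unfolding sum_negf[symmetric]
  proof (rule sum.cong[OF refl])
    fix x assume "x \<in> X"
    then have "a + x \<noteq> 0" "- a - x \<noteq> 0" using ne[of x] by (auto simp: eq_neg_iff_add_eq_0 add.commute)
    then show "2 * x * node_coeff X x / (- a - x) = - (node_weight X x * (x / (a + x)))"
      by (auto simp: node_weight_def divide_simps) (simp add: algebra_simps)
  qed
  finally have 1: "(\<Sum>x\<in>X. node_weight X x * (x / (a + x))) = 1" by simp
  have "(\<Sum>b\<in>X. node_weight X b * kernel a b)
    = (\<Sum>b\<in>X. 2 * (node_weight X b * (b / (a + b))) - node_weight X b)"
  proof (rule sum.cong[OF refl])
    fix b assume "b \<in> X"
    then show "node_weight X b * kernel a b = 2 * (node_weight X b * (b / (a + b))) - node_weight X b"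
      using ne[of b] by (simp add: kernel_def divide_simps) (simp add: algebra_simps)
  qed
  also have "\<dots> = 1"
    unfolding sum_subtractf sum_distrib_left[symmetric] 1 sum_node_weight[OF assms(1,2)] by simp
  finally show ?thesis .
qed

text \<open>A new node multiplies the old weights by \<open>(x + y) / (x - y)\<close>. Testing
  against multiples of \<open>x - y\<close> clears this denominator and removes the weight of
  \<open>y\<close> itself.\<close>

lemma sum_node_weight_insert:
  assumes "finite X" "0 \<in> X" "y \<notin> X"
  shows "(\<Sum>x\<in>insert y X. node_weight (insert y X) x * ((x - y) * g x)) = (\<Sum>x\<in>X. node_weight X x * ((x + y) * g x))"
proof -
  have "(\<Sum>x\<in>insert y X. node_weight (insert y X) x * ((x - y) * g x))
    = (\<Sum>x\<in>X. node_weight (insert y X) x * ((x - y) * g x))"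
    using assms by simp
  also have "\<dots> = (\<Sum>x\<in>X. node_weight X x * ((x + y) * g x))"
  proof (rule sum.cong[OF refl])
    fix x assume x: "x \<in> X"
    then have "x - y \<noteq> 0" using assms by auto
    then show "node_weight (insert y X) x * ((x - y) * g x) = node_weight X x * ((x + y) * g x)"
      using x assms by (simp add: node_weight_def node_coeff_insert)
  qed
  finally show ?thesis .
qed

definition node_sum :: "complex set \<Rightarrow> nat \<Rightarrow> complex"
  where "node_sum X r = (\<Sum>x\<in>X. node_weight X x * x ^ r)"

lemma node_sum_insert:
  assumes "finite X" "0 \<in> X" "y \<notin> X"
  shows "node_sum (insert y X) (Suc r) - y * node_sum (insert y X) r = node_sum X (Suc r) + y * node_sum X r"
proof -
  have "node_sum Z (Suc r) - c * node_sum Z r = (\<Sum>x\<in>Z. node_weight Z x * ((x - c) * x ^ r))" for Z c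
    unfolding node_sum_def sum_distrib_left sum_subtractf[symmetric]
    by (intro sum.cong refl) (simp add: algebra_simps)
  from this[of "insert y X" y] this[of X "- y"] sum_node_weight_insert[OF assms, of "\<lambda>x. x ^ r"]
  show ?thesis by simp
qed

text \<open>Adjoining \<open>y\<close> multiplies the generating series by
  \<open>(1 + y z) / (1 - y z)\<close>, so its logarithmic derivative gains twice the odd power sums
  of \<open>y\<close>. Denominators are cleared throughout, and nonzero series are cancelled at the
  end.\<close>

lemma node_sum_newton:
  assumes "finite X" "0 \<in> X"
  shows "of_nat (Suc n) * node_sum X (Suc n)
    = 2 * (\<Sum>i\<le>n. (if even i then (\<Sum>x\<in>X. x ^ Suc i) else 0) * node_sum X (n - i))"
proof -
  define D where "D X = Abs_fps (\<lambda>i. if even i then (\<Sum>x\<in>X. x ^ Suc i) else 0)" for X :: "complex set"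
  define H where "H X = Abs_fps (node_sum X)" for X
  have "fps_deriv (H (insert 0 Y)) = fps_const 2 * D (insert 0 Y) * H (insert 0 Y)" if "finite Y" "0 \<notin> Y" for Y
    using that
  proof (induction Y rule: finite_induct)
    case empty
    have "H {0} = 1"
      by (rule fps_ext) (simp add: H_def node_sum_def node_weight_def node_coeff_def power_0_left)
    moreover have "D {0} = 0" by (rule fps_ext) (simp add: D_def)
    ultimately show ?case by simp
  next
    case (insert y Y)
    let ?X = "insert 0 Y" and ?N = "H (insert 0 (insert y Y))"
    let ?a = "1 - fps_const y * fps_X" and ?b = "1 + fps_const y * fps_X"
    let ?d = "D {y}"
    have X: "finite ?X" "0 \<in> ?X" "y \<notin> ?X" using insert by auto
    have N: "?a * ?N = ?b * H ?X"
    proof (rule fps_ext)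
      fix n
      show "fps_nth (?a * ?N) n = fps_nth (?b * H ?X) n"
        using node_sum_insert[OF X, of "n - 1"] sum_node_weight[of "insert y ?X"] sum_node_weight[of ?X] X
        by (cases n)
           (simp_all add: H_def algebra_simps insert_commute[of 0 y] node_sum_def[of _ 0] fps_X_mult_nth
             mult.assoc[of "fps_const y"] del: sum.insert)
    qed
    have IH: "fps_deriv (H ?X) = fps_const 2 * D ?X * H ?X" using insert by simp
    have D: "D (insert 0 (insert y Y)) = D ?X + ?d"
      using insert by (intro fps_ext) (simp add: D_def)
    \<comment> \<open>The odd power sums of a single node form the series
      \<open>y / (1 - y^2 z^2)\<close>.\<close>
    have d: "?a * ?b * ?d = fps_const y"
    proof (rule fps_ext)
      fix n
      have "?a * ?b * ?d = ?d - fps_const y * (fps_X * (fps_const y * (fps_X * ?d)))"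
        by (simp add: algebra_simps)
      moreover have "fps_nth (?d - fps_const y * (fps_X * (fps_const y * (fps_X * ?d)))) n = fps_nth (fps_const y) n"
      proof (cases n)
        case (Suc k)
        then show ?thesis by (cases k) (simp_all add: D_def)
      qed (simp add: D_def)
      ultimately show "fps_nth (?a * ?b * ?d) n = fps_nth (fps_const y) n" by simp
    qed
    have "?a * fps_deriv ?N - fps_const y * ?N = ?b * fps_deriv (H ?X) + fps_const y * H ?X"
      using arg_cong[OF N, of fps_deriv] by (simp add: algebra_simps)
    then have "?a * fps_deriv ?N = fps_const y * ?N + fps_const y * H ?X + fps_const 2 * D ?X * (?b * H ?X)"
      by (simp add: IH algebra_simps)
    then have "?a * fps_deriv ?N = fps_const y * ?N + fps_const y * H ?X + fps_const 2 * D ?X * (?a * ?N)"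
      by (simp only: N)
    then have "?b * (?a * fps_deriv ?N)
        = ?b * (fps_const y * ?N + fps_const y * H ?X + fps_const 2 * D ?X * (?a * ?N))"
      by (rule arg_cong)
    also have "\<dots> = fps_const y * (?b * ?N) + fps_const y * (?b * H ?X) + fps_const 2 * D ?X * (?b * ?a * ?N)"
      by (simp only: algebra_simps)
    also have "\<dots> = fps_const y * (?b * ?N) + fps_const y * (?a * ?N) + fps_const 2 * D ?X * (?b * ?a * ?N)"
      by (simp only: N)
    also have "\<dots> = fps_const 2 * fps_const y * ?N + fps_const 2 * D ?X * (?b * ?a * ?N)"
      by (simp add: algebra_simps numeral_fps_const)
    also have "\<dots> = fps_const 2 * (?a * ?b * ?d) * ?N + fps_const 2 * D ?X * (?b * ?a * ?N)"
      by (simp only: d)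
    also have "\<dots> = ?b * (?a * (fps_const 2 * (D ?X + ?d) * ?N))"
      by (simp only: algebra_simps)
    finally have "?b * (?a * fps_deriv ?N) = ?b * (?a * (fps_const 2 * (D ?X + ?d) * ?N))" .
    moreover have "fps_nth ?a 0 \<noteq> 0" "fps_nth ?b 0 \<noteq> 0" by simp_all
    then have "?a \<noteq> 0" "?b \<noteq> 0" by (metis fps_zero_nth)+
    ultimately show ?case by (simp add: D)
  qed
  from this[of "X - {0}"] assms have "fps_deriv (H X) = fps_const 2 * D X * H X"
    by (simp add: insert_absorb)
  then have "fps_nth (fps_deriv (H X)) n = fps_nth (fps_const 2 * (D X * H X)) n" by (simp only: mult.assoc)
  then show ?thesis
    by (simp only: H_def D_def fps_deriv_nth fps_mult_left_const_nth fps_mult_nth[of "Abs_fps _"]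
        fps_nth_Abs_fps atLeast0AtMost Suc_eq_plus1)
qed

definition nodes :: "nat list \<Rightarrow> complex set"
  where "nodes \<nu> = of_nat ` insert 0 (set \<nu>)"

lemma nodes_finite [simp]: "finite (nodes \<nu>)"
  and zero_in_nodes [simp]: "0 \<in> nodes \<nu>"
  by (auto simp: nodes_def)

lemma nodes_add_eq_0:
  assumes "x \<in> nodes \<nu>" "y \<in> nodes \<nu>" "x + y = 0"
  shows "x = 0 \<and> y = 0"
proof -
  obtain a b where "x = of_nat a" "y = of_nat b" using assms by (auto simp: nodes_def)
  then show ?thesis using assms(3) by (metis add_is_0 of_nat_0 of_nat_add of_nat_eq_0_iff)
qed

lemma value_at_odd_power_sums:
  assumes "strict_partition \<nu>"
  shows "value_at \<nu> (odd_power_sums i) = (if even i then (\<Sum>x\<in>nodes \<nu>. x ^ Suc i) else 0)"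
proof -
  have 0: "0 \<notin> (of_nat ` set \<nu> :: complex set)"
    using assms by (auto simp: strict_partition_def)
  have "(\<Sum>x\<in>nodes \<nu>. x ^ Suc i) = (\<Sum>x\<in>of_nat ` set \<nu>. x ^ Suc i)"
    using 0 by (simp add: nodes_def)
  also have "\<dots> = (\<Sum>x\<in>set \<nu>. of_nat x ^ Suc i)"
    by (subst sum.reindex) (auto simp: inj_on_def)
  also have "\<dots> = (\<Sum>j<length \<nu>. of_nat (\<nu> ! j) ^ Suc i)"
    by (rule sum.reindex_bij_betw[symmetric, OF bij_betw_nth])
       (auto simp: strict_partition_distinct assms)
  finally show ?thesis by (simp add: odd_power_sums_def value_at_power_sum)
qed

text \<open>Newton's recursion holds on both sides and determines them from index 0.\<close>

lemma value_at_schur_q: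
  assumes "strict_partition \<nu>"
  shows "value_at \<nu> (schur_q n) = node_sum (nodes \<nu>) n"
proof (induction n rule: less_induct)
  case (less n)
  show ?case
  proof (cases n)
    case 0
    then show ?thesis by (simp add: node_sum_def sum_node_weight)
  next
    case (Suc k)
    have "of_nat (Suc k) * value_at \<nu> (schur_q (Suc k)) = value_at \<nu> (of_nat (Suc k) * schur_q (Suc k))"
      unfolding of_nat_pser[of "Suc k"] by (simp add: scale_mult_left value_at_scale schur_q_Gamma)
    also have "\<dots> = 2 * (\<Sum>i\<le>k. value_at \<nu> (odd_power_sums i) * value_at \<nu> (schur_q (k - i)))"
      unfolding schur_q_newton
      by (simp add: value_at_mult value_at_sum value_at_numeral Gamma_numeral Gamma_sum Gamma.mult
          odd_power_sums_Gamma schur_q_Gamma)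
    also have "\<dots> = 2 * (\<Sum>i\<le>k. (if even i then (\<Sum>x\<in>nodes \<nu>. x ^ Suc i) else 0) * node_sum (nodes \<nu>) (k - i))"
      using less Suc by (auto simp: value_at_odd_power_sums[OF assms] intro!: sum.cong)
    also have "\<dots> = of_nat (Suc k) * node_sum (nodes \<nu>) (Suc k)"
      by (rule node_sum_newton[symmetric]) auto
    finally show ?thesis using Suc by (simp del: of_nat_Suc)
  qed
qed

text \<open>Induction along \<open>schur_Q2_Suc\<close>, whose counterpart for the double sum is
  \<open>(x + y) * kernel x y = y - x\<close>, valid at \<open>(0, 0)\<close> too. In the base case
  the row \<open>x = 0\<close> is removed by \<open>x ^ r\<close>, as \<open>r > 0\<close>.\<close>

lemma value_at_schur_Q2:
  assumes "strict_partition \<nu>" "r > 0"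
  shows "value_at \<nu> (schur_Q2 r s) = (\<Sum>x\<in>nodes \<nu>. \<Sum>y\<in>nodes \<nu>.
    node_weight (nodes \<nu>) x * node_weight (nodes \<nu>) y * x ^ r * y ^ s * kernel x y)"
  using assms(2)
proof (induction s arbitrary: r)
  case 0
  let ?X = "nodes \<nu>"
  have "(\<Sum>x\<in>?X. \<Sum>y\<in>?X. node_weight ?X x * node_weight ?X y * x ^ r * y ^ 0 * kernel x y)
    = (\<Sum>x\<in>?X. node_weight ?X x * x ^ r * (\<Sum>y\<in>?X. node_weight ?X y * kernel x y))"
    by (simp add: sum_distrib_left mult_ac)
  also have "\<dots> = (\<Sum>x\<in>?X. node_weight ?X x * x ^ r)"
  proof (rule sum.cong[OF refl])
    fix x assume x: "x \<in> ?X"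
    show "node_weight ?X x * x ^ r * (\<Sum>y\<in>?X. node_weight ?X y * kernel x y) = node_weight ?X x * x ^ r"
    proof (cases "x = 0")
      case False
      then have "- x \<notin> ?X" using nodes_add_eq_0[OF x, of "- x"] by auto
      then show ?thesis using x False by (simp add: sum_node_weight_kernel)
    qed (use 0 in simp)
  qed
  finally show ?case by (simp add: schur_Q2_0 value_at_schur_q[OF assms(1)] node_sum_def)
next
  case (Suc s)
  let ?X = "nodes \<nu>" and ?u = "node_weight (nodes \<nu>)"
  have k: "?u x * ?u y * x ^ r * y ^ Suc s * kernel x y
    = ?u x * x ^ r * (?u y * y ^ Suc s) - ?u x * x ^ Suc r * (?u y * y ^ s)
      - ?u x * ?u y * x ^ Suc r * y ^ s * kernel x y" if "x \<in> ?X" "y \<in> ?X" for x y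
  proof -
    have "(x + y) * kernel x y = y - x"
      using nodes_add_eq_0[OF that] by (auto simp: kernel_def)
    then have "?u x * ?u y * x ^ r * y ^ s * ((x + y) * kernel x y) = ?u x * ?u y * x ^ r * y ^ s * (y - x)"
      by simp
    then show ?thesis by (simp add: algebra_simps)
  qed
  have "value_at \<nu> (schur_Q2 r (Suc s)) = node_sum ?X r * node_sum ?X (Suc s)
      - node_sum ?X (Suc r) * node_sum ?X s - value_at \<nu> (schur_Q2 (Suc r) s)"
    unfolding schur_Q2_Suc
    by (simp add: value_at_diff value_at_mult Gamma.mult Gamma_diff schur_q_Gamma schur_Q2_Gamma
        value_at_schur_q[OF assms(1)])
  also have "\<dots> = (\<Sum>x\<in>?X. \<Sum>y\<in>?X. ?u x * x ^ r * (?u y * y ^ Suc s) - ?u x * x ^ Suc r * (?u y * y ^ s)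
      - ?u x * ?u y * x ^ Suc r * y ^ s * kernel x y)"
    using Suc by (simp only: Suc.IH[of "Suc r"] node_sum_def sum_product sum_subtractf zero_less_Suc)
  finally show ?case using k by simp
qed

section \<open>The factorial analogues of \<open>Q\<^sub>r\<^sub>,\<^sub>s\<close>\<close>

definition falling_poly :: "nat \<Rightarrow> complex poly"
  where "falling_poly r = (\<Prod>i<r. [:- of_nat i, 1:])"

lemma poly_falling_poly: "poly (falling_poly r) x = (\<Prod>i<r. x - of_nat i)"
  by (simp add: falling_poly_def poly_prod algebra_simps)

lemma poly_falling_poly_Suc: "poly (falling_poly (Suc r)) x = poly (falling_poly r) x * (x - of_nat r)"
  by (simp add: poly_falling_poly)

lemma poly_falling_poly_eq_0_iff: "poly (falling_poly r) (of_nat n) = 0 \<longleftrightarrow> n < r"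
  by (auto simp: poly_falling_poly)

lemma degree_falling_poly: "degree (falling_poly r) = r"
  unfolding falling_poly_def by (subst degree_prod_eq_sum_degree) auto

lemma lead_coeff_falling_poly: "Polynomial.coeff (falling_poly r) r = 1"
proof -
  have "lead_coeff (falling_poly r) = 1"
    unfolding falling_poly_def by (simp add: lead_coeff_prod)
  then show ?thesis by (simp add: degree_falling_poly)
qed

lemma coeff_0_falling_poly: "r > 0 \<Longrightarrow> Polynomial.coeff (falling_poly r) 0 = 0"
  using poly_falling_poly_eq_0_iff[of r 0] by (simp add: poly_0_coeff_0)

text \<open>Expanding the falling factorials into powers keeps the function in
  \<open>\<Gamma>\<close>; in its values they reappear whole, see
  \<open>value_at_factorial_Q2\<close>.\<close>

definition factorial_Q2 :: "nat \<Rightarrow> nat \<Rightarrow> pser"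
  where "factorial_Q2 r s = (\<Sum>k\<le>r. \<Sum>l\<le>s.
    scale (Polynomial.coeff (falling_poly r) k * Polynomial.coeff (falling_poly s) l) (schur_Q2 k l))"

lemma factorial_Q2_Gamma: "factorial_Q2 r s \<in> Gamma"
  unfolding factorial_Q2_def by (intro Gamma_sum Gamma.scale schur_Q2_Gamma)

lemma degree_le_factorial_Q2: "degree_le (factorial_Q2 r s) (r + s)"
proof -
  have "degree_le (schur_Q2 k l) (r + s)" if "k \<le> r" "l \<le> s" for k l
    using that by (auto simp: degree_le_def dest: coeff_schur_Q2_nonzero)
  then show ?thesis
    unfolding factorial_Q2_def by (intro degree_le_sum degree_le_scale) auto
qed

text \<open>Falling factorials are monic, so the pair \<open>(r, s)\<close> enters with coefficient
  1, and no other pair reaches the top degree.\<close>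

lemma hom_component_factorial_Q2: "hom_component (r + s) (factorial_Q2 r s) = schur_Q2 r s"
proof -
  let ?c = "\<lambda>r. Polynomial.coeff (falling_poly r)"
  have h: "hom_component (r + s) (schur_Q2 k l) = (if k + l = r + s then schur_Q2 k l else 0)" for k l
    using hom_component_homogeneous[of "schur_Q2 k l" "k + l" "r + s"] coeff_schur_Q2_nonzero by auto
  have "hom_component (r + s) (factorial_Q2 r s)
    = (\<Sum>k\<le>r. \<Sum>l\<le>s. if k = r then if l = s then scale (?c r k * ?c s l) (schur_Q2 k l) else 0 else 0)"
    unfolding factorial_Q2_def hom_component_sum hom_component_scale h by (intro sum.cong refl) auto
  also have "\<dots> = (\<Sum>k\<le>r. if k = r then \<Sum>l\<le>s. if l = s then scale (?c r k * ?c s l) (schur_Q2 k l) else 0 else 0)"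
    by (intro sum.cong refl) auto
  also have "\<dots> = schur_Q2 r s"
    by (simp add: lead_coeff_falling_poly)
  finally show ?thesis .
qed

definition node_falling :: "complex set \<Rightarrow> nat \<Rightarrow> complex \<Rightarrow> complex"
  where "node_falling X r x = node_weight X x * poly (falling_poly r) x"

lemma value_at_factorial_Q2:
  assumes "strict_partition \<nu>" "r > 0"
  shows "value_at \<nu> (factorial_Q2 r s) = (\<Sum>x\<in>nodes \<nu>. \<Sum>y\<in>nodes \<nu>.
    node_falling (nodes \<nu>) r x * node_falling (nodes \<nu>) s y * kernel x y)"
proof -
  let ?c = "\<lambda>r. Polynomial.coeff (falling_poly r)"
  let ?X = "nodes \<nu>" and ?u = "node_weight (nodes \<nu>)"
  have "value_at \<nu> (factorial_Q2 r s) = (\<Sum>k\<le>r. \<Sum>l\<le>s. ?c r k * ?c s l * value_at \<nu> (schur_Q2 k l))"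
    unfolding factorial_Q2_def
    by (simp add: value_at_sum value_at_scale Gamma_sum Gamma.scale schur_Q2_Gamma)
  also have "\<dots> = (\<Sum>k\<le>r. \<Sum>l\<le>s. \<Sum>x\<in>?X. \<Sum>y\<in>?X. (?u x * ?u y * kernel x y) * ((?c r k * x ^ k) * (?c s l * y ^ l)))"
  proof (intro sum.cong refl)
    \<comment> \<open>\<open>value_at_schur_Q2\<close> is available only for \<open>k > 0\<close>.
      For \<open>k = 0\<close> the coefficient is 0, because a falling factorial of positive order
      has no constant term.\<close>
    fix k l
    show "?c r k * ?c s l * value_at \<nu> (schur_Q2 k l)
      = (\<Sum>x\<in>?X. \<Sum>y\<in>?X. (?u x * ?u y * kernel x y) * ((?c r k * x ^ k) * (?c s l * y ^ l)))"
    proof (cases "k = 0")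
      case False
      then show ?thesis by (simp add: value_at_schur_Q2[OF assms(1)] sum_distrib_left mult_ac)
    qed (simp add: coeff_0_falling_poly assms)
  qed
  also have "\<dots> = (\<Sum>k\<le>r. \<Sum>x\<in>?X. \<Sum>y\<in>?X. \<Sum>l\<le>s. (?u x * ?u y * kernel x y) * ((?c r k * x ^ k) * (?c s l * y ^ l)))"
    by (simp only: sum.swap[of _ ?X "{..s}"])
  also have "\<dots> = (\<Sum>x\<in>?X. \<Sum>y\<in>?X. \<Sum>k\<le>r. \<Sum>l\<le>s. (?u x * ?u y * kernel x y) * ((?c r k * x ^ k) * (?c s l * y ^ l)))"
    by (simp only: sum.swap[of _ ?X "{..r}"])
  also have "\<dots> = (\<Sum>x\<in>?X. \<Sum>y\<in>?X. (?u x * ?u y * kernel x y) * (poly (falling_poly r) x * poly (falling_poly s) y))"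
    by (simp only: poly_altdef degree_falling_poly sum_product) (simp only: sum_distrib_left)
  finally show ?thesis by (simp add: node_falling_def mult_ac)
qed

section \<open>Pfaffians\<close>

abbreviation delete_nth :: "nat \<Rightarrow> 'i list \<Rightarrow> 'i list"
  where "delete_nth j ks \<equiv> take j ks @ drop (Suc j) ks"

lemma sorted_wrt_delete_nth: "sorted_wrt P ks \<Longrightarrow> j < length ks \<Longrightarrow> sorted_wrt P (delete_nth j ks)"
  by (subst (asm) id_take_nth_drop[of j ks]) (auto simp: sorted_wrt_append)

text \<open>Agreement in list order suffices, since the expansion reads only entries above the
  diagonal. This lets formulas be used that are valid only for a positive first index.\<close>

lemma pfaffian_cong:
  "sorted_wrt (\<lambda>a b. A a b = B a b) ks \<Longrightarrow> pfaffian A ks = pfaffian B ks"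
proof (induction A ks rule: pfaffian.induct)
  case (2 A k ks)
  have "pfaffian A (delete_nth j ks) = pfaffian B (delete_nth j ks)" if "j < length ks" for j
    using 2 that sorted_wrt_delete_nth[of _ ks j] by simp
  then show ?case using 2(2) by (auto intro!: sum.cong)
qed simp

lemma pfaffian_map: "pfaffian A (map f ks) = pfaffian (\<lambda>a b. A (f a) (f b)) ks"
proof (induction "\<lambda>a b. A (f a) (f b)" ks rule: pfaffian.induct)
  case (2 k ks)
  then show ?case
    by (auto simp: take_map drop_map simp flip: map_append intro!: sum.cong)
qed simp

lemma prod_list_delete_nth:
  "j < length ks \<Longrightarrow> prod_list (map c ks) = c (ks ! j) * prod_list (map c (delete_nth j ks))"
  for c :: "'i \<Rightarrow> 'a :: comm_monoid_mult"
  by (subst id_take_nth_drop[of j ks]) (auto simp: mult_ac)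

lemma pfaffian_scale:
  "pfaffian (\<lambda>a b. c a * c b * A a b) ks = prod_list (map c ks) * pfaffian A ks"
proof (induction A ks rule: pfaffian.induct)
  case (2 A k ks)
  have "(- 1) ^ j * (c k * c (ks ! j) * A k (ks ! j)) * pfaffian (\<lambda>a b. c a * c b * A a b) (delete_nth j ks)
      = c k * prod_list (map c ks) * ((- 1) ^ j * A k (ks ! j) * pfaffian A (delete_nth j ks))"
    if "j < length ks" for j
    using 2[of j] that by (simp only: prod_list_delete_nth[OF that, of c]) (simp add: mult_ac)
  then show ?case by (simp add: sum_distrib_left)
qed simp

lemma pfaffian_Gamma: "(\<And>a b. A a b \<in> Gamma) \<Longrightarrow> pfaffian A ks \<in> Gamma"
proof (induction A ks rule: pfaffian.induct)
  case (2 A k ks)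
  then show ?case
    by (auto intro!: Gamma_sum Gamma.mult Gamma_minus_one_power)
qed (simp add: Gamma.one)

lemma value_at_pfaffian:
  "(\<And>a b. A a b \<in> Gamma) \<Longrightarrow> value_at \<nu> (pfaffian A ks) = pfaffian (\<lambda>a b. value_at \<nu> (A a b)) ks"
proof (induction A ks rule: pfaffian.induct)
  case (2 A k ks)
  then show ?case
    by (simp add: value_at_sum value_at_mult Gamma.mult Gamma_minus_one_power pfaffian_Gamma
        value_at_minus_one_power)
qed simp

lemma sum_list_delete_nth: "j < length ks \<Longrightarrow> sum_list ks = ks ! j + sum_list (delete_nth j ks)"
  for ks :: "nat list"
  by (subst id_take_nth_drop[of j ks]) auto

text \<open>Each term of a Pfaffian uses every index once, so the bounds \<open>r + s\<close> add up
  to the sum of all indices, and top components multiply.\<close>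

lemma pfaffian_top_component:
  assumes "\<And>r s. degree_le (A r s) (r + s)" "\<And>r s. hom_component (r + s) (A r s) = B r s"
  shows "degree_le (pfaffian A ks) (sum_list ks) \<and>
    hom_component (sum_list ks) (pfaffian A ks) = pfaffian B ks"
  using assms
proof (induction A ks rule: pfaffian.induct)
  case (1 A)
  have "hom_component 0 1 = (if 0 = (0 :: nat) then 1 else 0)"
    by (rule hom_component_homogeneous) (auto simp: one_pser.rep_eq split: if_splits)
  then show ?case by (simp add: degree_le_one)
next
  case (2 A k ks)
  have sign: "(- 1) ^ j * f = scale ((- 1) ^ j) f" for j and f :: pser
    by (cases "even j") auto
  let ?t = "\<lambda>j. A k (ks ! j) * pfaffian A (delete_nth j ks)"
  have t: "degree_le (?t j) (sum_list (k # ks)) \<and>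
      hom_component (sum_list (k # ks)) (?t j) = B k (ks ! j) * pfaffian B (delete_nth j ks)"
    if j: "j < length ks" for j
  proof -
    have s: "sum_list (k # ks) = (k + ks ! j) + sum_list (delete_nth j ks)"
      using sum_list_delete_nth[OF j] by simp
    have IH: "degree_le (pfaffian A (delete_nth j ks)) (sum_list (delete_nth j ks))"
      "hom_component (sum_list (delete_nth j ks)) (pfaffian A (delete_nth j ks)) = pfaffian B (delete_nth j ks)"
      using 2 j by auto
    show ?thesis
      unfolding s hom_component_mult_top[OF 2(2) IH(1)] IH(2) 2(3)
      using degree_le_mult[OF 2(2) IH(1)] by simp
  qed
  have "pfaffian A (k # ks) = (\<Sum>j<length ks. scale ((- 1) ^ j) (?t j))"
    by (simp add: mult.assoc sign scale_mult_left)
  moreover have "degree_le (\<Sum>j<length ks. scale ((- 1) ^ j) (?t j)) (sum_list (k # ks))"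
    using t by (intro degree_le_sum degree_le_scale) auto
  moreover have "hom_component (sum_list (k # ks)) (\<Sum>j<length ks. scale ((- 1) ^ j) (?t j)) = pfaffian B (k # ks)"
    unfolding hom_component_sum hom_component_scale using t
    by (auto simp: mult.assoc sign scale_mult_left intro!: sum.cong)
  ultimately show ?case by simp
qed

section \<open>Expansion of Pfaffians over words\<close>

definition words :: "'x set \<Rightarrow> nat \<Rightarrow> 'x list set"
  where "words X n = {xs. set xs \<subseteq> X \<and> length xs = n}"

lemma finite_words: "finite X \<Longrightarrow> finite (words X n)"
  unfolding words_def by (rule finite_lists_length_eq)

lemma sum_words_Suc:
  assumes "finite X"
  shows "(\<Sum>xs\<in>words X (Suc n). g xs) = (\<Sum>x\<in>X. \<Sum>ys\<in>words X n. g (x # ys))"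
proof -
  have "(\<Sum>x\<in>X. \<Sum>ys\<in>words X n. g (x # ys)) = (\<Sum>(x, ys)\<in>X \<times> words X n. g (x # ys))"
    by (rule sum.cartesian_product)
  also have "\<dots> = (\<Sum>xs\<in>words X (Suc n). g xs)"
    by (rule sum.reindex_bij_witness[of _ "\<lambda>xs. (hd xs, tl xs)" "\<lambda>(x, ys). x # ys"])
       (auto simp: words_def length_Suc_conv)
  finally show ?thesis by simp
qed

text \<open>Taking out letter \<open>j\<close> is a bijection onto pairs of a letter and a shorter
  word. In the Pfaffian expansion this is the letter of the index paired with the first one.\<close>

lemma sum_words_insert_nth:
  assumes "finite X" "j \<le> n"
  shows "(\<Sum>xs\<in>words X (Suc n). g (xs ! j) (delete_nth j xs)) = (\<Sum>y\<in>X. \<Sum>zs\<in>words X n. g y zs)"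
proof -
  have "(\<Sum>y\<in>X. \<Sum>zs\<in>words X n. g y zs) = (\<Sum>(y, zs)\<in>X \<times> words X n. g y zs)"
    by (rule sum.cartesian_product)
  also have "\<dots> = (\<Sum>xs\<in>words X (Suc n). g (xs ! j) (delete_nth j xs))"
  proof (rule sum.reindex_bij_witness[of _ "\<lambda>xs. (xs ! j, delete_nth j xs)"
        "\<lambda>(y, zs). take j zs @ y # drop j zs"])
    fix xs assume "xs \<in> words X (Suc n)"
    then have xs: "length xs = Suc n" "set xs \<subseteq> X" by (auto simp: words_def)
    then show "(case (xs ! j, delete_nth j xs) of (y, zs) \<Rightarrow> take j zs @ y # drop j zs) = xs"
      using assms(2) id_take_nth_drop[of j xs] by simp
    show "(xs ! j, delete_nth j xs) \<in> X \<times> words X n"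
      using xs assms(2) set_take_subset[of j xs] set_drop_subset[of "Suc j" xs] nth_mem[of j xs]
      by (auto simp: words_def)
  next
    fix p assume p: "p \<in> X \<times> words X n"
    then obtain y zs where pz: "p = (y, zs)" "y \<in> X" "length zs = n" "set zs \<subseteq> X" by (auto simp: words_def)
    let ?w = "case p of (y, zs) \<Rightarrow> take j zs @ y # drop j zs"
    show "(?w ! j, delete_nth j ?w) = p"
      using pz assms(2) by (simp add: nth_append)
    show "?w \<in> words X (Suc n)"
      using pz assms(2) set_take_subset[of j zs] set_drop_subset[of j zs] by (auto simp: words_def)
    show "g (?w ! j) (delete_nth j ?w) = (case p of (y, zs) \<Rightarrow> g y zs)"
      using pz assms(2) by (simp add: nth_append)
  qed
  finally show ?thesis by simp
qed

text \<open>Multilinearity: every index \<open>a\<close> of the list independently chooses a letter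
  \<open>x\<close> with weight \<open>v a x\<close>. Words with repeated letters stay in the sum;
  they vanish only for special kernels.\<close>

lemma pfaffian_expand:
  fixes A :: "'i \<Rightarrow> 'i \<Rightarrow> 'a :: comm_ring_1"
  assumes "finite X"
    and "\<And>a b. A a b = (\<Sum>x\<in>X. \<Sum>y\<in>X. v a x * v b y * K x y)"
  shows "pfaffian A ks = (\<Sum>xs\<in>words X (length ks). prod_list (map2 v ks xs) * pfaffian K xs)"
  using assms(2)
proof (induction A ks rule: pfaffian.induct)
  case (1 A)
  have "words X 0 = {[]}" by (auto simp: words_def)
  then show ?case by simp
next
  case (2 A k ks)
  let ?n = "length ks"
  have "(- 1) ^ j * A k (ks ! j) * pfaffian A (delete_nth j ks)
    = (\<Sum>x\<in>X. \<Sum>xs\<in>words X ?n. v k x * prod_list (map2 v ks xs) * ((- 1) ^ j * K x (xs ! j) * pfaffian K (delete_nth j xs)))"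
    if j: "j < ?n" for j
  proof -
    obtain n where n: "?n = Suc n" using j by (cases ?n) auto
    have IH: "pfaffian A (delete_nth j ks)
      = (\<Sum>zs\<in>words X n. prod_list (map2 v (delete_nth j ks) zs) * pfaffian K zs)"
    proof -
      have "length (delete_nth j ks) = n" using j n by simp
      moreover have "pfaffian A (delete_nth j ks) = (\<Sum>zs\<in>words X (length (delete_nth j ks)).
          prod_list (map2 v (delete_nth j ks) zs) * pfaffian K zs)"
        by (rule 2(1)) (use j 2(2) in auto)
      ultimately show ?thesis by metis
    qed
    have m: "prod_list (map2 v ks xs) = v (ks ! j) (xs ! j) * prod_list (map2 v (delete_nth j ks) (delete_nth j xs))"
      if "xs \<in> words X (Suc n)" for xs
    proof -
      have "length xs = ?n" using that n by (simp add: words_def)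
      then have "zip ks xs = zip (take j ks) (take j xs) @ (ks ! j, xs ! j) # zip (drop (Suc j) ks) (drop (Suc j) xs)"
        using j id_take_nth_drop[of j "zip ks xs"] by (simp add: take_zip drop_zip)
      moreover have "zip (delete_nth j ks) (delete_nth j xs)
        = zip (take j ks) (take j xs) @ zip (drop (Suc j) ks) (drop (Suc j) xs)"
        using j \<open>length xs = ?n\<close> by (intro zip_append) auto
      ultimately show ?thesis by (simp add: mult_ac)
    qed
    have "(- 1) ^ j * A k (ks ! j) * pfaffian A (delete_nth j ks)
      = (\<Sum>x\<in>X. \<Sum>y\<in>X. \<Sum>zs\<in>words X n. v k x * (v (ks ! j) y * prod_list (map2 v (delete_nth j ks) zs))
          * ((- 1) ^ j * K x y * pfaffian K zs))"
    proof -
      have "(- 1) ^ j * A k (ks ! j) * S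
        = (\<Sum>x\<in>X. \<Sum>y\<in>X. (- 1) ^ j * (v k x * v (ks ! j) y * K x y) * S)" for S
        by (simp only: 2(2)[of k "ks ! j"] sum_distrib_left sum_distrib_right)
      then show ?thesis
        unfolding IH by (simp only:) (intro sum.cong refl, simp only: sum_distrib_left mult_ac)
    qed
    also have "\<dots> = (\<Sum>x\<in>X. \<Sum>xs\<in>words X (Suc n). v k x * (v (ks ! j) (xs ! j) * prod_list (map2 v (delete_nth j ks) (delete_nth j xs)))
          * ((- 1) ^ j * K x (xs ! j) * pfaffian K (delete_nth j xs)))"
      using j n by (intro sum.cong refl sum_words_insert_nth[symmetric] assms) auto
    also have "\<dots> = (\<Sum>x\<in>X. \<Sum>xs\<in>words X ?n. v k x * prod_list (map2 v ks xs) * ((- 1) ^ j * K x (xs ! j) * pfaffian K (delete_nth j xs)))"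
      unfolding n by (intro sum.cong refl) (simp only: m)
    finally show ?thesis .
  qed
  then have "pfaffian A (k # ks) = (\<Sum>j<?n. \<Sum>x\<in>X. \<Sum>xs\<in>words X ?n. v k x * prod_list (map2 v ks xs) * ((- 1) ^ j * K x (xs ! j) * pfaffian K (delete_nth j xs)))"
    by simp
  also have "\<dots> = (\<Sum>x\<in>X. \<Sum>xs\<in>words X ?n. \<Sum>j<?n. v k x * prod_list (map2 v ks xs) * ((- 1) ^ j * K x (xs ! j) * pfaffian K (delete_nth j xs)))"
    by (subst sum.swap) (intro sum.cong refl, rule sum.swap)
  also have "\<dots> = (\<Sum>x\<in>X. \<Sum>xs\<in>words X ?n. prod_list (map2 v (k # ks) (x # xs)) * pfaffian K (x # xs))"
    by (intro sum.cong refl) (simp add: words_def sum_distrib_left)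
  finally show ?case by (simp add: sum_words_Suc[OF assms(1)])
qed

section \<open>Schur's Pfaffian identity\<close>

fun pair_prod :: "('i \<Rightarrow> 'i \<Rightarrow> 'a :: comm_monoid_mult) \<Rightarrow> 'i list \<Rightarrow> 'a" where
  "pair_prod h [] = 1"
| "pair_prod h (a # as) = prod_list (map (h a) as) * pair_prod h as"

lemma pair_prod_append_Cons:
  "pair_prod h (as @ x # bs)
    = pair_prod h (as @ bs) * prod_list (map (\<lambda>a. h a x) as) * prod_list (map (h x) bs)"
  by (induction as) (auto simp: mult_ac)

definition schur_kernel :: "'a :: field \<Rightarrow> 'a \<Rightarrow> 'a"
  where "schur_kernel x y = (x - y) / (x + y)"

lemma schur_kernel_swap: "schur_kernel x y = - schur_kernel y x"
  by (metis add.commute minus_diff_eq minus_divide_left schur_kernel_def)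

lemma prod_list_schur_kernel_swap:
  "prod_list (map (\<lambda>a. schur_kernel a x) as) = (- 1) ^ length as * prod_list (map (schur_kernel x) as)"
proof (induction as)
  case (Cons a as)
  then show ?case using schur_kernel_swap[of a x] by simp
qed simp

lemma pair_prod_not_distinct:
  assumes "\<not> distinct xs"
  shows "pair_prod schur_kernel xs = 0"
proof -
  obtain as x bs cs where "xs = as @ [x] @ bs @ [x] @ cs"
    using not_distinct_decomp[OF assms] by metis
  then show ?thesis by (simp add: pair_prod_append_Cons[of _ as] schur_kernel_def)
qed

lemma pair_prod_distinct_nonzero:
  "distinct xs \<Longrightarrow> sorted_wrt (\<lambda>x y. x + y \<noteq> 0) xs \<Longrightarrow> pair_prod schur_kernel xs \<noteq> 0"
  by (induction xs) (auto simp: schur_kernel_def prod_list_zero_iff)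

text \<open>Moving entry \<open>j\<close> to the front reverses \<open>j\<close> antisymmetric
  factors.\<close>

lemma pair_prod_delete_nth:
  assumes "j < length ks"
  shows "pair_prod schur_kernel ks = (- 1) ^ j * pair_prod schur_kernel (delete_nth j ks)
    * prod_list (map (schur_kernel (ks ! j)) (delete_nth j ks))"
proof -
  have "pair_prod schur_kernel ks = pair_prod schur_kernel (take j ks @ ks ! j # drop (Suc j) ks)"
    using id_take_nth_drop[OF assms] by simp
  then show ?thesis
    using assms unfolding pair_prod_append_Cons prod_list_schur_kernel_swap by (simp add: mult_ac)
qed

text \<open>Partial fractions at \<open>z = -k\<close>. The constant term 1 is replaced by the sum
  of the node coefficients, which is where the odd number of nodes enters.\<close>

lemma schur_kernel_sum:
  assumes "finite Y" "odd (card Y)" "\<And>x. x \<in> Y \<Longrightarrow> k + x \<noteq> 0"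
  shows "(\<Sum>x\<in>Y. schur_kernel k x * node_coeff Y x) = (\<Prod>x\<in>Y. schur_kernel k x)"
proof -
  have "- k \<notin> Y" using assms(3)[of "- k"] by auto
  have "(\<Prod>x\<in>Y. schur_kernel k x) = (\<Prod>x\<in>Y. (- k + x) / (- k - x))"
  proof (rule prod.cong[OF refl])
    fix x
    have "(- k + x) / (- k - x) = (- (k - x)) / (- (k + x))" by simp
    then show "schur_kernel k x = (- k + x) / (- k - x)" by (simp only: schur_kernel_def minus_divide_divide)
  qed
  also have "\<dots> = 1 + (\<Sum>x\<in>Y. 2 * x * node_coeff Y x / (- k - x))"
    by (rule node_partial_fractions) fact+
  also have "\<dots> = (\<Sum>x\<in>Y. node_coeff Y x) + (\<Sum>x\<in>Y. 2 * x * node_coeff Y x / (- k - x))"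
    using assms by (simp add: sum_node_coeff)
  also have "\<dots> = (\<Sum>x\<in>Y. node_coeff Y x + 2 * x * node_coeff Y x / (- k - x))"
    by (simp add: sum.distrib)
  also have "\<dots> = (\<Sum>x\<in>Y. schur_kernel k x * node_coeff Y x)"
  proof (rule sum.cong[OF refl])
    fix x assume "x \<in> Y"
    then have 1: "k + x \<noteq> 0" using assms(3) by auto
    have "- k - x = - (k + x)" by simp
    then have 2: "2 * x * node_coeff Y x / (- k - x) = - (2 * x * node_coeff Y x / (k + x))"
      by (simp only: minus_divide_right)
    have 3: "schur_kernel k x = 1 - 2 * x / (k + x)"
      using 1 by (simp add: schur_kernel_def divide_simps)
    show "node_coeff Y x + 2 * x * node_coeff Y x / (- k - x) = schur_kernel k x * node_coeff Y x"
      unfolding 2 3 by (simp add: algebra_simps)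
  qed
  finally show ?thesis by simp
qed

text \<open>
  When an entry is repeated, the two terms of the expansion that remove one of its occurrences
  cancel, and the other terms vanish by induction.
\<close>

lemma schur_pfaffian:
  fixes xs :: "'a :: field list"
  assumes "even (length xs)" "sorted_wrt (\<lambda>x y. x + y \<noteq> 0) xs"
  shows "pfaffian schur_kernel xs = pair_prod schur_kernel xs"
  using assms
proof (induction "length xs" arbitrary: xs rule: less_induct)
  case less
  show ?case
  proof (cases xs)
    case (Cons k ks)
    let ?h = "schur_kernel :: 'a \<Rightarrow> 'a \<Rightarrow> 'a"
    have k: "k + x \<noteq> 0" if "x \<in> set ks" for x using less.prems that Cons by simp
    have ks: "sorted_wrt (\<lambda>x y. x + y \<noteq> 0) ks" "odd (length ks)" using less.prems Cons by auto
    have IH: "pfaffian ?h (delete_nth j ks) = pair_prod ?h (delete_nth j ks)" if "j < length ks" for j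
      using that Cons ks less.prems by (intro less.hyps sorted_wrt_delete_nth) auto
    have eq: "pfaffian ?h xs = (\<Sum>j<length ks. (- 1) ^ j * ?h k (ks ! j) * pair_prod ?h (delete_nth j ks))"
      unfolding Cons pfaffian.simps by (intro sum.cong refl) (simp add: IH)
    show ?thesis
    proof (cases "distinct ks")
      case True
      let ?Y = "set ks"
      \<comment> \<open>Deleting \<open>?x\<close> divides the pair product, up to sign, by the
        factors of \<open>?x\<close>, and \<open>node_coeff\<close> is the reciprocal of those. With
        the product over \<open>ks\<close> taken out, the expansion is the sum in
        \<open>schur_kernel_sum\<close>.\<close>
      have t: "(- 1) ^ j * ?h k (ks ! j) * pair_prod ?h (delete_nth j ks)
        = pair_prod ?h ks * (?h k (ks ! j) * node_coeff ?Y (ks ! j))" if j: "j < length ks" for j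
      proof -
        let ?x = "ks ! j"
        have dec: "ks = take j ks @ ?x # drop (Suc j) ks" using id_take_nth_drop[OF j] .
        then have d: "distinct (take j ks @ ?x # drop (Suc j) ks)" using True by simp
        then have dd: "distinct (delete_nth j ks)" by auto
        have "set ks = insert ?x (set (delete_nth j ks))" by (subst dec) auto
        then have Y: "set (delete_nth j ks) = ?Y - {?x}" using d by auto
        have ne: "?x + b \<noteq> 0" "?x - b \<noteq> 0" if b: "b \<in> ?Y - {?x}" for b
        proof -
          have "b \<in> set (take j ks) \<or> b \<in> set (drop (Suc j) ks)" using b Y by auto
          moreover have "sorted_wrt (\<lambda>x y. x + y \<noteq> 0) (take j ks @ ?x # drop (Suc j) ks)"
            using ks(1) dec by simp
          ultimately show "?x + b \<noteq> 0" by (auto simp: sorted_wrt_append add.commute)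
          show "?x - b \<noteq> 0" using b by auto
        qed
        have "prod_list (map (?h ?x) (delete_nth j ks)) * node_coeff ?Y ?x
          = (\<Prod>b\<in>?Y - {?x}. ?h ?x b * ((?x + b) / (?x - b)))"
          using prod.distinct_set_conv_list[OF dd, of "?h ?x"]
          by (simp only: Y node_coeff_def prod.distrib)
        also have "\<dots> = 1" using ne by (intro prod.neutral) (simp add: schur_kernel_def)
        finally have 1: "prod_list (map (?h ?x) (delete_nth j ks)) * node_coeff ?Y ?x = 1" .
        have "pair_prod ?h ks * (?h k ?x * node_coeff ?Y ?x)
          = (- 1) ^ j * ?h k ?x * pair_prod ?h (delete_nth j ks)
            * (prod_list (map (?h ?x) (delete_nth j ks)) * node_coeff ?Y ?x)"
          unfolding pair_prod_delete_nth[OF j] by (simp only: mult_ac)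
        then show ?thesis unfolding 1 mult_1_right by (rule sym)
      qed
      have "pfaffian ?h xs = pair_prod ?h ks * (\<Sum>j<length ks. ?h k (ks ! j) * node_coeff ?Y (ks ! j))"
        unfolding eq sum_distrib_left by (intro sum.cong refl t) simp
      also have "(\<Sum>j<length ks. ?h k (ks ! j) * node_coeff ?Y (ks ! j)) = (\<Sum>x\<in>?Y. ?h k x * node_coeff ?Y x)"
        by (rule sum.reindex_bij_betw[OF bij_betw_nth]) (auto simp: True)
      also have "\<dots> = (\<Prod>x\<in>?Y. ?h k x)"
        using ks(2) k by (intro schur_kernel_sum) (auto simp: distinct_card True)
      also have "\<dots> = prod_list (map (?h k) ks)"
        by (rule prod.distinct_set_conv_list[OF True])
      finally show ?thesis using Cons by (simp add: mult.commute)
    next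
      case False
      then obtain as x bs cs where dec: "ks = as @ [x] @ bs @ [x] @ cs"
        by (metis not_distinct_decomp)
      let ?p = "length as" and ?q = "Suc (length as + length bs)"
      let ?t = "\<lambda>j. (- 1) ^ j * ?h k (ks ! j) * pair_prod ?h (delete_nth j ks)"
      have zero: "?t j = 0" if j: "j < length ks" "j \<noteq> ?p" "j \<noteq> ?q" for j
      proof -
        have xs: "ks ! ?p = x" "ks ! ?q = x" by (auto simp: dec nth_append)
        have len: "?p < length ks" "?q < length ks" by (auto simp: dec)
        \<comment> \<open>\<open>i a\<close> is the position of entry \<open>a\<close> after entry
          \<open>j\<close> has been deleted; both copies of \<open>x\<close> survive.\<close>
        define i where "i a = (if a < j then a else a - 1)" for a
        have "delete_nth j ks ! i a = ks ! a" if "a < length ks" "a \<noteq> j" for a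
          using that j by (auto simp: i_def nth_append)
        then have "delete_nth j ks ! i ?p = delete_nth j ks ! i ?q" using xs len j by metis
        moreover have "i ?p < length (delete_nth j ks)" "i ?q < length (delete_nth j ks)" "i ?p \<noteq> i ?q"
          using len j by (auto simp: i_def)
        ultimately have "\<not> distinct (delete_nth j ks)" by (metis nth_eq_iff_index_eq)
        then show ?thesis by (simp add: pair_prod_not_distinct)
      qed
      have "(\<Sum>j<length ks. ?t j) = (\<Sum>j\<in>{?p, ?q}. ?t j)"
        using zero by (intro sum.mono_neutral_right) (auto simp: dec)
      also have "\<dots> = ?t ?p + ?t ?q" by simp
      \<comment> \<open>The two remaining lists differ by moving \<open>x\<close> past
        \<open>bs\<close>, which costs \<open>(-1) ^ length bs\<close>; the signs of the expansion
        differ by one more factor \<open>-1\<close>.\<close>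
      also have "\<dots> = 0"
      proof -
        have "delete_nth ?p ks = (as @ bs) @ x # cs" "delete_nth ?q ks = as @ x # (bs @ cs)"
          "ks ! ?p = x" "ks ! ?q = x"
          by (auto simp: dec nth_append)
        then show ?thesis
          by (simp only: pair_prod_append_Cons)
             (simp add: prod_list_schur_kernel_swap power_add mult_ac flip: power_mult_distrib)
      qed
      finally show ?thesis
        using False unfolding eq by (simp add: Cons pair_prod_not_distinct)
    qed
  qed simp
qed

section \<open>Factorial Schur \<open>P\<close>-functions\<close>

definition padded :: "nat list \<Rightarrow> nat list"
  where "padded \<mu> = (if even (length \<mu>) then \<mu> else \<mu> @ [0])"

lemma even_length_padded: "even (length (padded \<mu>))"
  by (simp add: padded_def)

lemma sum_list_padded: "sum_list (padded \<mu>) = sum_list \<mu>"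
  by (simp add: padded_def)

lemma distinct_padded: "strict_partition \<mu> \<Longrightarrow> distinct (padded \<mu>)"
  by (simp add: padded_def strict_partition_distinct) (simp add: strict_partition_def)

text \<open>All parts are positive and the padding zero stands last, so the earlier of two entries
  is positive.\<close>

lemma sorted_wrt_padded:
  assumes "strict_partition \<mu>" "\<And>a b. a > 0 \<Longrightarrow> P a b"
  shows "sorted_wrt P (padded \<mu>)"
proof -
  have pos: "a > 0" if "a \<in> set \<mu>" for a
    using that assms(1) by (metis gr0I strict_partition_def)
  have "sorted_wrt (>) \<mu>" using assms(1) by (simp add: strict_partition_def)
  then have "sorted_wrt P \<mu>"
    by (rule sorted_wrt_mono_rel[rotated]) (use assms(2) pos in blast)
  then show ?thesis using assms(2) pos by (auto simp: padded_def sorted_wrt_append)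
qed

definition factorial_P :: "nat list \<Rightarrow> pser"
  where "factorial_P \<mu> = scale (1 / 2 ^ length \<mu>) (pfaffian factorial_Q2 (padded \<mu>))"

lemma factorial_P_Gamma: "factorial_P \<mu> \<in> Gamma"
  unfolding factorial_P_def by (intro Gamma.scale pfaffian_Gamma factorial_Q2_Gamma)

lemma degree_le_factorial_P: "degree_le (factorial_P \<mu>) (sum_list \<mu>)"
  using pfaffian_top_component[OF degree_le_factorial_Q2 hom_component_factorial_Q2, of "padded \<mu>"]
  by (simp add: factorial_P_def sum_list_padded degree_le_scale)

lemma hom_component_factorial_P: "hom_component (sum_list \<mu>) (factorial_P \<mu>) = schur_P \<mu>"
  using pfaffian_top_component[OF degree_le_factorial_Q2 hom_component_factorial_Q2, of "padded \<mu>"]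
  unfolding sum_list_padded factorial_P_def hom_component_scale schur_P_def schur_Q_def padded_def[symmetric]
  by simp

text \<open>The two kernels differ by a sign. It is written as \<open>\<i> * \<i>\<close> because
  \<open>pfaffian_scale\<close> attaches one factor to each index.\<close>

lemma pfaffian_kernel:
  assumes "even (length xs)" "sorted_wrt (\<lambda>x y. x + y \<noteq> 0) xs"
  shows "pfaffian kernel xs = \<i> ^ length xs * pair_prod schur_kernel xs"
proof -
  have "kernel = (\<lambda>a b. \<i> * \<i> * schur_kernel a b)"
    by (simp add: fun_eq_iff kernel_def schur_kernel_def flip: minus_divide_left)
  then have "pfaffian kernel xs = pfaffian (\<lambda>a b. \<i> * \<i> * schur_kernel a b) xs" by (rule arg_cong)
  also have "\<dots> = prod_list (map (\<lambda>_. \<i>) xs) * pfaffian schur_kernel xs" by (rule pfaffian_scale)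
  finally show ?thesis by (simp add: schur_pfaffian[OF assms] map_replicate_const)
qed

lemma value_at_factorial_P:
  assumes "strict_partition \<mu>" "strict_partition \<nu>"
  shows "value_at \<nu> (factorial_P \<mu>) = 1 / 2 ^ length \<mu> *
    (\<Sum>xs\<in>words (nodes \<nu>) (length (padded \<mu>)).
      prod_list (map2 (node_falling (nodes \<nu>)) (padded \<mu>) xs) * pfaffian kernel xs)"
proof -
  have "value_at \<nu> (factorial_P \<mu>)
    = 1 / 2 ^ length \<mu> * pfaffian (\<lambda>r s. value_at \<nu> (factorial_Q2 r s)) (padded \<mu>)"
    unfolding factorial_P_def
    by (simp add: value_at_scale pfaffian_Gamma factorial_Q2_Gamma value_at_pfaffian)
  also have "pfaffian (\<lambda>r s. value_at \<nu> (factorial_Q2 r s)) (padded \<mu>)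
    = pfaffian (\<lambda>r s. \<Sum>x\<in>nodes \<nu>. \<Sum>y\<in>nodes \<nu>.
        node_falling (nodes \<nu>) r x * node_falling (nodes \<nu>) s y * kernel x y) (padded \<mu>)"
    using assms by (intro pfaffian_cong sorted_wrt_padded value_at_factorial_Q2)
  also have "\<dots> = (\<Sum>xs\<in>words (nodes \<nu>) (length (padded \<mu>)).
      prod_list (map2 (node_falling (nodes \<nu>)) (padded \<mu>) xs) * pfaffian kernel xs)"
    by (rule pfaffian_expand) auto
  finally show ?thesis .
qed

lemma sum_list_mono_eq:
  fixes xs ys :: "nat list"
  assumes "list_all2 (\<le>) xs ys" "sum_list ys \<le> sum_list xs"
  shows "ys = xs"
  using assms
proof (induction rule: list_all2_induct)
  case (Cons x xs y ys)
  have "sum_list xs \<le> sum_list ys"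
    using Cons(2) by (induction rule: list_all2_induct) auto
  then show ?case using Cons by auto
qed simp

text \<open>
  In the expansion of \<open>P\<^sup>*\<^sub>\<mu>(\<nu>)\<close> a word with a repeated letter has a vanishing Pfaffian, and the falling
  factorials vanish unless each letter is at least the part of \<open>\<mu>\<close> at the same position.
\<close>

lemma factorial_P_word:
  assumes \<mu>: "strict_partition \<mu>" and \<nu>: "strict_partition \<nu>" and le: "sum_list \<nu> \<le> sum_list \<mu>"
    and xs: "xs \<in> words (nodes \<nu>) (length (padded \<mu>))"
    and nz: "prod_list (map2 (node_falling (nodes \<nu>)) (padded \<mu>) xs) * pfaffian kernel xs \<noteq> 0"
  shows "\<nu> = \<mu> \<and> xs = map of_nat (padded \<mu>)"
proof -
  let ?k = "padded \<mu>"
  from xs have "set xs \<subseteq> of_nat ` insert 0 (set \<nu>)" and len: "length xs = length ?k"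
    by (auto simp: words_def nodes_def)
  then have "xs \<in> map of_nat ` lists (insert 0 (set \<nu>))"
    unfolding lists_image[symmetric] by (simp add: lists_eq_set)
  then obtain ns where ns: "xs = map of_nat ns" "set ns \<subseteq> insert 0 (set \<nu>)"
    by (auto simp only: lists_eq_set image_iff mem_Collect_eq)
  have lenn: "length ns = length ?k" using len ns by simp
  have ge: "?k ! i \<le> ns ! i" if i: "i < length ?k" for i
  proof -
    have "map2 (node_falling (nodes \<nu>)) ?k xs ! i \<in> set (map2 (node_falling (nodes \<nu>)) ?k xs)"
      using i len by (intro nth_mem) simp
    moreover have "map2 (node_falling (nodes \<nu>)) ?k xs ! i = node_falling (nodes \<nu>) (?k ! i) (of_nat (ns ! i))"
      using i lenn by (simp add: ns(1))
    ultimately have "node_falling (nodes \<nu>) (?k ! i) (of_nat (ns ! i)) \<noteq> 0"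
      using nz by (metis mult_zero_left prod_list_zero_iff)
    then show ?thesis by (auto simp: node_falling_def poly_falling_poly_eq_0_iff)
  qed
  have kpos: "?k ! i > 0" if "i < length \<mu>" for i
    using that strict_partition_nth_pos[OF \<mu>, of i] by (auto simp: padded_def nth_append)
  have sorted: "sorted_wrt (\<lambda>x y. x + y \<noteq> 0) xs"
    unfolding sorted_wrt_iff_nth_less
  proof (intro allI impI)
    fix i j assume ij: "i < j" "j < length xs"
    then have "i < length \<mu>" using len by (auto simp: padded_def split: if_splits)
    then have "0 < ns ! i" using kpos[of i] ge[of i] ij len by auto
    then have "of_nat (ns ! i + ns ! j) \<noteq> (0 :: complex)" by (simp only: of_nat_eq_0_iff)
    then show "xs ! i + xs ! j \<noteq> 0" using ij len lenn by (simp add: ns(1))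
  qed
  have "distinct xs"
  proof (rule ccontr)
    assume "\<not> distinct xs"
    then have "pfaffian kernel xs = 0"
      using len even_length_padded[of \<mu>] sorted by (simp add: pfaffian_kernel pair_prod_not_distinct)
    then show False using nz by simp
  qed
  then have dn: "distinct ns" by (simp add: ns(1) distinct_map)
  \<comment> \<open>The padding position is cut off: its index 0 gives no positive lower bound on
    the letter.\<close>
  define ms where "ms = take (length \<mu>) ns"
  have lm: "length \<mu> \<le> length ?k" by (auto simp: padded_def)
  have "list_all2 (\<le>) \<mu> ms"
    unfolding list_all2_conv_all_nth ms_def
  proof (intro conjI allI impI)
    fix i assume i: "i < length \<mu>"
    then have "?k ! i = \<mu> ! i" by (auto simp: padded_def nth_append)
    then show "\<mu> ! i \<le> take (length \<mu>) ns ! i" using ge[of i] i lm by simp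
  qed (use lm lenn in simp)
  moreover have "set ms \<subseteq> set \<nu>"
  proof
    fix m assume m: "m \<in> set ms"
    then obtain i where i: "i < length \<mu>" "m = ns ! i" "i < length ns"
      using lm lenn by (auto simp: ms_def in_set_conv_nth)
    then have "m > 0" using kpos[of i] ge[of i] lenn by auto
    moreover have "m \<in> set ns" using i(2,3) by simp
    then have "m \<in> insert 0 (set \<nu>)" by (rule subsetD[OF ns(2)])
    ultimately show "m \<in> set \<nu>" by auto
  qed
  moreover have "distinct ms" using dn by (simp add: ms_def)
  then have sm: "sum_list ms = \<Sum>(set ms)" by (simp add: distinct_sum_list_conv_Sum)
  moreover have "\<Sum>(set ms) \<le> \<Sum>(set \<nu>)" using \<open>set ms \<subseteq> set \<nu>\<close> by (intro sum_mono2) auto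
  \<comment> \<open>The letters are distinct parts of \<open>\<nu>\<close>, so their total is at
    most \<open>|\<nu>| \<le> |\<mu>|\<close>; as they dominate the parts of \<open>\<mu>\<close>,
    equality holds at every position.\<close>
  ultimately have ms: "ms = \<mu>"
    using le sum_list_mono_eq[of \<mu> ms] sum_list_strict_partition[OF \<nu>] by simp
  have "set \<mu> = set \<nu>"
  proof (rule ccontr)
    assume "set \<mu> \<noteq> set \<nu>"
    then obtain m where m: "m \<in> set \<nu> - set \<mu>" using \<open>set ms \<subseteq> set \<nu>\<close> ms by auto
    then have "m > 0" using \<nu> by (metis DiffD1 gr0I strict_partition_def)
    moreover have "\<Sum>(insert m (set \<mu>)) \<le> \<Sum>(set \<nu>)"
      using m \<open>set ms \<subseteq> set \<nu>\<close> ms by (intro sum_mono2) auto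
    ultimately show False
      using m le sum_list_strict_partition[OF \<nu>] sum_list_strict_partition[OF \<mu>] by simp
  qed
  then have eq: "\<nu> = \<mu>" using strict_partition_eqI[OF \<mu> \<nu>] by simp
  have "ns = ?k"
  proof (cases "even (length \<mu>)")
    case True
    then show ?thesis using ms lenn by (simp add: ms_def padded_def)
  next
    case False
    \<comment> \<open>The parts are used up by the other positions, so distinctness leaves only the
      node 0 for the padding position.\<close>
    then have "ns = \<mu> @ [ns ! length \<mu>]"
      using ms lenn take_Suc_conv_app_nth[of "length \<mu>" ns] by (simp add: ms_def padded_def)
    then have dec: "ns = \<mu> @ [m]" if "m = ns ! length \<mu>" for m using that by simp
    then have "ns ! length \<mu> \<notin> set \<mu>" using dn by (metis distinct_append disjoint_iff list.set_intros(1))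
    moreover have "ns ! length \<mu> \<in> insert 0 (set \<mu>)"
      using ns(2) lenn False eq by (metis even_Suc length_append_singleton lessI nth_mem padded_def subsetD)
    ultimately show ?thesis using dec[OF refl] False by (auto simp: padded_def)
  qed
  then show ?thesis using eq ns(1) by simp
qed

lemma value_at_factorial_P_eq_0:
  assumes "strict_partition \<mu>" "strict_partition \<nu>" "sum_list \<nu> \<le> sum_list \<mu>" "\<nu> \<noteq> \<mu>"
  shows "value_at \<nu> (factorial_P \<mu>) = 0"
proof -
  have "prod_list (map2 (node_falling (nodes \<nu>)) (padded \<mu>) xs) * pfaffian kernel xs = 0"
    if "xs \<in> words (nodes \<nu>) (length (padded \<mu>))" for xs
    using factorial_P_word[OF assms(1-3) that] assms(4) by blast
  then show ?thesis
    unfolding value_at_factorial_P[OF assms(1,2)] by (simp only: sum.neutral_const cong: sum.cong) simp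
qed

lemma node_weight_nonzero:
  assumes "x \<in> nodes \<nu>"
  shows "node_weight (nodes \<nu>) x \<noteq> 0"
  using nodes_add_eq_0[OF assms] by (auto simp: node_weight_def node_coeff_def)

text \<open>Only the word spelled by \<open>\<mu>\<close> itself survives. Its term is nonzero: the
  falling factorial of order \<open>k\<close> does not vanish at \<open>k\<close>, and the letters
  are distinct with no two summing to 0.\<close>

lemma value_at_factorial_P_self:
  assumes \<mu>: "strict_partition \<mu>"
  shows "value_at \<mu> (factorial_P \<mu>) \<noteq> 0"
proof -
  let ?k = "padded \<mu>"
  let ?xs = "map of_nat ?k :: complex list"
  let ?t = "\<lambda>xs. prod_list (map2 (node_falling (nodes \<mu>)) ?k xs) * pfaffian kernel xs"
  have "set ?k \<subseteq> insert 0 (set \<mu>)" by (auto simp: padded_def)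
  then have xs: "?xs \<in> words (nodes \<mu>) (length ?k)" by (auto simp: words_def nodes_def)
  have "(\<Sum>xs\<in>words (nodes \<mu>) (length ?k). ?t xs) = (\<Sum>xs\<in>{?xs}. ?t xs)"
  proof (rule sum.mono_neutral_right)
    show "\<forall>xs\<in>words (nodes \<mu>) (length ?k) - {?xs}. ?t xs = 0"
      using factorial_P_word[OF \<mu> \<mu> order_refl] by (metis DiffD1 DiffD2 singletonI)
  qed (use xs in \<open>simp_all add: finite_words\<close>)
  moreover have "prod_list (map2 (node_falling (nodes \<mu>)) ?k ?xs) \<noteq> 0"
  proof -
    have map2: "map2 v ks (map of_nat ks) = map (\<lambda>k. v k (of_nat k)) ks"
      for v :: "nat \<Rightarrow> complex \<Rightarrow> complex" and ks
      by (induction ks) auto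
    have "node_falling (nodes \<mu>) k (of_nat k) \<noteq> 0" if "k \<in> set ?k" for k
    proof -
      have "of_nat k \<in> nodes \<mu>"
        using that \<open>set ?k \<subseteq> insert 0 (set \<mu>)\<close> unfolding nodes_def by (intro imageI) auto
      then show ?thesis
        by (simp add: node_falling_def node_weight_nonzero poly_falling_poly_eq_0_iff)
    qed
    then show ?thesis unfolding map2 by (auto simp: prod_list_zero_iff)
  qed
  moreover have "pfaffian kernel ?xs \<noteq> 0"
  proof -
    have "sorted_wrt (\<lambda>x y. x + y \<noteq> 0) ?xs"
      unfolding sorted_wrt_map
      by (rule sorted_wrt_padded[OF \<mu>]) (simp flip: of_nat_add)
    moreover have "distinct ?xs" using distinct_padded[OF \<mu>] by (simp add: distinct_map inj_on_def)
    ultimately show ?thesis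
      using even_length_padded[of \<mu>] by (simp add: pfaffian_kernel pair_prod_distinct_nonzero)
  qed
  ultimately show ?thesis unfolding value_at_factorial_P[OF \<mu> \<mu>] by simp
qed

section \<open>Independence, vanishing and uniqueness\<close>

lemma finite_strict_partitions: "finite {\<kappa>. strict_partition \<kappa> \<and> sum_list \<kappa> < n}"
proof -
  have "{\<kappa>. strict_partition \<kappa> \<and> sum_list \<kappa> < n} \<subseteq> {xs. set xs \<subseteq> {..<n} \<and> length xs \<le> n}"
  proof clarify
    fix \<kappa> assume \<kappa>: "strict_partition \<kappa>" "sum_list \<kappa> < n"
    have "length \<kappa> \<le> sum_list \<kappa>"
      using \<kappa>(1) by (induction \<kappa>) (auto simp: strict_partition_Cons)
    moreover have "k < n" if "k \<in> set \<kappa>" for k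
      using member_le_sum_list[OF that] \<kappa>(2) by simp
    ultimately show "set \<kappa> \<subseteq> {..<n} \<and> length \<kappa> \<le> n" using \<kappa>(2) by auto
  qed
  then show ?thesis by (rule finite_subset) (simp add: finite_lists_length_le)
qed

text \<open>At \<open>\<kappa>\<close> every other function of at least the same size vanishes, and
  the smaller ones already have coefficient 0 by induction on the size.\<close>

lemma factorial_P_combination_eq_0:
  assumes S: "finite S" "\<And>\<kappa>. \<kappa> \<in> S \<Longrightarrow> strict_partition \<kappa>"
    and zero: "\<And>\<nu>. \<nu> \<in> S \<Longrightarrow> value_at \<nu> (\<Sum>\<kappa>\<in>S. scale (c \<kappa>) (factorial_P \<kappa>)) = 0"
    and "\<kappa> \<in> S"
  shows "c \<kappa> = 0"
  using assms(4)
proof (induction "sum_list \<kappa>" arbitrary: \<kappa> rule: less_induct)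
  case less
  have "c \<rho> * value_at \<kappa> (factorial_P \<rho>) = 0" if "\<rho> \<in> S - {\<kappa>}" for \<rho>
    using less that value_at_factorial_P_eq_0[of \<rho> \<kappa>] S(2) by (cases "sum_list \<rho> < sum_list \<kappa>") auto
  then have "(\<Sum>\<rho>\<in>S - {\<kappa>}. c \<rho> * value_at \<kappa> (factorial_P \<rho>)) = 0"
    by (rule sum.neutral[OF ballI])
  then have "(\<Sum>\<rho>\<in>S. c \<rho> * value_at \<kappa> (factorial_P \<rho>)) = c \<kappa> * value_at \<kappa> (factorial_P \<kappa>)"
    using less.prems S(1) by (simp add: sum.remove[of S \<kappa>])
  moreover have "(\<Sum>\<rho>\<in>S. c \<rho> * value_at \<kappa> (factorial_P \<rho>)) = 0"
    using zero[OF less.prems] by (simp add: value_at_sum value_at_scale Gamma.scale factorial_P_Gamma)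
  ultimately show ?case using value_at_factorial_P_self S(2) less.prems by simp
qed

text \<open>
  Triangularity makes the \<^const>\<open>factorial_P\<close> of size less than \<open>n\<close> independent; as there are no more
  spanning products \<^const>\<open>q_prod\<close> than these, they span as well.
\<close>

lemma Gamma_eq_0_if_vanishing:
  assumes f: "f \<in> Gamma" "\<And>m. coeff f m \<noteq> 0 \<Longrightarrow> mdeg m < n"
    and zero: "\<And>\<nu>. strict_partition \<nu> \<Longrightarrow> sum_list \<nu> < n \<Longrightarrow> value_at \<nu> f = 0"
  shows "f = 0"
proof -
  let ?S = "{\<kappa>. strict_partition \<kappa> \<and> sum_list \<kappa> < n}"
  let ?s = "factorial_P ` ?S" and ?t = "q_prod ` ?S"
  have fin: "finite ?S" by (rule finite_strict_partitions)
  have inj: "inj_on factorial_P ?S"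
  proof (rule inj_onI, rule ccontr)
    fix \<kappa> \<rho> assume "\<kappa> \<in> ?S" "\<rho> \<in> ?S" and eq: "factorial_P \<kappa> = factorial_P \<rho>" and ne: "\<kappa> \<noteq> \<rho>"
    then have s: "strict_partition \<kappa>" "strict_partition \<rho>" by auto
    show False
      using value_at_factorial_P_self[OF s(1)] value_at_factorial_P_self[OF s(2)]
        value_at_factorial_P_eq_0[OF s] value_at_factorial_P_eq_0[OF s(2,1)] eq ne
      by (cases "sum_list \<kappa> \<le> sum_list \<rho>") auto
  qed
  have ind: "\<not> pser.dependent ?s"
  proof
    assume "pser.dependent ?s"
    then obtain u where u: "\<exists>v\<in>?s. u v \<noteq> 0" "(\<Sum>v\<in>?s. scale (u v) v) = 0"
      using fin by (auto simp: pser.dependent_finite)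
    then have "(\<Sum>\<kappa>\<in>?S. scale (u (factorial_P \<kappa>)) (factorial_P \<kappa>)) = 0"
      using inj by (simp add: sum.reindex)
    then have "u (factorial_P \<kappa>) = 0" if "\<kappa> \<in> ?S" for \<kappa>
      using factorial_P_combination_eq_0[OF fin, of "\<lambda>\<kappa>. u (factorial_P \<kappa>)" \<kappa>] that by auto
    then show False using u(1) by auto
  qed
  have sub: "?s \<subseteq> pser.span ?t"
  proof clarify
    fix \<kappa> assume "strict_partition \<kappa>" "sum_list \<kappa> < n"
    then show "factorial_P \<kappa> \<in> pser.span ?t"
      using degree_leD[OF degree_le_factorial_P] by (intro Gamma_span factorial_P_Gamma) fastforce
  qed
  have "f \<in> pser.span ?s"
  proof (rule ccontr)
    assume "f \<notin> pser.span ?s"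
    then have "\<not> pser.dependent (insert f ?s)" "f \<notin> ?s"
      using ind by (auto simp: pser.independent_insert intro: pser.span_base)
    moreover have "insert f ?s \<subseteq> pser.span ?t" using sub Gamma_span[OF f] by auto
    ultimately have "card (insert f ?s) \<le> card ?t"
      using pser.independent_span_bound[of ?t "insert f ?s"] fin by auto
    moreover have "card ?t \<le> card ?s" using fin inj by (simp add: card_image card_image_le)
    ultimately show False using \<open>f \<notin> ?s\<close> fin by simp
  qed
  then obtain u where "f = (\<Sum>v\<in>?s. scale (u v) v)"
    using fin by (auto simp: pser.span_finite)
  then have fu: "f = (\<Sum>\<kappa>\<in>?S. scale (u (factorial_P \<kappa>)) (factorial_P \<kappa>))"
    using inj by (simp add: sum.reindex)
  have "u (factorial_P \<kappa>) = 0" if "\<kappa> \<in> ?S" for \<kappa>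
  proof (rule factorial_P_combination_eq_0[OF fin _ _ that])
    fix \<nu> assume "\<nu> \<in> ?S"
    then show "value_at \<nu> (\<Sum>\<kappa>\<in>?S. scale (u (factorial_P \<kappa>)) (factorial_P \<kappa>)) = 0"
      unfolding fu[symmetric] using zero by auto
  qed auto
  then show ?thesis unfolding fu by (intro sum.neutral) auto
qed

text \<open>Two candidates have the same top component, so their difference has degree below
  \<open>|\<mu>|\<close> and vanishes at all strict partitions of smaller size.\<close>

lemma factorial_schur_P_eq:
  assumes \<mu>: "strict_partition \<mu>"
  shows "factorial_schur_P \<mu> = factorial_P \<mu>"
proof -
  let ?n = "sum_list \<mu>"
  have van: "eval_at (factorial_P \<mu>) (partition_seq \<nu>) = 0"
    if "strict_partition \<nu>" "\<nu> \<noteq> \<mu>" "sum_list \<nu> \<le> ?n" for \<nu>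
    using value_at_factorial_P_eq_0[OF \<mu> that(1,3,2)] by (simp add: value_at_def)
  \<comment> \<open>With a zero top component the function would have smaller degree and vanish at
    all smaller strict partitions, hence be 0, against its value at \<open>\<mu>\<close>.\<close>
  have "\<exists>m. coeff (factorial_P \<mu>) m \<noteq> 0 \<and> mdeg m = ?n"
  proof (rule ccontr)
    assume no: "\<nexists>m. coeff (factorial_P \<mu>) m \<noteq> 0 \<and> mdeg m = ?n"
    have "factorial_P \<mu> = 0"
    proof (rule Gamma_eq_0_if_vanishing[OF factorial_P_Gamma])
      show "mdeg m < ?n" if "coeff (factorial_P \<mu>) m \<noteq> 0" for m
        using degree_leD[OF degree_le_factorial_P that] no that by fastforce
      show "value_at \<nu> (factorial_P \<mu>) = 0" if "strict_partition \<nu>" "sum_list \<nu> < ?n" for \<nu>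
        using value_at_factorial_P_eq_0[OF \<mu> that(1)] that(2) by auto
    qed
    then show False using value_at_factorial_P_self[OF \<mu>] by simp
  qed
  then have deg: "has_degree (factorial_P \<mu>) ?n"
    using degree_le_factorial_P by (simp add: has_degree_def degree_le_def)
  show ?thesis
    unfolding factorial_schur_P_def
  proof (rule the_equality)
    show "factorial_P \<mu> \<in> Gamma \<and> has_degree (factorial_P \<mu>) ?n \<and>
        hom_component ?n (factorial_P \<mu>) = schur_P \<mu> \<and>
        (\<forall>\<nu>. strict_partition \<nu> \<longrightarrow> \<nu> \<noteq> \<mu> \<longrightarrow> sum_list \<nu> \<le> ?n \<longrightarrow>
          eval_at (factorial_P \<mu>) (partition_seq \<nu>) = 0)"
      using factorial_P_Gamma deg hom_component_factorial_P van by blast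
  next
    fix f
    assume f: "f \<in> Gamma \<and> has_degree f ?n \<and> hom_component ?n f = schur_P \<mu> \<and>
        (\<forall>\<nu>. strict_partition \<nu> \<longrightarrow> \<nu> \<noteq> \<mu> \<longrightarrow> sum_list \<nu> \<le> ?n \<longrightarrow> eval_at f (partition_seq \<nu>) = 0)"
    have "f - factorial_P \<mu> = 0"
    proof (rule Gamma_eq_0_if_vanishing)
      show "f - factorial_P \<mu> \<in> Gamma" using f factorial_P_Gamma Gamma_diff by blast
      show "mdeg m < ?n" if "coeff (f - factorial_P \<mu>) m \<noteq> 0" for m
      proof -
        have "mdeg m \<noteq> ?n"
        proof
          assume "mdeg m = ?n"
          then have "coeff (f - factorial_P \<mu>) m = coeff (hom_component ?n f - hom_component ?n (factorial_P \<mu>)) m"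
            by (simp add: minus_pser.rep_eq hom_component.rep_eq)
          then show False using that f by (simp add: hom_component_factorial_P zero_pser.rep_eq)
        qed
        moreover have "coeff f m \<noteq> 0 \<or> coeff (factorial_P \<mu>) m \<noteq> 0"
          using that by (auto simp: minus_pser.rep_eq)
        then have "mdeg m \<le> ?n" using f deg by (auto simp: has_degree_def)
        ultimately show ?thesis by simp
      qed
      show "value_at \<nu> (f - factorial_P \<mu>) = 0" if "strict_partition \<nu>" "sum_list \<nu> < ?n" for \<nu>
      proof -
        have "value_at \<nu> f = 0" using f that by (auto simp: value_at_def)
        moreover have "value_at \<nu> (factorial_P \<mu>) = 0"
          using van[of \<nu>] that by (auto simp: value_at_def)
        ultimately show ?thesis using f by (simp add: value_at_diff factorial_P_Gamma)
      qed
    qed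
    then show "f = factorial_P \<mu>" by simp
  qed
qed

section \<open>Evaluation at staircases\<close>

definition staircase :: "nat \<Rightarrow> nat list"
  where "staircase k = rev [1..<Suc k]"

lemma strict_partition_staircase: "strict_partition (staircase k)"
  by (auto simp: staircase_def strict_partition_def sorted_wrt_rev simp del: upt_Suc)

lemma nodes_staircase: "nodes (staircase k) = of_nat ` {..k}"
proof -
  have "insert 0 (set (staircase k)) = {..k}"
    by (auto simp: staircase_def simp del: upt_Suc)
  then show ?thesis by (simp add: nodes_def)
qed

definition falling_sum :: "complex set \<Rightarrow> nat \<Rightarrow> complex"
  where "falling_sum X r = (\<Sum>x\<in>X. node_falling X r x)"

text \<open>As \<open>node_sum_insert\<close>, with \<open>x - c\<close> split into
  \<open>(x - r) + (r - c)\<close>, because \<open>x - r\<close> raises the order of the falling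
  factorial.\<close>

lemma falling_sum_insert:
  assumes "finite X" "0 \<in> X" "y \<notin> X"
  shows "falling_sum (insert y X) (Suc r) + (of_nat r - y) * falling_sum (insert y X) r
    = falling_sum X (Suc r) + (of_nat r + y) * falling_sum X r"
proof -
  have "falling_sum Z (Suc r) + (of_nat r - c) * falling_sum Z r
    = (\<Sum>x\<in>Z. node_weight Z x * ((x - c) * poly (falling_poly r) x))" for Z c
    unfolding falling_sum_def sum_distrib_left sum.distrib[symmetric]
    by (intro sum.cong refl) (simp add: node_falling_def poly_falling_poly_Suc algebra_simps)
  from this[of "insert y X" y] this[of X "- y"] sum_node_weight_insert[OF assms, of "poly (falling_poly r)"]
  show ?thesis by simp
qed

text \<open>For \<open>\<kappa> = k (k + 1)\<close> and \<open>r \<le> k\<close> this is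
  \<open>(k + r)! / (r! (k - r)!)\<close>, and it vanishes for \<open>r > k\<close>. The form given
  is a polynomial in \<open>\<kappa>\<close>, which permits interpolation.\<close>

definition falling_value :: "complex \<Rightarrow> nat \<Rightarrow> complex"
  where "falling_value \<kappa> r = (\<Prod>j=1..r. (\<kappa> - (of_nat j - 1) * of_nat j) / of_nat j)"

lemma falling_value_0 [simp]: "falling_value \<kappa> 0 = 1"
  by (simp add: falling_value_def)

lemma falling_value_Suc:
  "falling_value \<kappa> (Suc r) = falling_value \<kappa> r * ((\<kappa> - of_nat r * (of_nat r + 1)) / (of_nat r + 1))"
  by (simp add: falling_value_def add.commute)

text \<open>Twice the size of the staircase with \<open>k\<close> rows.\<close>

definition casimir :: "nat \<Rightarrow> complex"
  where "casimir k = of_nat k * (of_nat k + 1)"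

text \<open>The quotient of the two closed forms, cross-multiplied so that it also holds where
  \<open>k + 1 - r\<close> vanishes.\<close>

lemma falling_value_casimir_Suc:
  "falling_value (casimir (Suc k)) r * (of_nat k + 1 - of_nat r)
    = falling_value (casimir k) r * (of_nat k + 1 + of_nat r)"
proof (induction r)
  case (Suc r)
  have r: "of_nat r + 1 \<noteq> (0 :: complex)" by (metis of_nat_Suc of_nat_neq_0 add.commute)
  have 1: "casimir (Suc k) - of_nat r * (of_nat r + 1) = (of_nat k + 1 - of_nat r) * (of_nat k + 2 + of_nat r)"
    and 2: "casimir k - of_nat r * (of_nat r + 1) = (of_nat k - of_nat r) * (of_nat k + 1 + of_nat r)"
    by (simp_all add: casimir_def algebra_simps)
  have "falling_value (casimir (Suc k)) (Suc r) * (of_nat k + 1 - of_nat (Suc r))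
    = (falling_value (casimir (Suc k)) r * (of_nat k + 1 - of_nat r)) * ((of_nat k + 2 + of_nat r) / (of_nat r + 1) * (of_nat k - of_nat r))"
    unfolding falling_value_Suc 1 by simp
  also have "\<dots> = falling_value (casimir k) (Suc r) * (of_nat k + 1 + of_nat (Suc r))"
    unfolding Suc falling_value_Suc 2 by (simp add: algebra_simps)
  finally show ?case .
qed (simp add: casimir_def)

text \<open>Double induction: adjoining the node \<open>k + 1\<close> gives a recursion from
  \<open>r\<close> to \<open>r + 1\<close>, which starts at the total weight 1 for
  \<open>r = 0\<close>.\<close>

lemma falling_sum_staircase: "falling_sum (nodes (staircase k)) r = falling_value (casimir k) r"
proof (induction k arbitrary: r)
  case 0
  have "falling_value 0 (Suc r) = 0" for r
    by (induction r) (simp_all add: falling_value_Suc)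
  then have "falling_value 0 r = (if r = 0 then 1 else 0)" by (cases r) auto
  moreover have "poly (falling_poly r) 0 = (if r = 0 then 1 else 0)"
    using poly_falling_poly_eq_0_iff[of r 0] by (auto simp: falling_poly_def)
  ultimately show ?case
    by (simp add: nodes_staircase falling_sum_def node_falling_def node_weight_def node_coeff_def casimir_def)
next
  case (Suc k)
  let ?X = "nodes (staircase k)" and ?y = "of_nat (Suc k) :: complex"
  have ins: "nodes (staircase (Suc k)) = insert ?y ?X"
    by (simp add: nodes_staircase atMost_Suc)
  have y: "?y \<notin> ?X" by (auto simp: nodes_staircase simp del: of_nat_Suc)
  show ?case
  proof (induction r)
    case 0
    show ?case
      using sum_node_weight[of "nodes (staircase (Suc k))"] by (simp add: falling_sum_def node_falling_def falling_poly_def)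
  next
    case (Suc r)
    have r: "of_nat r + 1 \<noteq> (0 :: complex)" by (metis of_nat_Suc of_nat_neq_0 add.commute)
    let ?a = "falling_value (casimir (Suc k)) r" and ?b = "falling_value (casimir k) r"
    have "falling_sum (insert ?y ?X) (Suc r)
      = falling_value (casimir k) (Suc r) + (of_nat r + ?y) * ?b - (of_nat r - ?y) * ?a"
      using falling_sum_insert[OF _ _ y, of r] Suc.IH Suc.prems \<open>\<And>r. falling_sum ?X r = falling_value (casimir k) r\<close>
      by (simp add: ins algebra_simps)
    also have "\<dots> = (of_nat k + 1) / (of_nat r + 1) * (?b * (of_nat k + 1 + of_nat r)) + (of_nat k + 1 - of_nat r) * ?a"
      using r by (simp add: falling_value_Suc casimir_def divide_simps) (simp add: algebra_simps)
    also have "\<dots> = (of_nat k + 1) / (of_nat r + 1) * (?a * (of_nat k + 1 - of_nat r)) + (of_nat k + 1 - of_nat r) * ?a"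
      by (simp only: falling_value_casimir_Suc)
    also have "\<dots> = falling_value (casimir (Suc k)) (Suc r)"
      using r by (simp add: falling_value_Suc casimir_def divide_simps) (simp add: algebra_simps)
    finally show ?case by (simp add: ins)
  qed
qed

definition falling_pair :: "complex set \<Rightarrow> nat \<Rightarrow> nat \<Rightarrow> complex"
  where "falling_pair X r s = (\<Sum>x\<in>X. \<Sum>y\<in>X. node_falling X r x * node_falling X s y * kernel x y)"

text \<open>The factor \<open>x + y\<close> cancels the denominator of the kernel, and
  \<open>x\<close> times a falling factorial of order \<open>r\<close> is the one of order
  \<open>r + 1\<close> plus \<open>r\<close> times itself.\<close>

lemma falling_pair_rec:
  assumes "X = nodes \<nu>"
  shows "falling_pair X (Suc r) s + falling_pair X r (Suc s) + (of_nat r + of_nat s) * falling_pair X r s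
    = falling_sum X r * falling_sum X (Suc s) - falling_sum X (Suc r) * falling_sum X s
      + (of_nat s - of_nat r) * (falling_sum X r * falling_sum X s)"
proof -
  let ?n = "node_falling X"
  have Suc: "?n (Suc r) x = ?n r x * (x - of_nat r)" for r x
    by (simp add: node_falling_def poly_falling_poly_Suc mult.assoc)
  have "falling_pair X (Suc r) s + falling_pair X r (Suc s) + (of_nat r + of_nat s) * falling_pair X r s
    = (\<Sum>x\<in>X. \<Sum>y\<in>X. ?n r x * ?n s y * ((x + y) * kernel x y))"
    unfolding falling_pair_def sum_distrib_left sum.distrib[symmetric] Suc
    by (intro sum.cong refl) (simp add: algebra_simps)
  also have "\<dots> = (\<Sum>x\<in>X. \<Sum>y\<in>X. ?n r x * ?n s y * (y - x))"
  proof (intro sum.cong refl)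
    fix x y assume "x \<in> X" "y \<in> X"
    then have "(x + y) * kernel x y = y - x"
      using nodes_add_eq_0[of x \<nu> y] assms by (auto simp: kernel_def)
    then show "?n r x * ?n s y * ((x + y) * kernel x y) = ?n r x * ?n s y * (y - x)" by simp
  qed
  also have "\<dots> = (\<Sum>x\<in>X. \<Sum>y\<in>X. ?n r x * ?n (Suc s) y - ?n (Suc r) x * ?n s y
      + (of_nat s - of_nat r) * (?n r x * ?n s y))"
    unfolding Suc by (intro sum.cong refl) (simp add: algebra_simps)
  finally show ?thesis
    by (simp only: sum.distrib sum_subtractf sum_distrib_left[symmetric] sum_product falling_sum_def)
qed

text \<open>\<open>B\<close>, \<open>C\<close>, \<open>D\<close> stand for the pairs
  \<open>(r, s)\<close>, \<open>(r + 1, s)\<close>, \<open>(r, s + 1)\<close>, and \<open>a\<close>,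
  \<open>b\<close>, \<open>a'\<close>, \<open>b'\<close> for the single sums at \<open>r\<close>,
  \<open>s\<close>, \<open>r + 1\<close>, \<open>s + 1\<close>. Eliminating \<open>C\<close> and
  \<open>D\<close> also cancels all terms in \<open>\<kappa>\<close>.\<close>

lemma falling_pair_algebra:
  fixes R S \<kappa> a b a' b' B C D :: complex
  assumes "R + 1 \<noteq> 0" "S + 1 \<noteq> 0" "R + S + 1 \<noteq> 0"
    and "(R + 1 + S) * C = (R + 1 - S) * (a' * b)" "(R + (S + 1)) * D = (R - (S + 1)) * (a * b')"
    and "a' = a * ((\<kappa> - R * (R + 1)) / (R + 1))" "b' = b * ((\<kappa> - S * (S + 1)) / (S + 1))"
    and "C + D + (R + S) * B = a * b' - a' * b + (S - R) * (a * b)"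
  shows "(R + S) * B = (R - S) * (a * b)"
proof -
  have C: "C = (R + 1 - S) * (a' * b) / (R + S + 1)" and D: "D = (R - S - 1) * (a * b') / (R + S + 1)"
    using assms(3-5) by (simp_all add: field_simps)
  have "(R + S) * B = a * b' - a' * b + (S - R) * (a * b) - C - D"
    using assms(8) by (simp add: algebra_simps)
  also have "\<dots> = a * b * ((\<kappa> - S * (S + 1)) / (S + 1) - (\<kappa> - R * (R + 1)) / (R + 1) + (S - R)
      - (R + 1 - S) * ((\<kappa> - R * (R + 1)) / (R + 1)) / (R + S + 1)
      - (R - S - 1) * ((\<kappa> - S * (S + 1)) / (S + 1)) / (R + S + 1))"
    unfolding C D assms(6,7) by (simp add: algebra_simps)
  also have "(\<kappa> - S * (S + 1)) / (S + 1) - (\<kappa> - R * (R + 1)) / (R + 1) + (S - R)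
      - (R + 1 - S) * ((\<kappa> - R * (R + 1)) / (R + 1)) / (R + S + 1)
      - (R - S - 1) * ((\<kappa> - S * (S + 1)) / (S + 1)) / (R + S + 1) = R - S"
    using assms(1-3) by (simp add: divide_simps) algebra
  finally show ?thesis by (simp add: mult_ac)
qed

lemma node_falling_staircase_eq_0:
  "x \<in> nodes (staircase k) \<Longrightarrow> k < r \<Longrightarrow> node_falling (nodes (staircase k)) r x = 0"
  by (auto simp: nodes_staircase node_falling_def poly_falling_poly_eq_0_iff)

text \<open>Downward induction on \<open>r + s\<close>: the recursion gives \<open>(r, s)\<close>
  from \<open>(r + 1, s)\<close> and \<open>(r, s + 1)\<close>, and everything vanishes once an
  index exceeds the largest node \<open>k\<close>.\<close>

lemma falling_pair_staircase:
  "(of_nat r + of_nat s) * falling_pair (nodes (staircase k)) r s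
    = (of_nat r - of_nat s) * (falling_value (casimir k) r * falling_value (casimir k) s)"
proof (induction "2 * k + 1 - (r + s)" arbitrary: r s rule: less_induct)
  case less
  let ?X = "nodes (staircase k)" and ?L = "falling_value (casimir k)"
  show ?case
  proof (cases "k < r \<or> k < s")
    case True
    then have "falling_pair ?X r s = 0"
      by (auto simp: falling_pair_def node_falling_staircase_eq_0 intro!: sum.neutral)
    moreover have "?L r * ?L s = 0"
      unfolding falling_sum_staircase[symmetric] falling_sum_def
      using True by (auto simp: node_falling_staircase_eq_0 intro!: sum.neutral)
    ultimately show ?thesis by simp
  next
    case False
    have nz: "of_nat n + 1 \<noteq> (0 :: complex)" for n by (metis of_nat_Suc of_nat_neq_0 add.commute)
    have "(of_nat (Suc r) + of_nat s) * falling_pair ?X (Suc r) s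
        = (of_nat (Suc r) - of_nat s) * (?L (Suc r) * ?L s)"
      "(of_nat r + of_nat (Suc s)) * falling_pair ?X r (Suc s)
        = (of_nat r - of_nat (Suc s)) * (?L r * ?L (Suc s))"
      using False by (intro less(1), linarith)+
    then show ?thesis
      using nz[of r] nz[of s] nz[of "r + s"] falling_pair_rec[OF refl, of "staircase k" r s]
      unfolding falling_sum_staircase
      by (intro falling_pair_algebra[of "of_nat r" "of_nat s" "falling_pair ?X (Suc r) s" "?L (Suc r)" "?L s"
            "falling_pair ?X r (Suc s)" "?L r" "?L (Suc s)" "casimir k"])
         (simp_all add: falling_value_Suc add_ac)
  qed
qed

lemma pair_prod_map: "pair_prod h (map f xs) = pair_prod (\<lambda>a b. h (f a) (f b)) xs"
  by (induction xs) (auto simp: comp_def)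

lemma pair_prod_eq_prod:
  "pair_prod h xs = (\<Prod>(i, j)\<in>{(i, j). i < j \<and> j < length xs}. h (xs ! i) (xs ! j))"
proof (induction xs)
  case (Cons x xs)
  let ?P = "{(i, j). i < j \<and> j < length xs}"
  have fin: "finite ?P"
    by (rule finite_subset[of _ "{..<length xs} \<times> {..<length xs}"]) auto
  have "{(i, j). i < j \<and> j < length (x # xs)} = (\<lambda>j. (0, Suc j)) ` {..<length xs} \<union> map_prod Suc Suc ` ?P"
  proof (intro equalityI subsetI)
    fix p assume "p \<in> {(i, j). i < j \<and> j < length (x # xs)}"
    then obtain i j where p: "p = (i, j)" "i < j" "j < Suc (length xs)" by auto
    then obtain j' where j': "j = Suc j'" by (cases j) auto
    show "p \<in> (\<lambda>j. (0, Suc j)) ` {..<length xs} \<union> map_prod Suc Suc ` ?P"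
      using p j' by (cases i) (auto simp: image_iff)
  qed auto
  moreover have "prod g ((\<lambda>j. (0, Suc j)) ` {..<length xs} \<union> map_prod Suc Suc ` ?P)
      = prod g ((\<lambda>j. (0, Suc j)) ` {..<length xs}) * prod g (map_prod Suc Suc ` ?P)" for g :: "nat \<times> nat \<Rightarrow> 'a"
    using fin by (intro prod.union_disjoint) auto
  moreover have "prod g ((\<lambda>j. (0, Suc j)) ` {..<length xs}) = (\<Prod>j<length xs. g (0, Suc j))" for g :: "nat \<times> nat \<Rightarrow> 'a"
    by (subst prod.reindex) (auto simp: inj_on_def)
  moreover have "prod g (map_prod Suc Suc ` ?P) = (\<Prod>(i, j)\<in>?P. g (Suc i, Suc j))" for g :: "nat \<times> nat \<Rightarrow> 'a"
    by (subst prod.reindex) (auto simp: inj_on_def map_prod_def case_prod_unfold)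
  moreover have "prod_list (map (h x) xs) = (\<Prod>j<length xs. h x (xs ! j))"
    by (simp add: prod.list_conv_set_nth atLeast0LessThan)
  ultimately show ?case using Cons by simp
qed simp

text \<open>The product formula as a polynomial expression in \<open>\<tau>\<close>, to be read at
  \<open>\<tau> = -t\<close>; the variable of \<open>falling_value\<close> is
  \<open>2 \<tau>\<close>.\<close>

definition weight :: "complex \<Rightarrow> nat list \<Rightarrow> complex"
  where "weight \<tau> \<mu> = 1 / 2 ^ length \<mu> * prod_list (map (falling_value (2 * \<tau>)) \<mu>)
    * pair_prod (\<lambda>a b. schur_kernel (of_nat a) (of_nat b)) \<mu>"

lemma value_at_staircase_factorial_P:
  assumes "strict_partition \<mu>"
  shows "value_at (staircase k) (factorial_P \<mu>) = weight (casimir k / 2) \<mu>"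
proof -
  let ?L = "falling_value (casimir k)" and ?h = "\<lambda>r s. schur_kernel (of_nat r) (of_nat s) :: complex"
  have "pfaffian (\<lambda>r s. value_at (staircase k) (factorial_Q2 r s)) (padded \<mu>)
    = pfaffian (\<lambda>r s. ?L r * ?L s * ?h r s) (padded \<mu>)"
  proof (intro pfaffian_cong sorted_wrt_padded assms)
    fix r s :: nat assume "r > 0"
    then have "of_nat r + of_nat s \<noteq> (0 :: complex)" by (metis add_is_0 of_nat_add of_nat_eq_0_iff less_irrefl)
    then show "value_at (staircase k) (factorial_Q2 r s) = ?L r * ?L s * ?h r s"
      using falling_pair_staircase[of r s k]
      unfolding value_at_factorial_Q2[OF strict_partition_staircase \<open>r > 0\<close>] falling_pair_def schur_kernel_def
      by (simp add: field_simps)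
  qed
  also have "\<dots> = prod_list (map ?L (padded \<mu>)) * pfaffian schur_kernel (map of_nat (padded \<mu>))"
    by (simp add: pfaffian_scale pfaffian_map)
  also have "pfaffian schur_kernel (map of_nat (padded \<mu>)) = pair_prod schur_kernel (map of_nat (padded \<mu>) :: complex list)"
  proof (rule schur_pfaffian)
    show "sorted_wrt (\<lambda>x y. x + y \<noteq> 0) (map of_nat (padded \<mu>) :: complex list)"
      unfolding sorted_wrt_map
      by (rule sorted_wrt_padded[OF assms]) (simp flip: of_nat_add)
  qed (simp add: even_length_padded)
  also have "\<dots> = pair_prod ?h \<mu>"
  proof -
    \<comment> \<open>The padding entry contributes the factors \<open>r / r\<close> to the pair
      product.\<close>
    have "?h r 0 = 1" if "r \<in> set \<mu>" for r
    proof -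
      have "r \<noteq> 0" using that assms by (metis strict_partition_def)
      then show ?thesis by (simp add: schur_kernel_def)
    qed
    then have "map (\<lambda>r. ?h r 0) \<mu> = map (\<lambda>_. 1) \<mu>" by (intro map_cong) auto
    then have "prod_list (map (\<lambda>r. ?h r 0) \<mu>) = prod_list (map (\<lambda>_. 1) \<mu>)" by (rule arg_cong)
    then have "prod_list (map (\<lambda>r. ?h r 0) \<mu>) = 1" by (simp add: map_replicate_const)
    then show ?thesis
      by (simp add: padded_def pair_prod_map pair_prod_append_Cons)
  qed
  also have "prod_list (map ?L (padded \<mu>)) = prod_list (map ?L \<mu>)"
    by (simp add: padded_def)
  finally show ?thesis
    by (simp add: factorial_P_def weight_def value_at_scale pfaffian_Gamma factorial_Q2_Gamma value_at_pfaffian)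
qed

lemma weight_minus:
  "weight (- of_real t) \<mu> = (- 1) ^ sum_list \<mu> * of_real (schur_weight t \<mu>)"
proof -
  \<comment> \<open>Every factor \<open>-2 t - (j - 1) j\<close> releases a sign, one for each box
    of a row of length \<open>r\<close>.\<close>
  have fv: "falling_value (2 * - of_real t) r
    = (- 1) ^ r * of_real ((\<Prod>j=1..r. 2 * t + (real j - 1) * real j) / fact r)" for r
  proof (induction r)
    case (Suc r)
    let ?w = "\<lambda>r. (\<Prod>j=1..r. 2 * t + (real j - 1) * real j) / fact r"
    have "?w (Suc r) = ?w r * ((2 * t + real r * (real r + 1)) / (real r + 1))"
      by (simp add: divide_simps mult_ac add_ac)
    then have "complex_of_real (?w (Suc r))
      = of_real (?w r) * of_real ((2 * t + real r * (real r + 1)) / (real r + 1))"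
      by (simp only: of_real_mult)
    moreover have "(2 * - of_real t - of_nat r * (of_nat r + 1)) / (of_nat r + 1)
      = - complex_of_real ((2 * t + real r * (real r + 1)) / (real r + 1))"
    proof -
      have e: "2 * - of_real t - of_nat r * (of_nat r + 1) = - complex_of_real (2 * t + real r * (real r + 1))"
        by simp
      show ?thesis unfolding e
        by (simp only: of_real_divide minus_divide_left of_real_add of_real_1 of_real_of_nat_eq)
    qed
    ultimately show ?case unfolding falling_value_Suc Suc by (simp only: power_Suc mult_ac) simp
  qed simp
  have "prod_list (map (falling_value (2 * - of_real t)) \<mu>)
    = (- 1) ^ sum_list \<mu> * (\<Prod>i<length \<mu>. of_real ((\<Prod>j=1..\<mu> ! i. 2 * t + (real j - 1) * real j) / fact (\<mu> ! i)))"
  proof -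
    have "prod_list (map (falling_value (2 * - of_real t)) \<mu>)
      = (- 1) ^ sum_list \<mu> * prod_list (map (\<lambda>r. of_real ((\<Prod>j=1..r. 2 * t + (real j - 1) * real j) / fact r)) \<mu>)"
    proof (induction \<mu>)
      case (Cons r \<mu>)
      show ?case
        unfolding list.map prod_list.Cons sum_list.Cons fv[of r] Cons power_add by (simp only: mult_ac)
    qed simp
    then show ?thesis by (simp add: prod.list_conv_set_nth atLeast0LessThan)
  qed
  moreover have "pair_prod (\<lambda>a b. schur_kernel (of_nat a) (of_nat b)) \<mu>
    = complex_of_real (\<Prod>(i, j)\<in>{(i, j). i < j \<and> j < length \<mu>}.
      (real (\<mu> ! i) - real (\<mu> ! j)) / (real (\<mu> ! i) + real (\<mu> ! j)))"
    by (simp add: pair_prod_eq_prod schur_kernel_def case_prod_unfold)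
  ultimately show ?thesis
    by (simp add: weight_def schur_weight_def prod_boxes prod_dividef mult_ac)
qed

section \<open>Interpolation\<close>

definition interpolates :: "complex poly \<Rightarrow> pser \<Rightarrow> bool"
  where "interpolates F f \<longleftrightarrow> (\<forall>k. poly F (casimir k / 2) = value_at (staircase k) f)"

text \<open>Staircases of different heights have different sizes, so two interpolating polynomials
  agree at infinitely many points.\<close>

lemma interpolates_unique:
  assumes "interpolates F f" "interpolates G f"
  shows "F = G"
proof (rule ccontr)
  assume "F \<noteq> G"
  then have "finite {x. poly (F - G) x = 0}" by (intro poly_roots_finite) simp
  moreover have "range (\<lambda>k. casimir k / 2) \<subseteq> {x. poly (F - G) x = 0}"
    using assms by (auto simp: interpolates_def)
  ultimately have "finite (range (\<lambda>k. casimir k / 2))" by (rule rev_finite_subset)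
  moreover have "inj (\<lambda>k. casimir k / 2)"
  proof (rule injI)
    fix k l assume "casimir k / 2 = casimir l / 2"
    then have "casimir k = casimir l" by simp
    then have "complex_of_nat (k * (k + 1)) = of_nat (l * (l + 1))" by (simp add: casimir_def algebra_simps)
    then have "k * (k + 1) = l * (l + 1)" by (simp only: of_nat_eq_iff)
    then show "k = l"
    proof (cases k l rule: linorder_cases)
      case less
      then have "k * (k + 1) < l * (l + 1)" by (intro mult_strict_mono) auto
      then show ?thesis using \<open>k * (k + 1) = l * (l + 1)\<close> by simp
    next
      case greater
      then have "l * (l + 1) < k * (k + 1)" by (intro mult_strict_mono) auto
      then show ?thesis using \<open>k * (k + 1) = l * (l + 1)\<close> by simp
    qed
  qed
  ultimately show False using finite_imageD by blast
qed

lemma interpolates_add: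
  "interpolates F f \<Longrightarrow> interpolates G g \<Longrightarrow> f \<in> Gamma \<Longrightarrow> g \<in> Gamma \<Longrightarrow> interpolates (F + G) (f + g)"
  by (simp add: interpolates_def value_at_add)

lemma interpolates_mult:
  "interpolates F f \<Longrightarrow> interpolates G g \<Longrightarrow> f \<in> Gamma \<Longrightarrow> g \<in> Gamma \<Longrightarrow> interpolates (F * G) (f * g)"
  by (simp add: interpolates_def value_at_mult)

lemma interpolates_scale:
  "interpolates F f \<Longrightarrow> f \<in> Gamma \<Longrightarrow> interpolates (smult c F) (scale c f)"
  by (simp add: interpolates_def value_at_scale)

lemma interpolates_one: "interpolates 1 1"
  by (simp add: interpolates_def)

definition falling_value_poly :: "nat \<Rightarrow> complex poly"
  where "falling_value_poly r = (\<Prod>j=1..r. smult (1 / of_nat j) [:- ((of_nat j - 1) * of_nat j), 2:])"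

lemma poly_falling_value_poly: "poly (falling_value_poly r) \<tau> = falling_value (2 * \<tau>) r"
  unfolding falling_value_poly_def falling_value_def poly_prod
  by (intro prod.cong refl) (auto simp: field_simps)

text \<open>The sums of a falling factorial of order \<open>s\<close> times \<open>x ^ n\<close> are
  treated for all \<open>s\<close> together: \<open>x\<close> times order \<open>s\<close> is order
  \<open>s + 1\<close> plus \<open>s\<close> times order \<open>s\<close>, which lowers
  \<open>n\<close> down to \<open>falling_sum_staircase\<close>. The case \<open>s = 0\<close> is
  \<open>q_n\<close>.\<close>

lemma ex_interpolates_schur_q: "\<exists>F. interpolates F (schur_q n)"
proof -
  have "\<exists>F. \<forall>k. poly F (casimir k / 2)
    = (\<Sum>x\<in>nodes (staircase k). node_falling (nodes (staircase k)) s x * x ^ n)" for s n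
  proof (induction n arbitrary: s)
    case 0
    show ?case
      by (intro exI[of _ "falling_value_poly s"])
         (simp add: poly_falling_value_poly falling_sum_def flip: falling_sum_staircase)
  next
    case (Suc n)
    from Suc[of "Suc s"] Suc[of s] obtain F G where
      F: "\<And>k. poly F (casimir k / 2)
        = (\<Sum>x\<in>nodes (staircase k). node_falling (nodes (staircase k)) (Suc s) x * x ^ n)" and
      G: "\<And>k. poly G (casimir k / 2)
        = (\<Sum>x\<in>nodes (staircase k). node_falling (nodes (staircase k)) s x * x ^ n)"
      by metis
    show ?case
      by (intro exI[of _ "F + smult (of_nat s) G"])
         (simp add: F G node_falling_def poly_falling_poly_Suc sum_distrib_left algebra_simps flip: sum.distrib)
  qed
  from this[of 0 n] show ?thesis
    by (simp add: interpolates_def value_at_schur_q strict_partition_staircase node_sum_def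
        node_falling_def falling_poly_def)
qed

lemma ex_interpolates_q_prod: "q_prod xs \<in> Gamma \<and> (\<exists>F. interpolates F (q_prod xs))"
proof (induction xs)
  case Nil
  then show ?case using interpolates_one by (auto simp: q_prod_def Gamma.one)
next
  case (Cons x xs)
  obtain F where "interpolates F (schur_q x)" using ex_interpolates_schur_q by blast
  moreover obtain G where "interpolates G (q_prod xs)" using Cons by blast
  ultimately show ?case
    using Cons interpolates_mult[of F "schur_q x" G "q_prod xs"] schur_q_Gamma[of x] Gamma.mult
    by (auto simp: q_prod_def)
qed

lemma ex_interpolates_Gamma:
  assumes "f \<in> Gamma"
  shows "\<exists>F. interpolates F f"
proof -
  obtain d where "degree_le f d" using Gamma_degree_le[OF assms] .
  then have "f \<in> pser.span (q_prod ` {\<kappa>. strict_partition \<kappa> \<and> sum_list \<kappa> < Suc d})"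
    using assms by (intro Gamma_span) (auto dest: degree_leD)
  then have "f \<in> Gamma \<and> (\<exists>F. interpolates F f)"
  proof (induction rule: pser.span_induct_alt)
    case base
    have "interpolates 0 0" by (simp add: interpolates_def)
    then show ?case using Gamma_zero by blast
  next
    case (step c x y)
    then obtain xs where x: "x = q_prod xs" by blast
    from ex_interpolates_q_prod[of xs] obtain F where F: "x \<in> Gamma" "interpolates F x" unfolding x by blast
    from step obtain G where G: "y \<in> Gamma" "interpolates G y" by blast
    have "interpolates (smult c F + G) (scale c x + y)"
      using F G by (intro interpolates_add interpolates_scale Gamma.scale)
    moreover have "scale c x + y \<in> Gamma" using F G by (intro Gamma.add Gamma.scale)
    ultimately show ?case by blast
  qed
  then show ?thesis by blast
qed

definition interpolation :: "pser \<Rightarrow> complex poly"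
  where "interpolation f = (SOME F. interpolates F f)"

lemma interpolates_interpolation: "f \<in> Gamma \<Longrightarrow> interpolates (interpolation f) f"
  unfolding interpolation_def by (rule someI_ex) (rule ex_interpolates_Gamma)

lemma interpolation_eqI: "interpolates F f \<Longrightarrow> interpolation f = F"
  unfolding interpolation_def by (rule some_equality) (auto intro: interpolates_unique)

lemma multiplicative_functional_interpolation:
  "multiplicative_functional (\<lambda>f. poly (interpolation f) \<tau>)"
proof -
  have "interpolation (f + g) = interpolation f + interpolation g"
    "interpolation (f * g) = interpolation f * interpolation g"
    "interpolation (scale c f) = smult c (interpolation f)"
    if "f \<in> Gamma" "g \<in> Gamma" for f g c
    using that
    by (auto intro!: interpolation_eqI interpolates_add interpolates_mult interpolates_scale interpolates_interpolation)
  moreover have "interpolation 1 = 1" by (rule interpolation_eqI) (rule interpolates_one)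
  ultimately show ?thesis by (simp add: multiplicative_functional_def)
qed

text \<open>The product formula is a polynomial in \<open>\<tau>\<close> with the right values at
  all staircases, so by uniqueness it is the interpolation itself.\<close>

lemma interpolation_factorial_P:
  assumes "strict_partition \<mu>"
  shows "poly (interpolation (factorial_P \<mu>)) \<tau> = weight \<tau> \<mu>"
proof -
  define F where "F = smult (1 / 2 ^ length \<mu> * pair_prod (\<lambda>a b. schur_kernel (of_nat a) (of_nat b)) \<mu>)
    (prod_list (map falling_value_poly \<mu>))"
  have "poly (prod_list (map falling_value_poly xs)) \<tau> = prod_list (map (falling_value (2 * \<tau>)) xs)" for xs \<tau>
    by (induction xs) (auto simp: poly_falling_value_poly)
  then have F: "poly F \<tau> = weight \<tau> \<mu>" for \<tau>
    by (simp add: F_def weight_def)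
  then have "interpolates F (factorial_P \<mu>)"
    using assms by (simp add: interpolates_def value_at_staircase_factorial_P)
  then show ?thesis using F by (simp add: interpolation_eqI)
qed

theorem theorem5p1:
  fixes t :: real
  assumes "t > 0"
  shows "positive_harmonic (phi t) \<and>
    (\<exists>\<pi>. multiplicative_functional \<pi> \<and>
      (\<forall>\<mu>. strict_partition \<mu> \<longrightarrow>
        \<pi> (factorial_schur_P \<mu>) = (- 1) ^ sum_list \<mu> * complex_of_real (schur_weight t \<mu>) \<and>
        complex_of_real (phi t \<mu>) =
          (- 1) ^ sum_list \<mu> * \<pi> (factorial_schur_P \<mu>) /
            complex_of_real (pochhammer t (sum_list \<mu>))))"
proof (intro conjI exI allI impI)
  let ?\<pi> = "\<lambda>f. poly (interpolation f) (- complex_of_real t)"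
  show "positive_harmonic (phi t)" using assms by (rule positive_harmonic_phi)
  show "multiplicative_functional ?\<pi>" by (rule multiplicative_functional_interpolation)
  fix \<mu> assume \<mu>: "strict_partition \<mu>"
  show *: "?\<pi> (factorial_schur_P \<mu>) = (- 1) ^ sum_list \<mu> * complex_of_real (schur_weight t \<mu>)"
    by (simp add: factorial_schur_P_eq interpolation_factorial_P \<mu> weight_minus)
  show "complex_of_real (phi t \<mu>) = (- 1) ^ sum_list \<mu> * ?\<pi> (factorial_schur_P \<mu>) /
      complex_of_real (pochhammer t (sum_list \<mu>))"
    unfolding * phi_def by (simp flip: mult.assoc power_mult_distrib)
qed

end
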